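(* Let $d=2$, let $K\subset\{2,3,4,\dots\}$, let $A_K=\{a_k\}_{k\in K}$ be a family of positive real numbers, and for each $k\in K$ let $I_k$ be a finite index set. Suppose that for each lattice $L=\mathbb{Z}u_1\oplus\mathbb{Z}u_2$ with Minkowski basis $\{u_1,u_2\}$ one is given points $p_{i,k}\in L$ ($k\in K$, $i\in I_k$) such that $$\forall k\in K,\ \forall i\in I_k,\qquad \frac{p_{i,k}}{k}= c_L \ \text{ modulo } L\ \Big(\text{i.e. } \frac{p_{i,k}}{k}-c_L\in L\Big),\qquad c_L:=\frac{u_1+u_2}{2}.$$ Then for every $f\in\mathcal{F}_2^{cm}$, the triangular lattice $\mathsf{A}_2$ is the unique minimizer in $\mathcal{L}_2(1)$ of $$E_f^\kappa[L]:=E_f[L]-\sum_{k\in K}\sum_{i\in I_k}a_kE_f[p_{i,k}+kL].$$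
   Context: A lattice in $\mathbb{R}^2$ is a set $L=\mathbb{Z}u_1\oplus\mathbb{Z}u_2$ with $\{u_1,u_2\}$ a basis of $\mathbb{R}^2$; $\mathcal{L}_2(V)$ is the set of lattices with $|\det(u_1,u_2)|=V$. A Minkowski basis is a Minkowski-reduced basis of $L$; $c_L$ is the center of the corresponding unit cell $Q_L=\{\lambda_1u_1+\lambda_2u_2:\lambda_i\in[0,1)\}$. For a lattice or translated lattice $X$, $E_f[X]:=\sum_{p\in X\setminus\{0\}}f(|p|^2)$. $\mathcal{F}_2^{cm}$ is the set of functions $f:\mathbb{R}_+\to\mathbb{R}$ of the form $f(r)=\int_0^\infty e^{-rt}\,d\mu_f(t)$ with $\mu_f$ a non-negative Radon measure on $\mathbb{R}_+$, and such that $|f(r)|=O(r^{-p_f})$ as $r\to\infty$ for some $p_f>1$. The symbol $\kappa$ denotes the data $(K,A_K,(p_{i,k}))$, assumed to be such that the sum over $K$ defining $E_f^\kappa$ is absolutely convergent. $\mathsf{A}_2$ is the dilation to unit volume of $\mathbb{Z}(1,0)\oplus\mathbb{Z}(1/2,\sqrt3/2)$. Minimizers and uniqueness are understood up to rotations.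
   Formalization: The function f is additionally assumed not to be identically zero on the positive reals; the zero function belongs to the class (with zero measure) and makes every lattice a minimizer, so uniqueness fails for it. *)

theory Defs
  imports "HOL-Analysis.Analysis" "HOL-Library.Landau_Symbols"
begin

definition lattice_basis :: "(real^2) set \<Rightarrow> real^2 \<Rightarrow> real^2 \<Rightarrow> bool" where
  "lattice_basis L u v \<longleftrightarrow>
     independent {u, v} \<and> span {u, v} = UNIV \<and>
     L = {of_int m *\<^sub>R u + of_int n *\<^sub>R v | m n :: int. True}"

definition is_lattice :: "(real^2) set \<Rightarrow> bool" where
  "is_lattice L \<longleftrightarrow> (\<exists>u v. lattice_basis L u v)"

definition lattices :: "real \<Rightarrow> (real^2) set set" where
  "lattices V = {L. \<exists>u v. lattice_basis L u v \<and> \<bar>det (vector [u, v] :: real^2^2)\<bar> = V}"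

text \<open>
  Minkowski reduction: each basis vector is shortest among those lattice vectors which,
  together with the preceding ones, extend to a basis of the lattice. No sign is imposed on
  the inner product of the two vectors: replacing \<open>v\<close> by \<open>- v\<close> changes the centre
  \<open>(u + v) / 2\<close> only by a lattice vector. A lattice may have Minkowski bases whose centres
  are inequivalent modulo the lattice (e.g. the triangular lattice).
\<close>

definition minkowski_basis :: "(real^2) set \<Rightarrow> real^2 \<Rightarrow> real^2 \<Rightarrow> bool" where
  "minkowski_basis L u v \<longleftrightarrow>
     lattice_basis L u v \<and>
     (\<forall>u' v'. lattice_basis L u' v' \<longrightarrow> norm u \<le> norm u') \<and>
     (\<forall>v'. lattice_basis L u v' \<longrightarrow> norm v \<le> norm v')"

definition cell_center :: "real^2 \<Rightarrow> real^2 \<Rightarrow> real^2" where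
  "cell_center u v = (1/2) *\<^sub>R (u + v)"

definition triangular_lattice :: "(real^2) set" where
  "triangular_lattice =
     (\<lambda>x. sqrt (2 / sqrt 3) *\<^sub>R x) `
       {of_int m *\<^sub>R vector [1, 0] + of_int n *\<^sub>R vector [1/2, sqrt 3 / 2] | m n :: int. True}"

lemma triangular_lattice_in_lattices: "triangular_lattice \<in> lattices 1"
proof -
  define s where "s = sqrt (2 / sqrt 3)"
  define u v :: "real^2" where "u = s *\<^sub>R vector [1, 0]" and "v = s *\<^sub>R vector [1/2, sqrt 3 / 2]"
  have s: "s > 0" by (simp add: s_def)
  have s2: "s * s = 2 / sqrt 3" by (simp add: s_def)
  have "det (vector [u, v] :: real^2^2) = s * s * (sqrt 3 / 2)"
    by (simp add: det_2 u_def v_def)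
  then have det: "det (vector [u, v] :: real^2^2) = 1" by (simp add: s2)
  have rep: "x = (x$1 / s - x$2 / (s * sqrt 3)) *\<^sub>R u + (2 * x$2 / (s * sqrt 3)) *\<^sub>R v" for x
    using s by (simp add: vec_eq_iff forall_2 u_def v_def field_simps)
  have span: "span {u, v} = UNIV"
  proof (intro equalityI subsetI)
    fix x
    show "x \<in> span {u, v}"
      by (subst rep[of x]) (intro span_add span_scale span_base; simp)
  qed simp
  have "u $ 2 = 0" "v $ 2 \<noteq> 0" using s by (simp_all add: u_def v_def)
  then have "u \<noteq> v" by auto
  then have indep: "independent {u, v}"
    by (intro card_le_dim_spanning[where V = UNIV]) (auto simp: span dim_UNIV)
  have "s *\<^sub>R (of_int m *\<^sub>R vector [1, 0] + of_int n *\<^sub>R vector [1/2, sqrt 3 / 2])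
      = of_int m *\<^sub>R u + of_int n *\<^sub>R v" for m n :: int
    by (simp add: u_def v_def scaleR_add_right mult.commute)
  then have "triangular_lattice = {of_int m *\<^sub>R u + of_int n *\<^sub>R v | m n :: int. True}"
    unfolding triangular_lattice_def s_def[symmetric] image_Collect by (intro Collect_cong) metis
  then have "lattice_basis triangular_lattice u v"
    unfolding lattice_basis_def using span indep by (intro conjI)
  with det show ?thesis unfolding lattices_def by force
qed

text \<open>
  On the half-line every locally finite Borel measure is automatically regular, so finiteness
  on compact sets is all that the Radon property requires.
\<close>

definition radon_measure_half_line :: "real measure \<Rightarrow> bool" where
  "radon_measure_half_line \<mu> \<longleftrightarrow>
     sets \<mu> = sets (restrict_space borel {0..}) \<and>
     (\<forall>C. compact C \<and> C \<subseteq> {0..} \<longrightarrow> emeasure \<mu> C < \<infinity>)"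

text \<open>
  Potentials are only evaluated at squared norms of nonzero points, so they are constrained
  on \<open>r > 0\<close> only; in particular inverse powers, singular at the origin, are included.
\<close>

definition cm_potentials :: "(real \<Rightarrow> real) set" where
  "cm_potentials =
     {f. (\<exists>\<mu>. radon_measure_half_line \<mu> \<and>
            (\<forall>r>0. has_bochner_integral \<mu> (\<lambda>t. exp (- (r * t))) (f r))) \<and>
         (\<exists>q>1. f \<in> O[at_top](\<lambda>r. r powr (- q)))}"

definition energy :: "(real \<Rightarrow> real) \<Rightarrow> (real^2) set \<Rightarrow> real" where
  "energy f X = (\<Sum>\<^sub>\<infinity>x\<in>X - {0}. f ((norm x)\<^sup>2))"

definition translated_sublattice :: "real^2 \<Rightarrow> nat \<Rightarrow> (real^2) set \<Rightarrow> (real^2) set" where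
  "translated_sublattice q k L = (\<lambda>x. q + real k *\<^sub>R x) ` L"

definition defect_term ::
  "(real \<Rightarrow> real) \<Rightarrow> (nat \<Rightarrow> real) \<Rightarrow> (nat \<Rightarrow> 'i set) \<Rightarrow>
   ((real^2) set \<Rightarrow> 'i \<Rightarrow> nat \<Rightarrow> real^2) \<Rightarrow> (real^2) set \<Rightarrow> nat \<Rightarrow> real" where
  "defect_term f a I p L k =
     (\<Sum>i\<in>I k. a k * energy f (translated_sublattice (p L i k) k L))"

definition defect_energy ::
  "(real \<Rightarrow> real) \<Rightarrow> nat set \<Rightarrow> (nat \<Rightarrow> real) \<Rightarrow> (nat \<Rightarrow> 'i set) \<Rightarrow>
   ((real^2) set \<Rightarrow> 'i \<Rightarrow> nat \<Rightarrow> real^2) \<Rightarrow> (real^2) set \<Rightarrow> real" where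
  "defect_energy f K a I p L = energy f L - (\<Sum>\<^sub>\<infinity>k\<in>K. defect_term f a I p L k)"

end

theory Submission
  imports Defs "HOL-Probability.Probability"
begin

text \<open>
  Writing \<open>f\<close> as a Laplace transform reduces the claim to Gaussians: at every inverse temperature
  \<open>\<alpha>\<close> the theta function of a unit lattice has to be smallest, and the theta function of the lattice
  translated by its cell centre largest, at the triangular lattice; \<open>p + k L\<close> is the \<open>k\<close>-fold dilate
  of \<open>c\<^sub>L + L\<close>. Reduced lattices are parametrised by \<open>x + \<i> y\<close> with \<open>\<bar>x\<bar> \<le> 1/2\<close> and \<open>x\<^sup>2 + y\<^sup>2 \<ge> 1\<close>, and
  one moves first to \<open>x = 1/2\<close> at fixed \<open>y\<close>, then down to \<open>y = sqrt 3 / 2\<close>.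

  For the first move, Poisson summation in one variable turns both theta functions into sums of
  one-dimensional theta functions. By the triple product these are limits of products of affine
  functions of \<open>cos (2 pi b)\<close> with nonnegative coefficients, so any two of their difference
  quotients are comparable, and the first terms of the sums decide. For the second move, the
  centred theta function is a product of two values of \<open>\<theta>\<^sub>4\<close>, each factor of whose infinite product
  is monotone; for the lattice itself, each Gaussian is compared with its tangent at the
  triangular lattice, where the symmetry of order three cancels the first-order terms.
\<close>

section \<open>Sums over the integers\<close>

text \<open>Absolute bounds on theta functions cannot decide the first move: near x = 1/2 all
  differences vanish, and at extreme temperatures they are exponentially small. Everything is
  therefore measured against one difference quotient. The price is the ratio of two slopes: exp (pi
  / (4 * X)) for \<open>th3\<close> as a function of cos (2 pi b), and exp (3 * pi / (4 * X)) for
  \<open>th2\<close> as a function of cos (pi b). With a = alpha * y and X = y / alpha, a reduced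
  basis gives a * X = y^2 >= 3/4. This bounds the price by an exponential weaker than the decay from
  one term to the next, and makes a or X at least 0.866. \<open>Phi\<close> is symmetric in a and X,
  so one estimate serves both cases; \<open>Psi\<close> is not, and its second case requires
  \<open>th2\<close>. In the second move the functional equation of \<open>theta\<close> allows
  alpha >= 1, where 2 pi / sqrt 3 > 18/5 leaves room for explicit tails. Strictness comes from the
  lattice term alone; the defect terms only need weak maximality. Everything is even in x, so it
  does not matter which Minkowski basis supplies the centre.\<close>

abbreviation gauss :: "real \<Rightarrow> real \<Rightarrow> real" where
  "gauss a t \<equiv> exp (- (pi * a * t\<^sup>2))"

abbreviation dual_gauss :: "real \<Rightarrow> real \<Rightarrow> real" where
  "dual_gauss X t \<equiv> exp (- (pi * t\<^sup>2 / X))"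

text \<open>Lebesgue's theorem for \<open>count_space A\<close>, where integrability is absolute
  summability. It serves the passage from the finite to the infinite triple product.\<close>

lemma infsum_dominated_convergence:
  fixes f :: "nat \<Rightarrow> 'a \<Rightarrow> 'b::{banach, second_countable_topology}"
  assumes h: "h summable_on A"
    and lim: "\<And>x. x \<in> A \<Longrightarrow> (\<lambda>n. f n x) \<longlonglongrightarrow> g x"
    and bound: "\<And>n x. x \<in> A \<Longrightarrow> norm (f n x) \<le> (h x :: real)"
  shows "(\<lambda>n. infsum (f n) A) \<longlonglongrightarrow> infsum g A"
proof -
  have gb: "norm (g x) \<le> h x" if "x \<in> A" for x
    by (rule tendsto_upperbound[OF tendsto_norm[OF lim[OF that]]]) (auto simp: bound that)
  have hn: "0 \<le> h x" if "x \<in> A" for x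
    using gb[OF that] norm_ge_zero order_trans by blast
  have hs: "integrable (count_space A) h"
  proof -
    have "(\<lambda>x. norm (h x)) summable_on A"
      using h summable_on_iff_abs_summable_on_real by blast
    then show ?thesis using abs_summable_equivalent abs_summable_on_def by blast
  qed
  have fs: "integrable (count_space A) (f n)" for n
    by (rule Bochner_Integration.integrable_bound[OF hs]) (auto simp: AE_count_space bound hn)
  have gs: "integrable (count_space A) g"
    by (rule Bochner_Integration.integrable_bound[OF hs]) (auto simp: AE_count_space gb hn)
  have "(\<lambda>n. integral\<^sup>L (count_space A) (f n)) \<longlonglongrightarrow> integral\<^sup>L (count_space A) g"
    by (rule integral_dominated_convergence[OF _ _ hs])
       (auto simp: AE_count_space lim bound)
  moreover have "integral\<^sup>L (count_space A) (f n) = infsum (f n) A" for n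
    using infsetsum_infsum[of "f n" A] fs[of n] by (simp add: infsetsum_def abs_summable_on_def)
  moreover have "integral\<^sup>L (count_space A) g = infsum g A"
    using infsetsum_infsum[of g A] gs by (simp add: infsetsum_def abs_summable_on_def)
  ultimately show ?thesis by simp
qed

lemma summable_on_nat_abs:
  fixes h :: "nat \<Rightarrow> real"
  assumes h: "h summable_on UNIV"
  shows "(\<lambda>k::int. h (nat \<bar>k\<bar>)) summable_on UNIV"
proof -
  have "(\<lambda>k::int. h (nat \<bar>k\<bar>)) summable_on range int"
    by (subst summable_on_reindex) (auto simp: o_def h)
  moreover have "(\<lambda>k::int. h (nat \<bar>k\<bar>)) summable_on range (\<lambda>n. - int n)"
    by (subst summable_on_reindex) (auto simp: o_def h inj_on_def)
  ultimately have "(\<lambda>k::int. h (nat \<bar>k\<bar>)) summable_on (range int \<union> range (\<lambda>n. - int n))"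
    by (rule summable_on_union)
  moreover have "range int \<union> range (\<lambda>n. - int n) = UNIV"
  proof -
    have "x \<in> range int \<union> range (\<lambda>n. - int n)" for x :: int
      by (cases "0 \<le> x") (auto intro: range_eqI[of _ _ "nat x"] range_eqI[of _ _ "nat (- x)"])
    then show ?thesis by blast
  qed
  ultimately show ?thesis by simp
qed

lemma summable_on_int_geometric:
  fixes c :: real
  assumes "0 \<le> c" "c < 1"
  shows "(\<lambda>k::int. c ^ nat \<bar>k\<bar>) summable_on UNIV"
  using assms by (intro summable_on_nat_abs summable_nonneg_imp_summable_on) (auto intro: summable_geometric)

lemma summable_on_exp_abs:
  fixes c :: real
  assumes "c > 0"
  shows "(\<lambda>k::int. exp (- (c * \<bar>real_of_int k\<bar>))) summable_on UNIV"
proof -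
  have "exp (- (c * \<bar>real_of_int k\<bar>)) = exp (- c) ^ nat \<bar>k\<bar>" for k :: int
    by (simp add: exp_of_nat_mult[symmetric] mult.commute)
  then show ?thesis using summable_on_int_geometric[of "exp (-c)"] assms by simp
qed

text \<open>Follows from |z| <= z^2 + 1 at z = k + b. The bound is uniform for b in a bounded
  interval, as the M-test for theta series in b requires.\<close>

lemma gauss_le_exp_abs:
  fixes c b R :: real
  assumes "c > 0" "\<bar>b\<bar> \<le> R"
  shows "exp (- (c * (of_int k + b)\<^sup>2)) \<le> exp (c + c * R) * exp (- (c * \<bar>of_int k\<bar>))"
proof -
  have "\<bar>real_of_int k\<bar> \<le> \<bar>k + b\<bar> + \<bar>b\<bar>" by linarith
  also have "\<bar>k + b\<bar> \<le> (k + b)\<^sup>2 + 1"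
  proof -
    have "0 \<le> (\<bar>k + b\<bar> - 1)\<^sup>2 + \<bar>k + b\<bar>" by simp
    then show ?thesis by (simp add: power2_diff)
  qed
  finally have "c * \<bar>real_of_int k\<bar> \<le> c * ((k + b)\<^sup>2 + 1 + R)"
    using assms by (intro mult_left_mono) auto
  then show ?thesis by (simp add: exp_add[symmetric] algebra_simps)
qed

lemma summable_on_gauss:
  fixes c b :: real
  assumes "c > 0"
  shows "(\<lambda>k::int. exp (- (c * (of_int k + b)\<^sup>2))) summable_on UNIV"
proof (rule summable_on_comparison_test)
  show "(\<lambda>k::int. exp (c + c * \<bar>b\<bar>) * exp (- (c * \<bar>of_int k\<bar>))) summable_on UNIV"
    by (intro summable_on_cmult_right summable_on_exp_abs assms)
qed (use assms in \<open>auto intro!: gauss_le_exp_abs\<close>)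

lemma summable_on_gauss0:
  fixes c :: real
  assumes "c > 0"
  shows "(\<lambda>k::int. exp (- (c * (real_of_int k)\<^sup>2))) summable_on UNIV"
  using summable_on_gauss[OF assms, of 0] by simp

lemma
  fixes f g :: "'a \<Rightarrow> real"
  assumes "f summable_on A" "g summable_on A"
  shows summable_on_diff: "(\<lambda>x. f x - g x) summable_on A"
    and infsum_diff: "(\<Sum>\<^sub>\<infinity>x\<in>A. f x - g x) = infsum f A - infsum g A"
proof -
  have "(\<lambda>x. - g x) summable_on A" using assms(2) by (rule summable_on_uminus[THEN iffD2])
  then show "(\<lambda>x. f x - g x) summable_on A" "(\<Sum>\<^sub>\<infinity>x\<in>A. f x - g x) = infsum f A - infsum g A"
    using summable_on_add[of f A "\<lambda>x. - g x"] infsum_add[of f A "\<lambda>x. - g x"] assms(1)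
    by (simp_all add: infsum_uminus)
qed

lemma summable_on_bounded_mult:
  fixes f g :: "'a \<Rightarrow> real"
  assumes "f summable_on A" "\<And>x. x \<in> A \<Longrightarrow> 0 \<le> f x" "\<And>x. x \<in> A \<Longrightarrow> \<bar>g x\<bar> \<le> B"
  shows "(\<lambda>x. f x * g x) summable_on A"
proof -
  have "(\<lambda>x. \<bar>f x * g x\<bar>) summable_on A"
  proof (rule summable_on_comparison_test)
    show "(\<lambda>x. f x * B) summable_on A" by (intro summable_on_cmult_left assms)
  qed (use assms in \<open>auto simp: abs_mult intro: mult_left_mono\<close>)
  then show ?thesis
    using summable_on_iff_abs_summable_on_real by fastforce
qed

lemma infsum_reflect_int:
  fixes f :: "int \<Rightarrow> 'a::{comm_monoid_add, topological_space, t2_space}"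
  shows "(\<Sum>\<^sub>\<infinity>k. f (- k)) = (\<Sum>\<^sub>\<infinity>k. f k)"
  by (rule infsum_reindex_bij_witness[of _ uminus uminus]) auto

lemma infsum_shift_int:
  fixes f :: "int \<Rightarrow> 'a::{comm_monoid_add, topological_space, t2_space}"
  shows "(\<Sum>\<^sub>\<infinity>k. f (k + j)) = (\<Sum>\<^sub>\<infinity>k. f k)"
  by (rule infsum_reindex_bij_witness[of _ "\<lambda>k. k - j" "\<lambda>k. k + j"]) auto

section \<open>Poisson summation for Gaussians\<close>

text \<open>The Weierstrass M-test gives uniform convergence along finite subsets, under which both
  continuity and the integral pass to the limit.\<close>

lemma integral_infsum:
  fixes f :: "'a \<Rightarrow> real \<Rightarrow> real"
  assumes M: "M summable_on UNIV" and le: "\<And>k x. x \<in> {l..u} \<Longrightarrow> \<bar>f k x\<bar> \<le> M k"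
    and c: "\<And>k. continuous_on {l..u} (f k)"
  shows "((\<lambda>k. integral {l..u} (f k)) has_sum integral {l..u} (\<lambda>x. \<Sum>\<^sub>\<infinity>k. f k x)) UNIV"
    and "continuous_on {l..u} (\<lambda>x. \<Sum>\<^sub>\<infinity>k. f k x)"
proof -
  have ul: "uniform_limit {l..u} (\<lambda>X x. \<Sum>k\<in>X. f k x) (\<lambda>x. \<Sum>\<^sub>\<infinity>k. f k x) (finite_subsets_at_top UNIV)"
    using le by (intro Weierstrass_m_test_general[OF _ M]) auto
  have cs: "continuous_on {l..u} (\<lambda>x. \<Sum>k\<in>X. f k x)" for X
    by (intro continuous_on_sum c)
  show "continuous_on {l..u} (\<lambda>x. \<Sum>\<^sub>\<infinity>k. f k x)"
    by (rule uniform_limit_theorem[OF _ ul]) (auto intro: cs)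
  obtain I J where I: "\<And>X. ((\<lambda>x. \<Sum>k\<in>X. f k x) has_integral I X) {l..u}"
    and J: "((\<lambda>x. \<Sum>\<^sub>\<infinity>k. f k x) has_integral J) {l..u}" and IJ: "(I \<longlongrightarrow> J) (finite_subsets_at_top UNIV)"
    using uniform_limit_integral[OF ul cs] by auto
  have "((\<lambda>X. \<Sum>k\<in>X. integral {l..u} (f k)) \<longlongrightarrow> J) (finite_subsets_at_top UNIV)"
  proof (rule Lim_transform_eventually[OF IJ])
    show "\<forall>\<^sub>F X in finite_subsets_at_top UNIV. I X = (\<Sum>k\<in>X. integral {l..u} (f k))"
    proof (rule eventually_finite_subsets_at_top_weakI)
      fix X :: "'a set" assume "finite X"
      then have "integral {l..u} (\<lambda>x. \<Sum>k\<in>X. f k x) = (\<Sum>k\<in>X. integral {l..u} (f k))"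
        by (intro integral_sum) (auto intro: integrable_continuous_real c)
      with I[of X] show "I X = (\<Sum>k\<in>X. integral {l..u} (f k))"
        by (simp add: integral_unique)
    qed
  qed
  with J show "((\<lambda>k. integral {l..u} (f k)) has_sum integral {l..u} (\<lambda>x. \<Sum>\<^sub>\<infinity>k. f k x)) UNIV"
    by (simp add: has_sum_def integral_unique)
qed

lemma periodic_int:
  fixes D :: "real \<Rightarrow> 'a"
  assumes "\<And>b. D (b + 1) = D b"
  shows "D (b + of_int n) = D b"
proof (induction n rule: int_induct[of _ 0])
  case base then show ?case by simp
next
  case (step1 i) then show ?case using assms[of "b + of_int i"] by (simp add: add.assoc)
next
  case (step2 i) then show ?case using assms[of "b + of_int (i - 1)"] by simp
qed

text \<open>An even function of period \<open>1\<close> is a continuous function of \<open>cos (2 * pi * b)\<close>, so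
  Weierstrass approximation on an interval replaces trigonometric approximation on the circle.\<close>

lemma cosine_coefficients_zero:
  fixes D :: "real \<Rightarrow> real"
  assumes cont: "continuous_on UNIV D" and per: "\<And>b. D (b + 1) = D b" and even: "\<And>b. D (- b) = D b"
    and zero: "\<And>k::int. integral {0..1} (\<lambda>b. D b * cos (2 * pi * of_int k * b)) = 0"
  shows "D b = 0"
proof -
  define t where "t = (\<lambda>b. (1 + cos (2 * pi * b)) / 2)"
  \<comment> \<open>\<open>Z\<close> holds for the multipliers that keep all cosine coefficients of
    \<open>D\<close> zero. By the product-to-sum formula it is stable under multiplication by affine
    functions of cos (2 pi b), hence it holds for all polynomials built as such products.\<close>
  define Z where "Z = (\<lambda>\<phi>. continuous_on UNIV \<phi> \<and>
    (\<forall>k::int. integral {0..1} (\<lambda>b. D b * \<phi> b * cos (2 * pi * of_int k * b)) = 0))"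
  have int: "(\<lambda>b. D b * \<phi> b) integrable_on {0..1}" if "continuous_on UNIV \<phi>" for \<phi>
    by (intro integrable_continuous_real continuous_intros continuous_on_subset[OF cont]
        continuous_on_subset[OF that]) auto
  have int2: "(\<lambda>b. D b * \<phi> b * cos (2 * pi * of_int k * b)) integrable_on {0..1}"
    if "continuous_on UNIV \<phi>" for \<phi> and k :: int
    by (intro integrable_continuous_real continuous_intros continuous_on_subset[OF cont]
        continuous_on_subset[OF that]) auto
  have Z1: "Z (\<lambda>_. 1)" using zero by (simp add: Z_def)
  have Zm: "Z (\<lambda>b. \<phi> b * (p + q * cos (2 * pi * b)))" if "Z \<phi>" for \<phi> p q
    unfolding Z_def
  proof (intro conjI allI)
    have c: "continuous_on UNIV \<phi>" using that by (simp add: Z_def)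
    then show "continuous_on UNIV (\<lambda>b. \<phi> b * (p + q * cos (2 * pi * b)))"
      by (intro continuous_intros)
    fix k :: int
    have "D b * (\<phi> b * (p + q * cos (2 * pi * b))) * cos (2 * pi * of_int k * b)
       = p * (D b * \<phi> b * cos (2 * pi * of_int k * b))
       + (q / 2 * (D b * \<phi> b * cos (2 * pi * of_int (k + 1) * b))
       + q / 2 * (D b * \<phi> b * cos (2 * pi * of_int (k - 1) * b)))" for b
    proof -
      have "cos (2 * pi * of_int (k + 1) * b) + cos (2 * pi * of_int (k - 1) * b)
        = 2 * cos (2 * pi * of_int k * b) * cos (2 * pi * b)"
        by (simp add: algebra_simps cos_add cos_diff)
      then show ?thesis by algebra
    qed
    then have "integral {0..1} (\<lambda>b. D b * (\<phi> b * (p + q * cos (2 * pi * b))) * cos (2 * pi * of_int k * b))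
      = integral {0..1} (\<lambda>b. p * (D b * \<phi> b * cos (2 * pi * of_int k * b))
       + (q / 2 * (D b * \<phi> b * cos (2 * pi * of_int (k + 1) * b))
       + q / 2 * (D b * \<phi> b * cos (2 * pi * of_int (k - 1) * b))))" by simp
    also have "\<dots> = 0"
    proof -
      have h: "((\<lambda>b. D b * \<phi> b * cos (2 * pi * of_int j * b)) has_integral 0) {0..1}" for j :: int
        using that int2[OF c, of j] unfolding Z_def by (auto simp: has_integral_iff)
      show ?thesis
        using has_integral_add[OF has_integral_mult_right[OF h[of k], of p]
            has_integral_add[OF has_integral_mult_right[OF h[of "k + 1"], of "q / 2"]
              has_integral_mult_right[OF h[of "k - 1"], of "q / 2"]]]
        by (auto dest: integral_unique)
    qed
    finally show "integral {0..1} (\<lambda>b. D b * (\<phi> b * (p + q * cos (2 * pi * b))) * cos (2 * pi * of_int k * b)) = 0" .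
  qed
  have Zp: "Z (\<lambda>b. \<phi> b * (p + q * cos (2 * pi * b)) ^ j)" if "Z \<phi>" for \<phi> p q j
  proof (induction j)
    case (Suc j) then show ?case using Zm[OF Suc, of p q] by (simp add: mult_ac)
  qed (use that in simp)
  have Zint: "integral {0..1} (\<lambda>b. D b * \<phi> b) = 0" if "Z \<phi>" for \<phi>
    using that unfolding Z_def by (auto dest!: spec[of _ 0])
  \<comment> \<open>With t = (1 + cos) / 2, both t and 1 - t are affine in the cosine, so a
    Bernstein polynomial in t is a product of admissible factors.\<close>
  have ZB: "Z (\<lambda>b. Bernstein n k (t b))" for n k
  proof -
    have "Z (\<lambda>b. 1 * (real (n choose k) + 0 * cos (2 * pi * b)) ^ 1 * (1/2 + 1/2 * cos (2 * pi * b)) ^ k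
      * (1/2 + (-1/2) * cos (2 * pi * b)) ^ (n - k))"
      by (intro Zp Z1)
    also have "(\<lambda>b. 1 * (real (n choose k) + 0 * cos (2 * pi * b)) ^ 1 * (1/2 + 1/2 * cos (2 * pi * b)) ^ k
      * (1/2 + (-1/2) * cos (2 * pi * b)) ^ (n - k)) = (\<lambda>b. Bernstein n k (t b))"
      by (auto simp: Bernstein_def t_def fun_eq_iff diff_divide_distrib add_divide_distrib)
    finally show ?thesis .
  qed
  \<comment> \<open>\<open>d\<close> expresses \<open>D\<close> through t on [0, 1]; evenness and
    periodicity make this independent of the branch chosen by arccos.\<close>
  define d where "d = (\<lambda>s. D (arccos (2 * s - 1) / (2 * pi)))"
  have "continuous_on {0..1} d"
    unfolding d_def
    by (rule continuous_on_compose2[OF cont]) (auto intro!: continuous_intros)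
  have dt: "d (t b) = D b" for b
  proof -
    have "cos (2 * pi * b) = cos (arccos (cos (2 * pi * b)))" by (simp add: cos_arccos)
    then obtain n where n: "n \<in> \<int>" and
      "arccos (cos (2 * pi * b)) = 2 * pi * b + 2 * n * pi \<or> arccos (cos (2 * pi * b)) = - (2 * pi * b) + 2 * n * pi"
      using cos_eq by metis
    then have "arccos (cos (2 * pi * b)) / (2 * pi) = b + n \<or> arccos (cos (2 * pi * b)) / (2 * pi) = - b + n"
      by (auto simp: field_simps)
    moreover obtain i where "n = of_int i" using n by (auto simp: Ints_def)
    ultimately have "D (arccos (cos (2 * pi * b)) / (2 * pi)) = D b"
      using periodic_int[of D, OF per, of b i] periodic_int[of D, OF per, of "- b" i] even[of b] by auto
    then show ?thesis by (simp add: d_def t_def add_divide_distrib)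
  qed
  have t01: "t b \<in> {0..1}" for b
  proof -
    have aux: "(1 + c) / 2 \<in> {0..1}" if "- 1 \<le> c" "c \<le> 1" for c :: real
      using that by auto
    then show ?thesis unfolding t_def by (intro aux cos_ge_minus_one cos_le_one)
  qed
  define B where "B = integral {0..1} (\<lambda>b. \<bar>D b\<bar>)"
  have iabs: "(\<lambda>b. \<bar>D b\<bar>) integrable_on {0..1}"
    by (intro integrable_continuous_real continuous_intros continuous_on_subset[OF cont]) auto
  have B0: "B \<ge> 0" unfolding B_def by (intro integral_nonneg iabs) auto
  have small: "integral {0..1} (\<lambda>b. D b * D b) \<le> e * B" if e: "e > 0" for e
  proof -
    obtain N where N: "\<And>n s. N \<le> n \<Longrightarrow> s \<in> {0..1} \<Longrightarrow> \<bar>d s - (\<Sum>k\<le>n. d (k / n) * Bernstein n k s)\<bar> < e"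
      using Bernstein_Weierstrass[OF \<open>continuous_on {0..1} d\<close> e] by blast
    define p where "p = (\<lambda>b. \<Sum>k\<le>N. d (k / N) * Bernstein N k (t b))"
    have pc: "continuous_on UNIV (\<lambda>b. Bernstein N k (t b))" for k using ZB by (simp add: Z_def)
    have p0: "integral {0..1} (\<lambda>b. D b * p b) = 0"
    proof -
      have "integral {0..1} (\<lambda>b. D b * p b) = integral {0..1} (\<lambda>b. \<Sum>k\<le>N. d (k / N) * (D b * Bernstein N k (t b)))"
        by (simp add: p_def sum_distrib_left mult_ac)
      also have "\<dots> = (\<Sum>k\<le>N. integral {0..1} (\<lambda>b. d (k / N) * (D b * Bernstein N k (t b))))"
        by (intro integral_sum finite_atMost integrable_on_mult_right int pc)
      also have "\<dots> = 0" by (simp add: Zint[OF ZB])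
      finally show ?thesis .
    qed
    have ip: "(\<lambda>b. D b * p b) integrable_on {0..1}"
      unfolding p_def by (intro int continuous_intros pc)
    have iDD: "(\<lambda>b. D b * D b) integrable_on {0..1}" by (intro int cont)
    \<comment> \<open>Orthogonality of \<open>D\<close> to the approximant p allows p to be
      subtracted at no cost, and D - p is uniformly at most e.\<close>
    have "integral {0..1} (\<lambda>b. D b * D b) = integral {0..1} (\<lambda>b. D b * D b - D b * p b)"
      by (simp add: integral_diff[OF iDD ip] p0)
    also have "\<dots> \<le> integral {0..1} (\<lambda>b. e * \<bar>D b\<bar>)"
    proof (rule integral_le)
      fix b :: real assume "b \<in> {0..1}"
      have "\<bar>D b - p b\<bar> \<le> e"
        using N[OF order_refl t01[of b]] by (simp add: p_def dt)
      then have "\<bar>D b\<bar> * \<bar>D b - p b\<bar> \<le> \<bar>D b\<bar> * e" by (intro mult_left_mono) auto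
      moreover have "D b * D b - D b * p b \<le> \<bar>D b\<bar> * \<bar>D b - p b\<bar>"
        by (metis abs_ge_self abs_mult right_diff_distrib)
      ultimately show "D b * D b - D b * p b \<le> e * \<bar>D b\<bar>" by (simp add: mult.commute)
    qed (intro integrable_diff iDD ip integrable_on_mult_right iabs)+
    also have "\<dots> = e * B" by (simp add: B_def)
    finally show ?thesis .
  qed
  have "integral {0..1} (\<lambda>b. D b * D b) \<le> 0"
  proof (rule field_le_epsilon)
    fix e :: real assume "e > 0"
    have "integral {0..1} (\<lambda>b. D b * D b) \<le> e / (B + 1) * B"
      using B0 \<open>e > 0\<close> by (intro small) auto
    also have "\<dots> \<le> e" using B0 \<open>e > 0\<close> by (simp add: field_simps)
    finally show "integral {0..1} (\<lambda>b. D b * D b) \<le> 0 + e" by simp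
  qed
  moreover have "integral {0..1} (\<lambda>b. D b * D b) \<ge> 0"
    by (intro integral_nonneg int cont) auto
  ultimately have "integral {0..1} (\<lambda>b. D b * D b) = 0" by simp
  then have z: "\<forall>b\<in>{0..1}. D b * D b = 0"
    by (subst (asm) integral_eq_0_iff) (auto intro!: continuous_intros continuous_on_subset[OF cont])
  have "D b = D (b + of_int (- \<lfloor>b\<rfloor>))" by (rule periodic_int[of D, OF per, symmetric])
  also have "b + of_int (- \<lfloor>b\<rfloor>) \<in> {0..1}" by simp linarith
  then have "D (b + of_int (- \<lfloor>b\<rfloor>)) = 0" using z by (metis mult_eq_0_iff)
  finally show ?thesis .
qed

text \<open>This is the characteristic function of the standard normal distribution after the
  substitution t -> s * t with s^2 = 2 pi / X.\<close>

lemma gauss_cosine_integral: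
  assumes "X > 0"
  shows "has_bochner_integral lborel (\<lambda>t. exp (- (pi * t\<^sup>2 / X)) * cos (2 * pi * k * t))
           (sqrt X * exp (- (pi * X * k\<^sup>2)))"
proof -
  define s where "s = sqrt (2 * pi / X)"
  have s: "s > 0" "s\<^sup>2 = 2 * pi / X" using assms by (auto simp: s_def)
  define w where "w = 2 * pi * k / s"
  have "integrable lborel (\<lambda>x. std_normal_density x * cos (w * x))"
    by (rule Bochner_Integration.integrable_bound[OF integrable_normal_density[of 1 0]])
       (auto simp: abs_mult normal_density_nonneg intro!: AE_I2 mult_left_le)
  moreover have "(\<integral>x. std_normal_density x * cos (w * x) \<partial>lborel) = exp (- w\<^sup>2 / 2)"
  proof -
    have ci: "complex_integrable lborel (\<lambda>x. std_normal_density x *\<^sub>R iexp (w * x))"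
      by (rule Bochner_Integration.integrable_bound[OF integrable_normal_density[of 1 0]]) auto
    have "char std_normal_distribution w = (CLINT x|lborel. std_normal_density x *\<^sub>R iexp (w * x))"
      unfolding char_def by (subst integral_density) (auto simp: normal_density_nonneg)
    then have "Re (CLINT x|lborel. std_normal_density x *\<^sub>R iexp (w * x)) = exp (- w\<^sup>2 / 2)"
      unfolding char_std_normal_distribution by (metis Re_complex_of_real)
    also have "Re (CLINT x|lborel. std_normal_density x *\<^sub>R iexp (w * x))
        = (\<integral>x. Re (std_normal_density x *\<^sub>R iexp (w * x)) \<partial>lborel)"
      using integral_Re[OF ci] by simp
    also have "(\<lambda>x. Re (std_normal_density x *\<^sub>R iexp (w * x))) = (\<lambda>x. std_normal_density x * cos (w * x))"
      by (simp add: fun_eq_iff Re_exp)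
    finally show ?thesis .
  qed
  ultimately have "has_bochner_integral lborel (\<lambda>x. std_normal_density x * cos (w * x)) (exp (- w\<^sup>2 / 2))"
    by (simp add: has_bochner_integral_iff)
  then have "has_bochner_integral lborel (\<lambda>x. std_normal_density (0 + s * x) * cos (w * (0 + s * x)))
      (exp (- w\<^sup>2 / 2) /\<^sub>R \<bar>s\<bar>)"
    using s(1) by (intro iffD1[OF lborel_has_bochner_integral_real_affine_iff]) auto
  then have "has_bochner_integral lborel (\<lambda>x. sqrt (2 * pi) * (std_normal_density (0 + s * x) * cos (w * (0 + s * x))))
      (sqrt (2 * pi) * (exp (- w\<^sup>2 / 2) /\<^sub>R \<bar>s\<bar>))"
    by (intro has_bochner_integral_mult_right) auto
  moreover have "sqrt (2 * pi) * (std_normal_density (0 + s * t) * cos (w * (0 + s * t)))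
      = exp (- (pi * t\<^sup>2 / X)) * cos (2 * pi * k * t)" for t
    using s by (simp add: std_normal_density_def w_def power_mult_distrib mult_ac)
  moreover have "sqrt (2 * pi) * (exp (- w\<^sup>2 / 2) /\<^sub>R \<bar>s\<bar>) = sqrt X * exp (- (pi * X * k\<^sup>2))"
  proof -
    have "sqrt (2 * pi) / s = sqrt X" using assms by (simp add: s_def real_sqrt_divide)
    moreover have "w\<^sup>2 = (2 * pi * k)\<^sup>2 / (2 * pi / X)"
      by (simp add: w_def power_divide s(2))
    then have "w\<^sup>2 / 2 = pi * X * k\<^sup>2"
      using assms by (simp add: field_simps power2_eq_square)
    ultimately show ?thesis using s by (simp add: field_simps)
  qed
  ultimately show ?thesis by simp
qed

text \<open>Both numbers are limits of the integral over [-n, n]: \<open>I\<close> by dominated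
  convergence, \<open>J\<close> because the sets {-n..<n} exhaust the integers. This is the
  unfolding step of Poisson summation.\<close>

lemma infsum_unit_intervals:
  fixes f :: "real \<Rightarrow> real"
  assumes f: "has_bochner_integral lborel f I" and cont: "continuous_on UNIV f"
    and J: "((\<lambda>m::int. integral {of_int m..of_int m + 1} f) has_sum J) UNIV"
  shows "I = J"
proof (rule LIMSEQ_unique)
  have int: "f integrable_on {l..u}" for l u
    by (intro integrable_continuous_real continuous_on_subset[OF cont]) auto
  have sum: "(\<Sum>m\<in>{- int n..<int n}. integral {of_int m..of_int m + 1} f) = integral {- real n..real n} f" for n
  proof (induction n)
    case (Suc n)
    have "{- int (Suc n)..<int (Suc n)} = insert (- int (Suc n)) (insert (int n) {- int n..<int n})" by auto
    then have "(\<Sum>m\<in>{- int (Suc n)..<int (Suc n)}. integral {of_int m..of_int m + 1} f)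
      = integral {- real (Suc n)..- real n} f + (integral {real n..real (Suc n)} f + integral {- real n..real n} f)"
      using Suc by (simp add: add_ac)
    also have "integral {real n..real (Suc n)} f + integral {- real n..real n} f = integral {- real n..real (Suc n)} f"
      by (subst add.commute, rule Henstock_Kurzweil_Integration.integral_combine) (auto intro: int)
    also have "integral {- real (Suc n)..- real n} f + \<dots> = integral {- real (Suc n)..real (Suc n)} f"
      by (rule Henstock_Kurzweil_Integration.integral_combine) (auto intro: int)
    finally show ?case .
  qed simp
  have fl: "filterlim (\<lambda>n. {- int n..<int n}) (finite_subsets_at_top UNIV) sequentially"
    unfolding filterlim_finite_subsets_at_top
  proof (intro allI impI)
    fix F :: "int set" assume F: "finite F \<and> F \<subseteq> UNIV"
    show "\<forall>\<^sub>F n in sequentially. finite {- int n..<int n} \<and> F \<subseteq> {- int n..<int n} \<and> {- int n..<int n} \<subseteq> UNIV"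
      unfolding eventually_sequentially
    proof (intro exI[of _ "Suc (nat (Max (insert 0 (abs ` F))))"] allI impI)
      fix n assume n: "Suc (nat (Max (insert 0 (abs ` F)))) \<le> n"
      have "x \<in> {- int n..<int n}" if "x \<in> F" for x
      proof -
        have "\<bar>x\<bar> \<le> Max (insert 0 (abs ` F))" using F that by (intro Max_ge) auto
        then show ?thesis using n by auto
      qed
      then show "finite {- int n..<int n} \<and> F \<subseteq> {- int n..<int n} \<and> {- int n..<int n} \<subseteq> UNIV" by auto
    qed
  qed
  have "(\<lambda>n. \<Sum>m\<in>{- int n..<int n}. integral {of_int m..of_int m + 1} f) \<longlonglongrightarrow> J"
    using J unfolding has_sum_def by (rule filterlim_compose[OF _ fl])
  then show "(\<lambda>n. integral {- real n..real n} f) \<longlonglongrightarrow> J" by (simp add: sum)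
  have fi: "integrable lborel f" "integral\<^sup>L lborel f = I" using f by (auto simp: has_bochner_integral_iff)
  have eq: "integral\<^sup>L lborel (\<lambda>x. indicator {- real n..real n} x *\<^sub>R f x) = integral {- real n..real n} f" for n
  proof -
    have "set_integrable lborel {- real n..real n} f"
      using fi(1) unfolding set_integrable_def by (intro integrable_mult_indicator) auto
    from set_borel_integral_eq_integral(2)[OF this] show ?thesis by (simp add: set_lebesgue_integral_def)
  qed
  have "(\<lambda>n. integral\<^sup>L lborel (\<lambda>x. indicator {- real n..real n} x *\<^sub>R f x)) \<longlonglongrightarrow> integral\<^sup>L lborel f"
  proof (rule integral_dominated_convergence[where w="\<lambda>x. norm (f x)"])
    show "AE x in lborel. (\<lambda>n. indicator {- real n..real n} x *\<^sub>R f x) \<longlonglongrightarrow> f x"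
    proof (rule AE_I2)
      fix x :: real
      obtain N :: nat where N: "\<bar>x\<bar> \<le> real N" using real_arch_simple by blast
      have "\<forall>\<^sub>F n in sequentially. indicator {- real n..real n} x *\<^sub>R f x = f x"
        unfolding eventually_sequentially
      proof (intro exI[of _ N] allI impI)
        fix n assume "N \<le> n"
        then have "x \<in> {- real n..real n}" using N by auto
        then show "indicator {- real n..real n} x *\<^sub>R f x = f x" by simp
      qed
      then show "(\<lambda>n. indicator {- real n..real n} x *\<^sub>R f x) \<longlonglongrightarrow> f x"
        by (rule tendsto_eventually)
    qed
    show "AE x in lborel. norm (indicator {- real n..real n} x *\<^sub>R f x) \<le> norm (f x)" for n
      by (intro AE_I2) (simp add: indicator_def)
    show "f \<in> borel_measurable lborel" using fi(1) by auto
    then show "(\<lambda>x. indicator {- real n..real n} x *\<^sub>R f x) \<in> borel_measurable lborel" for n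
      by measurable
  qed (use fi in auto)
  then show "(\<lambda>n. integral {- real n..real n} f) \<longlonglongrightarrow> I" unfolding eq fi(2) .
qed

text \<open>\<open>th3 X\<close> and \<open>th2 X\<close> are Jacobi's \<open>\<theta>\<^sub>3\<close> and \<open>\<theta>\<^sub>2\<close> of nome \<open>exp (- pi * X)\<close>, with
  the period in \<open>b\<close> normalised to \<open>1\<close>; \<open>th3 X (1/2)\<close> is \<open>\<theta>\<^sub>4(0)\<close>.\<close>

definition th3 :: "real \<Rightarrow> real \<Rightarrow> real" where
  "th3 X b = (\<Sum>\<^sub>\<infinity>k::int. gauss X (of_int k) * cos (2 * pi * of_int k * b))"

definition th2 :: "real \<Rightarrow> real \<Rightarrow> real" where
  "th2 X b = (\<Sum>\<^sub>\<infinity>k::int. gauss X (of_int k + 1/2) * cos (2 * pi * (of_int k + 1/2) * b))"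

lemma th3_summable: "X > 0 \<Longrightarrow> (\<lambda>k::int. gauss X (of_int k) * cos (2 * pi * of_int k * b)) summable_on UNIV"
  by (intro summable_on_bounded_mult[where B = 1] summable_on_gauss0) auto

lemma th2_summable: "X > 0 \<Longrightarrow> (\<lambda>k::int. gauss X (of_int k + 1/2) * cos (2 * pi * (of_int k + 1/2) * b)) summable_on UNIV"
  by (intro summable_on_bounded_mult[where B = 1] summable_on_gauss) auto

lemma continuous_on_UNIV_intervals:
  fixes f :: "real \<Rightarrow> real"
  assumes "\<And>R. continuous_on {-R..R} f"
  shows "continuous_on UNIV f"
proof (rule continuous_at_imp_continuous_on, rule ballI)
  fix b :: real
  have "b \<in> interior {-(\<bar>b\<bar> + 1)..\<bar>b\<bar> + 1}" by auto
  then show "isCont f b" using continuous_on_interior[OF assms] by blast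
qed

lemma integral_cos_unit: "((\<lambda>b. cos (2 * pi * of_int n * b)) has_integral (if n = 0 then 1 else 0)) {0..1::real}"
proof (cases "n = 0")
  case False
  have "((\<lambda>b. cos (2 * pi * of_int n * b)) has_integral
      sin (2 * pi * of_int n * 1) / (2 * pi * of_int n) - sin (2 * pi * of_int n * 0) / (2 * pi * of_int n)) {0..1::real}"
    using False
    by (intro fundamental_theorem_of_calculus)
       (auto intro!: derivative_eq_intros simp: has_real_derivative_iff_has_vector_derivative[symmetric])
  moreover have "sin (2 * pi * of_int n) = 0" using sin_int_2pin[of n] by (simp add: mult_ac)
  ultimately show ?thesis using False by simp
qed (use has_integral_const_real[of "1::real" 0 1] in simp)

lemma has_sum_delta_int:
  fixes c :: real
  shows "((\<lambda>j. if j = k then c else 0) has_sum c) UNIV"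
  by (rule has_sum_finite_neutralI[of "{k}"]) auto

text \<open>Both sides are continuous, even and of period 1 in b, so equality of cosine coefficients
  is enough. On the left, unfolding turns a coefficient into a Fourier integral over the line; on
  the right it is read off by orthogonality.\<close>

theorem gauss_poisson:
  assumes X: "X > 0"
  shows "(\<Sum>\<^sub>\<infinity>m::int. dual_gauss X (of_int m + b)) = sqrt X * th3 X b"
proof -
  define v where "v = (\<lambda>b. \<Sum>\<^sub>\<infinity>m::int. dual_gauss X (of_int m + b))"
  define u where "u = (\<lambda>b. th3 X b)"
  define c where "c = pi / X"
  have c: "c > 0" using X by (simp add: c_def)
  have vbound: "dual_gauss X (of_int m + b) \<le> exp (c + c * R) * exp (- (c * \<bar>of_int m\<bar>))"
    if "\<bar>b\<bar> \<le> R" for m :: int and b R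
    using gauss_le_exp_abs[OF c that, of m] by (simp add: c_def)
  have vM: "(\<lambda>m::int. exp (c + c * R) * exp (- (c * \<bar>of_int m\<bar>))) summable_on UNIV" for R
    by (intro summable_on_cmult_right summable_on_exp_abs c)
  have uM: "(\<lambda>k::int. gauss X (of_int k)) summable_on UNIV"
    using X by (intro summable_on_gauss0) auto
  have contv: "continuous_on UNIV v"
    unfolding v_def
  proof (rule continuous_on_UNIV_intervals)
    show "continuous_on {-R..R} (\<lambda>b. \<Sum>\<^sub>\<infinity>m::int. dual_gauss X (of_int m + b))" for R
      by (rule integral_infsum(2)[OF vM[of R]])
         (use X in \<open>auto intro!: vbound continuous_intros\<close>)
  qed
  have contu: "continuous_on UNIV u"
    unfolding u_def th3_def
    by (rule continuous_on_UNIV_intervals, rule integral_infsum(2)[OF uM])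
       (auto intro!: continuous_intros simp: abs_mult)
  define D where "D = (\<lambda>b. v b - sqrt X * u b)"
  have "D b = 0"
  proof (rule cosine_coefficients_zero[where D = D and b = b])
    show "continuous_on UNIV D" unfolding D_def by (intro continuous_intros contv contu)
    show "D (b + 1) = D b" for b
    proof -
      have "v (b + 1) = v b"
        unfolding v_def using infsum_shift_int[of "\<lambda>m. dual_gauss X (of_int m + b)" 1]
        by (simp add: add_ac)
      moreover have "cos (2 * pi * of_int k * (b + 1)) = cos (2 * pi * of_int k * b)" for k :: int
        using cos_int_2pin[of k] sin_int_2pin[of k] by (simp add: distrib_left cos_add mult_ac)
      then have "u (b + 1) = u b" unfolding u_def th3_def by simp
      ultimately show ?thesis by (simp add: D_def)
    qed
    show "D (- b) = D b" for b
    proof -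
      have "(of_int m - b)\<^sup>2 = (of_int (- m) + b)\<^sup>2" for m :: int by (simp add: power2_eq_square algebra_simps)
      then have "v (- b) = v b"
        unfolding v_def using infsum_reflect_int[of "\<lambda>m. dual_gauss X (of_int m + b)"] by simp
      moreover have "u (- b) = u b" unfolding u_def th3_def by simp
      ultimately show ?thesis by (simp add: D_def)
    qed
    fix k :: int
    define I where "I = sqrt X * gauss X (of_int k)"
    have v1: "((\<lambda>m. integral {0..1} (\<lambda>b. dual_gauss X (of_int m + b) * cos (2 * pi * of_int k * b)))
      has_sum integral {0..1} (\<lambda>b. \<Sum>\<^sub>\<infinity>m::int. dual_gauss X (of_int m + b) * cos (2 * pi * of_int k * b))) UNIV"
    proof (rule integral_infsum(1)[OF vM[of 1]])
      fix m :: int and b :: real assume "b \<in> {0..1}"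
      then have "dual_gauss X (of_int m + b) \<le> exp (c + c * 1) * exp (- (c * \<bar>of_int m\<bar>))"
        by (intro vbound) auto
      moreover have "dual_gauss X (of_int m + b) * \<bar>cos (2 * pi * of_int k * b)\<bar> \<le> dual_gauss X (of_int m + b)"
        by (rule mult_left_le) auto
      ultimately show "\<bar>dual_gauss X (of_int m + b) * cos (2 * pi * of_int k * b)\<bar> \<le> exp (c + c * 1) * exp (- (c * \<bar>of_int m\<bar>))"
        unfolding abs_mult abs_exp_cancel by linarith
    qed (use X in \<open>auto intro!: continuous_intros\<close>)
    \<comment> \<open>The cosine is unchanged by the shift by m, so the translates of [0, 1] tile
      the line with one and the same integrand.\<close>
    have v2: "integral {0..1} (\<lambda>b. dual_gauss X (of_int m + b) * cos (2 * pi * of_int k * b))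
        = integral {of_int m..of_int m + 1} (\<lambda>t. exp (- (pi * t\<^sup>2 / X)) * cos (2 * pi * of_int k * t))" for m :: int
    proof -
      let ?f = "\<lambda>t. exp (- (pi * t\<^sup>2 / X)) * cos (2 * pi * of_int k * t)"
      have "(?f has_integral integral {of_int m..of_int m + 1} ?f) (cbox (of_int m) (of_int m + 1))"
        using X by (auto intro!: integrable_integral integrable_continuous_real continuous_intros)
      from has_integral_affinity[OF this, of 1 "of_int m"]
      have "((\<lambda>b. ?f (b + of_int m)) has_integral integral {of_int m..of_int m + 1} ?f) {0..1}"
        by (simp add: algebra_simps)
      moreover have "?f (b + of_int m) = dual_gauss X (of_int m + b) * cos (2 * pi * of_int k * b)" for b
        using cos_int_2pin[of "k * m"] sin_int_2pin[of "k * m"] by (simp add: distrib_left cos_add mult_ac add_ac)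
      ultimately show ?thesis by (simp add: integral_unique)
    qed
    have "I = integral {0..1} (\<lambda>b. \<Sum>\<^sub>\<infinity>m::int. dual_gauss X (of_int m + b) * cos (2 * pi * of_int k * b))"
      unfolding I_def
    proof (rule infsum_unit_intervals[OF gauss_cosine_integral[OF X]])
      show "continuous_on UNIV (\<lambda>t. exp (- (pi * t\<^sup>2 / X)) * cos (2 * pi * real_of_int k * t))"
        using X by (auto intro!: continuous_intros)
    qed (use v1 v2 in simp)
    also have "\<dots> = integral {0..1} (\<lambda>b. v b * cos (2 * pi * of_int k * b))"
      unfolding v_def by (simp add: infsum_cmult_left')
    finally have vI: "integral {0..1} (\<lambda>b. v b * cos (2 * pi * of_int k * b)) = I" ..
    have u1: "((\<lambda>j. integral {0..1} (\<lambda>b. gauss X (of_int j) * cos (2 * pi * of_int j * b) * cos (2 * pi * of_int k * b)))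
      has_sum integral {0..1} (\<lambda>b. \<Sum>\<^sub>\<infinity>j::int. gauss X (of_int j) * cos (2 * pi * of_int j * b) * cos (2 * pi * of_int k * b))) UNIV"
      by (rule integral_infsum(1)[OF uM])
         (auto intro!: continuous_intros mult_left_le mult_le_one simp: abs_mult mult.assoc)
    \<comment> \<open>The two halves come from j = k and j = -k; for k = 0 both conditions hold and
      the halves add up in the same term.\<close>
    have u2: "integral {0..1} (\<lambda>b. gauss X (of_int j) * cos (2 * pi * of_int j * b) * cos (2 * pi * of_int k * b))
      = (if j = k then gauss X (of_int k) / 2 else 0) + (if j = - k then gauss X (of_int k) / 2 else 0)" for j
    proof -
      have hi: "((\<lambda>b. gauss X (of_int j) / 2 * (cos (2 * pi * of_int (j - k) * b) + cos (2 * pi * of_int (j + k) * b)))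
        has_integral gauss X (of_int j) / 2 * ((if j - k = 0 then 1 else 0) + (if j + k = 0 then 1 else 0))) {0..1}"
        by (intro has_integral_mult_right has_integral_add integral_cos_unit)
      have eq: "(\<lambda>b. gauss X (of_int j) / 2 * (cos (2 * pi * of_int (j - k) * b) + cos (2 * pi * of_int (j + k) * b)))
        = (\<lambda>b. gauss X (of_int j) * cos (2 * pi * of_int j * b) * cos (2 * pi * of_int k * b))"
        by (rule ext) (simp add: algebra_simps cos_add cos_diff)
      have "integral {0..1} (\<lambda>b. gauss X (of_int j) * cos (2 * pi * of_int j * b) * cos (2 * pi * of_int k * b))
        = gauss X (of_int j) / 2 * ((if j - k = 0 then 1 else 0) + (if j + k = 0 then 1 else 0))"
        using hi unfolding eq by (rule integral_unique)
      also have "\<dots> = (if j = k then gauss X (of_int k) / 2 else 0) + (if j = - k then gauss X (of_int k) / 2 else 0)"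
        by (cases "j = - k") (auto simp: distrib_left)
      finally show ?thesis .
    qed
    have "((\<lambda>j. integral {0..1} (\<lambda>b. gauss X (of_int j) * cos (2 * pi * of_int j * b) * cos (2 * pi * of_int k * b)))
      has_sum (gauss X (of_int k) / 2 + gauss X (of_int k) / 2)) UNIV"
      unfolding u2 by (intro has_sum_add has_sum_delta_int)
    with u1 have "integral {0..1} (\<lambda>b. \<Sum>\<^sub>\<infinity>j::int. gauss X (of_int j) * cos (2 * pi * of_int j * b) * cos (2 * pi * of_int k * b))
      = gauss X (of_int k)"
      using has_sum_unique by fastforce
    then have uI: "integral {0..1} (\<lambda>b. u b * cos (2 * pi * of_int k * b)) = gauss X (of_int k)"
      unfolding u_def th3_def by (simp add: infsum_cmult_left')
    have iv: "(\<lambda>b. v b * cos (2 * pi * of_int k * b)) integrable_on {0..1}"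
      by (intro integrable_continuous_real continuous_intros continuous_on_subset[OF contv]) auto
    have iu: "(\<lambda>b. u b * cos (2 * pi * of_int k * b)) integrable_on {0..1}"
      by (intro integrable_continuous_real continuous_intros continuous_on_subset[OF contu]) auto
    have "integral {0..1} (\<lambda>b. D b * cos (2 * pi * of_int k * b))
      = integral {0..1} (\<lambda>b. v b * cos (2 * pi * of_int k * b) - sqrt X * (u b * cos (2 * pi * of_int k * b)))"
      by (simp add: D_def algebra_simps)
    also have "\<dots> = I - sqrt X * gauss X (of_int k)"
      by (subst integral_diff) (auto intro: iv iu integrable_on_mult_right simp: vI uI)
    finally show "integral {0..1} (\<lambda>b. D b * cos (2 * pi * of_int k * b)) = 0" by (simp add: I_def)
  qed
  then show ?thesis by (simp add: D_def v_def u_def)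
qed

section \<open>The triple product\<close>

text \<open>The q-Pochhammer symbol (p; p)_n.\<close>

definition qpoch :: "real \<Rightarrow> nat \<Rightarrow> real" where
  "qpoch p n = (\<Prod>i<n. 1 - p ^ Suc i)"

text \<open>The Gaussian binomial coefficient with base p; its value 0 beyond N lets the Pascal rule
  hold without side conditions.\<close>

definition qbinom :: "real \<Rightarrow> nat \<Rightarrow> nat \<Rightarrow> real" where
  "qbinom p N j = (if j \<le> N then qpoch p N / (qpoch p j * qpoch p (N - j)) else 0)"

lemma qpoch_Suc: "qpoch p (Suc n) = qpoch p n * (1 - p ^ Suc n)"
  by (simp add: qpoch_def)

lemma qpoch_0 [simp]: "qpoch p 0 = 1"
  by (simp add: qpoch_def)

context
  fixes p :: real
  assumes p: "0 < p" "p < 1"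
begin

lemma power_Suc_less_1: "p ^ Suc n < 1"
  using p by (metis power_Suc_less_one)

text \<open>From 1 - x >= exp (- x / (1 - x)) at x = p^(i+1) <= p, followed by the geometric series.
  The bound does not depend on n, so the infinite product stays positive.\<close>

lemma qpoch_ge: "qpoch p n \<ge> exp (- (1 / (1 - p)\<^sup>2))"
proof -
  have 1: "qpoch p n \<ge> exp (- (\<Sum>i<n. p ^ Suc i / (1 - p)))" for n
  proof (induction n)
    case (Suc n)
    have "p ^ Suc n \<le> p" using p by (simp add: mult_left_le power_le_one)
    then have "p ^ Suc n / (1 - p ^ Suc n) \<le> p ^ Suc n / (1 - p)"
      using p by (intro divide_left_mono) (auto intro!: mult_pos_pos power_Suc_less_1 simp del: power_Suc)
    moreover have "1 + p ^ Suc n / (1 - p ^ Suc n) \<le> exp (p ^ Suc n / (1 - p ^ Suc n))"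
      by (rule exp_ge_add_one_self)
    moreover have "1 + p ^ Suc n / (1 - p ^ Suc n) = 1 / (1 - p ^ Suc n)"
      using power_Suc_less_1[of n] by (simp add: field_simps del: power_Suc)
    moreover have "exp (p ^ Suc n / (1 - p ^ Suc n)) \<le> exp (p ^ Suc n / (1 - p))"
      using calculation(1) by (simp only: exp_le_cancel_iff)
    ultimately have "1 / (1 - p ^ Suc n) \<le> exp (p ^ Suc n / (1 - p))"
      by linarith
    then have "exp (- (p ^ Suc n / (1 - p))) \<le> 1 - p ^ Suc n"
      using power_Suc_less_1[of n] by (simp add: exp_minus field_simps del: power_Suc)
    then have "exp (- (\<Sum>i<n. p ^ Suc i / (1 - p))) * exp (- (p ^ Suc n / (1 - p))) \<le> qpoch p n * (1 - p ^ Suc n)"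
      using Suc by (intro mult_mono) (auto intro: order_trans[OF exp_ge_zero])
    then show ?case by (simp add: qpoch_Suc exp_add[symmetric] del: power_Suc)
  qed simp
  have "(\<Sum>i<n. p ^ Suc i / (1 - p)) \<le> (\<Sum>i<n. p ^ i) / (1 - p)"
    unfolding sum_divide_distrib
    using p by (intro sum_mono divide_right_mono) (auto simp: mult_left_le_one_le)
  also have "(\<Sum>i<n. p ^ i) \<le> (\<Sum>i. p ^ i)"
    using p by (intro sum_le_suminf summable_geometric) auto
  also have "\<dots> = 1 / (1 - p)" using p by (intro suminf_geometric) auto
  finally have "(\<Sum>i<n. p ^ Suc i / (1 - p)) \<le> 1 / (1 - p)\<^sup>2"
    using p by (simp add: divide_right_mono power2_eq_square)
  then have "exp (- (1 / (1 - p)\<^sup>2)) \<le> exp (- (\<Sum>i<n. p ^ Suc i / (1 - p)))"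
    by (simp only: exp_le_cancel_iff neg_le_iff_le)
  then show ?thesis using 1[of n] by (rule order_trans)
qed

lemma qpoch_pos: "qpoch p n > 0"
  using qpoch_ge[of n] by (rule less_le_trans[OF exp_gt_zero])

lemma qpoch_antimono: "m \<le> n \<Longrightarrow> qpoch p n \<le> qpoch p m"
proof (induction n rule: dec_induct)
  case (step n)
  have "qpoch p n * (1 - p ^ Suc n) \<le> qpoch p n"
    using qpoch_pos[of n] p by (intro mult_left_le) auto
  with step show ?case by (simp add: qpoch_Suc del: power_Suc)
qed simp

lemma qpoch_convergent: "\<exists>L>0. qpoch p \<longlonglongrightarrow> L \<and> (\<forall>n. L \<le> qpoch p n)"
proof -
  have d: "decseq (qpoch p)" by (auto simp: decseq_def qpoch_antimono)
  then obtain L where L: "qpoch p \<longlonglongrightarrow> L" "\<forall>n. L \<le> qpoch p n"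
    using decseq_convergent[OF d, of 0] less_imp_le[OF qpoch_pos] by blast
  have "exp (- (1 / (1 - p)\<^sup>2)) \<le> L"
    by (rule tendsto_lowerbound[OF L(1)]) (auto simp: qpoch_ge)
  then have "0 < L" by (rule less_le_trans[OF exp_gt_zero])
  then show ?thesis using L by blast
qed

text \<open>The numerator is split as 1 - p^(N+1) = (1 - p^(N-j)) + p^(N-j) * (1 - p^(j+1)), and
  each summand cancels one factor of the denominator.\<close>

lemma qbinom_pascal: "qbinom p (Suc N) (Suc j) = qbinom p N (Suc j) + p ^ (N - j) * qbinom p N j"
proof -
  consider "j < N" | "j = N" | "j > N" by linarith
  then show ?thesis
  proof cases
    case 1
    then obtain d where d: "N = Suc (j + d)" using less_imp_Suc_add by auto
    have nz: "qpoch p j \<noteq> 0" "qpoch p d \<noteq> 0" "1 - p ^ Suc j \<noteq> 0" "1 - p ^ Suc d \<noteq> 0"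
      using qpoch_pos[of j] qpoch_pos[of d] power_Suc_less_1[of j] power_Suc_less_1[of d] by auto
    have e: "1 - p ^ Suc N = (1 - p ^ Suc d) + p ^ Suc d * (1 - p ^ Suc j)"
      by (simp add: d power_add algebra_simps)
    have "qbinom p (Suc N) (Suc j)
      = qpoch p N * (1 - p ^ Suc N) / (qpoch p j * (1 - p ^ Suc j) * (qpoch p d * (1 - p ^ Suc d)))"
      by (simp add: qbinom_def d qpoch_Suc del: power_Suc)
    also have "\<dots> = qpoch p N / (qpoch p j * (1 - p ^ Suc j) * qpoch p d)
      + p ^ Suc d * (qpoch p N / (qpoch p j * (qpoch p d * (1 - p ^ Suc d))))"
    proof -
      have "A * (v + w * u) / (a * u * (b * v)) = A / (a * u * b) + w * (A / (a * (b * v)))"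
        if "a \<noteq> 0" "b \<noteq> 0" "u \<noteq> 0" "v \<noteq> 0" for A a b u v w :: real
        using that by (simp add: field_simps)
      from this[OF nz] show ?thesis unfolding e .
    qed
    also have "\<dots> = qbinom p N (Suc j) + p ^ (N - j) * qbinom p N j"
      by (simp add: qbinom_def d qpoch_Suc del: power_Suc)
    finally show ?thesis .
  next
    case 2 then show ?thesis
      using qpoch_pos[of N] qpoch_pos[of "Suc N"] by (simp add: qbinom_def)
  next
    case 3 then show ?thesis by (simp add: qbinom_def)
  qed
qed

lemma qbinom_0: "qbinom p N 0 = 1"
  using qpoch_pos[of N] by (simp add: qbinom_def)

lemma qbinom_bound:
  assumes "\<And>n. L \<le> qpoch p n" "L > 0"
  shows "0 \<le> qbinom p N j" "qbinom p N j \<le> 1 / L"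
proof -
  show "0 \<le> qbinom p N j"
    using qpoch_pos by (simp add: qbinom_def less_imp_le)
  show "qbinom p N j \<le> 1 / L"
  proof (cases "j \<le> N")
    case True
    have "qbinom p N j = qpoch p N / qpoch p (N - j) * (1 / qpoch p j)"
      using True by (simp add: qbinom_def)
    also have "\<dots> \<le> 1 * (1 / L)"
      using qpoch_pos[of "N - j"] qpoch_pos[of N] qpoch_pos[of j] qpoch_antimono[of "N - j" N] assms
      by (intro mult_mono divide_left_mono) (auto simp: less_imp_le)
    finally show ?thesis by simp
  qed (use assms in \<open>simp add: qbinom_def\<close>)
qed

text \<open>Cauchy's q-binomial theorem. In the induction the exponents match because (j+1 choose 2)
  = (j choose 2) + j and p^j * p^(N-j) = p^N.\<close>

lemma qbinom_theorem:
  fixes t :: complex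
  shows "(\<Prod>i<N. 1 + t * of_real (p ^ i)) = (\<Sum>j\<le>N. of_real (p ^ (j choose 2) * qbinom p N j) * t ^ j)"
proof (induction N)
  case 0 then show ?case by (simp add: qbinom_0 binomial_eq_0)
next
  case (Suc N)
  let ?c = "\<lambda>N j. of_real (p ^ (j choose 2) * qbinom p N j) :: complex"
  have ext: "(\<Sum>j\<le>N. ?c N j * t ^ j) = ?c N 0 + (\<Sum>j\<le>N. ?c N (Suc j) * t ^ Suc j)"
  proof -
    have "(\<Sum>j\<le>N. ?c N j * t ^ j) = (\<Sum>j\<le>Suc N. ?c N j * t ^ j)"
      by (simp add: qbinom_def)
    then show ?thesis by (simp only: sum.atMost_Suc_shift power_0 mult_1_right)
  qed
  have "(\<Prod>i<Suc N. 1 + t * of_real (p ^ i)) = (\<Sum>j\<le>N. ?c N j * t ^ j) * (1 + t * of_real (p ^ N))"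
    by (simp only: prod.lessThan_Suc Suc)
  also have "\<dots> = (\<Sum>j\<le>N. ?c N j * t ^ j) + (\<Sum>j\<le>N. of_real (p ^ N) * ?c N j * t ^ Suc j)"
  proof -
    have "(\<Sum>j\<le>N. ?c N j * t ^ j) * (t * of_real (p ^ N)) = (\<Sum>j\<le>N. of_real (p ^ N) * ?c N j * t ^ Suc j)"
      unfolding sum_distrib_right by (intro sum.cong refl) (simp only: power_Suc mult_ac)
    then show ?thesis by (simp only: distrib_left mult_1_right)
  qed
  also have "\<dots> = ?c N 0 + (\<Sum>j\<le>N. (?c N (Suc j) + of_real (p ^ N) * ?c N j) * t ^ Suc j)"
    by (subst ext) (simp only: sum.distrib distrib_right add.assoc)
  also have "\<dots> = ?c (Suc N) 0 + (\<Sum>j\<le>N. ?c (Suc N) (Suc j) * t ^ Suc j)"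
  proof -
    have "?c N (Suc j) + of_real (p ^ N) * ?c N j = ?c (Suc N) (Suc j)" if "j \<le> N" for j
    proof -
      have "Suc j choose 2 = (j choose 2) + j" by (simp add: numeral_2_eq_2)
      moreover have "p ^ j * p ^ (N - j) = p ^ N" using that by (simp add: power_add[symmetric])
      ultimately have "p ^ (Suc j choose 2) * (p ^ (N - j) * qbinom p N j) = p ^ N * (p ^ (j choose 2) * qbinom p N j)"
        by (simp add: power_add mult_ac)
      then have "p ^ (Suc j choose 2) * qbinom p N (Suc j) + p ^ N * (p ^ (j choose 2) * qbinom p N j)
          = p ^ (Suc j choose 2) * qbinom p (Suc N) (Suc j)"
        unfolding qbinom_pascal by (simp only: distrib_left)
      then show ?thesis by (simp only: of_real_add[symmetric] of_real_mult[symmetric])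
    qed
    then show ?thesis by (simp add: qbinom_0 binomial_eq_0)
  qed
  also have "\<dots> = (\<Sum>j\<le>Suc N. ?c (Suc N) j * t ^ j)"
    by (simp only: sum.atMost_Suc_shift power_0 mult_1_right)
  finally show ?case .
qed

end

text \<open>The finite form of the triple product, with the two parities of \<open>N\<close> leading to the two
  theta functions.\<close>

definition fin_theta :: "real \<Rightarrow> real \<Rightarrow> nat \<Rightarrow> real" where
  "fin_theta s \<phi> N = (\<Sum>j\<le>N. qbinom (exp (- (2 * s))) N j *
     (exp (- (s * (real j - real N / 2)\<^sup>2)) * cos ((real j - real N / 2) * \<phi>)))"

lemma fin_theta_prod:
  assumes "s > 0"
  shows "of_real (fin_theta s \<phi> N) = Re (cis (- (real N / 2 * \<phi>)) * of_real (exp (- (s * (real N)\<^sup>2 / 4))) *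
     (\<Prod>i<N. 1 + cis \<phi> * of_real (exp (s * (real N - 1 - 2 * real i)))))"
proof -
  let ?p = "exp (- (2 * s))"
  have p: "0 < ?p" "?p < 1" using assms by auto
  \<comment> \<open>This choice centres the product: together with the prefactor exp (- s N^2 / 4)
    the exponent of the j-th term becomes the complete square - s (j - N/2)^2.\<close>
  define t where "t = cis \<phi> * of_real (exp (s * (real N - 1)))"
  have "(\<Prod>i<N. 1 + cis \<phi> * of_real (exp (s * (real N - 1 - 2 * real i)))) = (\<Prod>i<N. 1 + t * of_real (?p ^ i))"
  proof (intro prod.cong refl)
    fix i
    have "exp (s * (real N - 1 - 2 * real i)) = exp (s * (real N - 1)) * ?p ^ i"
      by (simp add: exp_of_nat_mult[symmetric] exp_add[symmetric] algebra_simps)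
    then show "1 + cis \<phi> * of_real (exp (s * (real N - 1 - 2 * real i))) = 1 + t * of_real (?p ^ i)"
      by (simp add: t_def mult_ac)
  qed
  also have "\<dots> = (\<Sum>j\<le>N. of_real (?p ^ (j choose 2) * qbinom ?p N j) * t ^ j)"
    by (rule qbinom_theorem[OF p])
  finally have 1: "cis (- (real N / 2 * \<phi>)) * of_real (exp (- (s * (real N)\<^sup>2 / 4))) *
     (\<Prod>i<N. 1 + cis \<phi> * of_real (exp (s * (real N - 1 - 2 * real i))))
     = (\<Sum>j\<le>N. cis (- (real N / 2 * \<phi>)) * of_real (exp (- (s * (real N)\<^sup>2 / 4))) * (of_real (?p ^ (j choose 2) * qbinom ?p N j) * t ^ j))"
    by (simp add: sum_distrib_left)
  have 2: "cis (- (real N / 2 * \<phi>)) * of_real (exp (- (s * (real N)\<^sup>2 / 4))) * (of_real (?p ^ (j choose 2) * qbinom ?p N j) * t ^ j)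
    = of_real (qbinom ?p N j * exp (- (s * (real j - real N / 2)\<^sup>2))) * cis ((real j - real N / 2) * \<phi>)" for j
  proof -
    have "2 * real (j choose 2) = real j * (real j - 1)"
      by (induction j) (auto simp: numeral_2_eq_2 algebra_simps)
    moreover have "?p ^ (j choose 2) = exp (- (s * (2 * real (j choose 2))))"
      by (simp add: exp_of_nat_mult[symmetric] mult_ac)
    ultimately have pj: "?p ^ (j choose 2) = exp (- (s * (real j * (real j - 1))))"
      by (simp only:)
    have "t ^ j = cis \<phi> ^ j * of_real (exp (s * (real N - 1)) ^ j)"
      by (simp add: t_def power_mult_distrib)
    also have "exp (s * (real N - 1)) ^ j = exp (s * (real j * (real N - 1)))"
      by (simp add: exp_of_nat_mult[symmetric] mult_ac)
    finally have tj: "t ^ j = cis (real j * \<phi>) * of_real (exp (s * (real j * (real N - 1))))"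
      by (simp only: Complex.DeMoivre)
    have c: "cis (- (real N / 2 * \<phi>)) * cis (real j * \<phi>) = cis ((real j - real N / 2) * \<phi>)"
      by (simp add: cis_mult algebra_simps)
    have e: "exp (- (s * (real N)\<^sup>2 / 4)) * (exp (- (s * (real j * (real j - 1)))) * exp (s * (real j * (real N - 1))))
       = exp (- (s * (real j - real N / 2)\<^sup>2))"
      by (simp add: exp_add[symmetric] power2_eq_square algebra_simps)
    show ?thesis
      unfolding pj tj c[symmetric] e[symmetric] of_real_mult by (simp only: mult_ac)
  qed
  show ?thesis unfolding 1 2 fin_theta_def Re_sum by (simp add: mult_ac)
qed

text \<open>Passing from N to N + 2 adds one factor at each end of the symmetric product, with
  exponents s * (N + 1) and - s * (N + 1). With the change of the prefactor, these two combine into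
  a real quadratic factor; hence the two parities form separate chains.\<close>

lemma fin_theta_step:
  assumes "s > 0"
  shows "fin_theta s \<phi> (Suc (Suc N)) = fin_theta s \<phi> N *
    (1 + 2 * exp (- (s * (real N + 1))) * cos \<phi> + (exp (- (s * (real N + 1))))\<^sup>2)"
proof -
  define W where "W = (\<lambda>N. cis (- (real N / 2 * \<phi>)) * of_real (exp (- (s * (real N)\<^sup>2 / 4))) *
     (\<Prod>i<N. 1 + cis \<phi> * of_real (exp (s * (real N - 1 - 2 * real i)))))"
  define e where "e = exp (- (s * (real N + 1)))"
  have e: "e > 0" "exp (s * (real N + 1)) = 1 / e" by (simp_all add: e_def exp_minus inverse_eq_divide)
  have "(\<Prod>i<Suc (Suc N). 1 + cis \<phi> * of_real (exp (s * (real (Suc (Suc N)) - 1 - 2 * real i))))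
    = (1 + cis \<phi> * of_real (exp (s * (real N + 1)))) * ((\<Prod>i<N. 1 + cis \<phi> * of_real (exp (s * (real N - 1 - 2 * real i))))
      * (1 + cis \<phi> * of_real e))"
  proof -
    define g :: "nat \<Rightarrow> complex" where "g = (\<lambda>i. 1 + cis \<phi> * of_real (exp (s * (real (Suc (Suc N)) - 1 - 2 * real i))))"
    have "prod g {..<Suc (Suc N)} = g 0 * prod (\<lambda>i. g (Suc i)) {..<Suc N}"
      by (rule prod.lessThan_Suc_shift)
    also have "\<dots> = g 0 * (prod (\<lambda>i. g (Suc i)) {..<N} * g (Suc N))" by simp
    also have "g 0 = 1 + cis \<phi> * of_real (exp (s * (real N + 1)))" by (simp add: g_def add_ac)
    also have "g (Suc N) = 1 + cis \<phi> * of_real e" by (simp add: g_def e_def algebra_simps)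
    also have "(\<lambda>i. g (Suc i)) = (\<lambda>i. 1 + cis \<phi> * of_real (exp (s * (real N - 1 - 2 * real i))))"
      by (simp add: g_def fun_eq_iff algebra_simps)
    finally show ?thesis unfolding g_def .
  qed
  moreover have "exp (- (s * (real (Suc (Suc N)))\<^sup>2 / 4)) = exp (- (s * (real N)\<^sup>2 / 4)) * e"
    by (simp add: e_def exp_add[symmetric] power2_eq_square algebra_simps add_divide_distrib)
  moreover have "cis (- (real (Suc (Suc N)) / 2 * \<phi>)) = cis (- (real N / 2 * \<phi>)) * cis (- \<phi>)"
    by (simp add: cis_mult algebra_simps add_divide_distrib)
  ultimately have "W (Suc (Suc N)) = W N * (cis (- \<phi>) * of_real e * (1 + cis \<phi> * of_real (1 / e)) * (1 + cis \<phi> * of_real e))"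
    unfolding W_def e by (simp add: mult_ac)
  also have "cis (- \<phi>) * of_real e * (1 + cis \<phi> * of_real (1 / e)) * (1 + cis \<phi> * of_real e) = of_real (1 + 2 * e * cos \<phi> + e\<^sup>2)"
  proof -
    have 1: "of_real e * of_real (1 / e) = (1 :: complex)" using e by (simp flip: of_real_mult)
    have 2: "cis (- \<phi>) * cis \<phi> = 1" by (simp add: cis_mult)
    have 3: "cis (- \<phi>) + cis \<phi> = of_real (2 * cos \<phi>)" by (simp add: complex_eq_iff)
    have "x * E * (1 + y * E') * (1 + y * E) = 1 + E * (x + y) + E * E" if "x * y = 1" "E * E' = 1"
      for x y E E' :: complex
      using that by algebra
    from this[OF 2 1] show ?thesis unfolding 3 by (simp add: power2_eq_square algebra_simps)
  qed
  finally have "Re (W (Suc (Suc N))) = Re (W N) * (1 + 2 * e * cos \<phi> + e\<^sup>2)" by simp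
  then show ?thesis
    using fin_theta_prod[OF assms, of \<phi> N] fin_theta_prod[OF assms, of \<phi> "Suc (Suc N)"]
    by (simp add: W_def e_def)
qed

lemma fin_theta_even:
  assumes "s > 0"
  shows "fin_theta s \<phi> (2 * n) = (\<Prod>r<n. 1 + 2 * exp (- (s * (2 * real r + 1))) * cos \<phi> + (exp (- (s * (2 * real r + 1))))\<^sup>2)"
proof (induction n)
  case 0 show ?case by (simp add: fin_theta_def qbinom_def)
next
  case (Suc n)
  then show ?case using fin_theta_step[OF assms, of \<phi> "2 * n"] by (simp add: add_ac)
qed

lemma fin_theta_odd:
  assumes "s > 0"
  shows "fin_theta s \<phi> (2 * n + 1) = 2 * cos (\<phi> / 2) * exp (- (s / 4)) *
    (\<Prod>r<n. 1 + 2 * exp (- (s * (2 * real r + 2))) * cos \<phi> + (exp (- (s * (2 * real r + 2))))\<^sup>2)"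
proof (induction n)
  case 0 show ?case
    using assms by (simp add: fin_theta_def qbinom_def qpoch_def power2_eq_square)
next
  case (Suc n)
  then show ?case using fin_theta_step[OF assms, of \<phi> "2 * n + 1"] by (simp add: add_ac)
qed

text \<open>After recentring the index by \<open>c n\<close>, each coefficient is a quotient tending
  to L / (L * L) and bounded by 1 / L, so dominated convergence applies with a Gaussian majorant.
  The offset d is 0 for even and 1/2 for odd N.\<close>

lemma fin_theta_tendsto:
  fixes d :: real and N c :: "nat \<Rightarrow> nat"
  assumes s: "s > 0" and L: "qpoch (exp (- (2 * s))) \<longlonglongrightarrow> L" "L > 0" "\<And>n. L \<le> qpoch (exp (- (2 * s))) n"
    and c: "\<And>n. real (c n) - real (N n) / 2 = d" "filterlim c at_top sequentially"
    and N: "filterlim (\<lambda>n. N n - c n) at_top sequentially"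
  shows "(\<lambda>n. fin_theta s \<phi> (N n)) \<longlonglongrightarrow>
    (\<Sum>\<^sub>\<infinity>k::int. exp (- (s * (of_int k + d)\<^sup>2)) * cos ((of_int k + d) * \<phi>)) / L"
proof -
  let ?p = "exp (- (2 * s))"
  have p: "0 < ?p" "?p < 1" using s by auto
  define g where "g = (\<lambda>x. exp (- (s * x\<^sup>2)) * cos (x * \<phi>))"
  define q where "q = (\<lambda>n (k::int). if 0 \<le> k + int (c n) then qbinom ?p (N n) (nat (k + int (c n))) else 0)"
  have eq: "fin_theta s \<phi> (N n) = (\<Sum>\<^sub>\<infinity>k. q n k * g (of_int k + d))" for n
  proof -
    have "(\<Sum>\<^sub>\<infinity>k. q n k * g (of_int k + d)) = (\<Sum>\<^sub>\<infinity>k\<in>(\<lambda>j. int j - int (c n)) ` {..N n}. q n k * g (of_int k + d))"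
    proof (rule infsum_cong_neutral)
      fix k assume "k \<in> UNIV - (\<lambda>j. int j - int (c n)) ` {..N n}"
      then have "k \<noteq> int (nat (k + int (c n))) - int (c n) \<or> \<not> nat (k + int (c n)) \<le> N n" by blast
      then show "q n k * g (of_int k + d) = 0" by (auto simp: q_def qbinom_def)
    qed auto
    also have "\<dots> = (\<Sum>k\<in>(\<lambda>j. int j - int (c n)) ` {..N n}. q n k * g (of_int k + d))"
      by (rule infsum_finite) auto
    also have "\<dots> = (\<Sum>j\<le>N n. q n (int j - int (c n)) * g (of_int (int j - int (c n)) + d))"
      by (subst sum.reindex) (auto simp: inj_on_def)
    also have "\<dots> = fin_theta s \<phi> (N n)"
      unfolding fin_theta_def
    proof (intro sum.cong refl)
      fix j
      have "of_int (int j - int (c n)) + d = real j - real (N n) / 2" using c(1)[of n] by simp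
      moreover have "q n (int j - int (c n)) = qbinom ?p (N n) j" by (simp add: q_def)
      ultimately show "q n (int j - int (c n)) * g (of_int (int j - int (c n)) + d) = qbinom ?p (N n) j *
         (exp (- (s * (real j - real (N n) / 2)\<^sup>2)) * cos ((real j - real (N n) / 2) * \<phi>))"
        by (simp only: g_def)
    qed
    finally show ?thesis ..
  qed
  have lim: "(\<lambda>n. q n k) \<longlonglongrightarrow> 1 / L" for k
  proof -
    have Lim: "(\<lambda>n. qpoch ?p (a n)) \<longlonglongrightarrow> L" if "filterlim a at_top sequentially" for a
      using filterlim_compose[OF L(1) that] .
    have c': "filterlim (\<lambda>n. nat (k + int (c n))) at_top sequentially"
      unfolding filterlim_at_top_ge[of _ _ 0]
    proof (intro allI impI)
      fix Z :: nat
      have "\<forall>\<^sub>F n in sequentially. Z + nat \<bar>k\<bar> \<le> c n" using c(2) by (simp add: filterlim_at_top)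
      then show "\<forall>\<^sub>F n in sequentially. Z \<le> nat (k + int (c n))" by eventually_elim auto
    qed
    have N': "filterlim (\<lambda>n. N n - nat (k + int (c n))) at_top sequentially"
      unfolding filterlim_at_top_ge[of _ _ 0]
    proof (intro allI impI)
      fix Z :: nat
      have "\<forall>\<^sub>F n in sequentially. Z + nat \<bar>k\<bar> \<le> N n - c n" using N by (simp add: filterlim_at_top)
      then show "\<forall>\<^sub>F n in sequentially. Z \<le> N n - nat (k + int (c n))" by eventually_elim auto
    qed
    have NN: "filterlim N at_top sequentially"
      by (rule filterlim_at_top_mono[OF N]) auto
    have "(\<lambda>n. qpoch ?p (N n) / (qpoch ?p (nat (k + int (c n))) * qpoch ?p (N n - nat (k + int (c n))))) \<longlonglongrightarrow> L / (L * L)"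
      using L(2) by (intro tendsto_intros Lim NN c' N') auto
    moreover have "\<forall>\<^sub>F n in sequentially. q n k = qpoch ?p (N n) / (qpoch ?p (nat (k + int (c n))) * qpoch ?p (N n - nat (k + int (c n))))"
    proof -
      have "\<forall>\<^sub>F n in sequentially. nat \<bar>k\<bar> + 1 \<le> c n" using c(2) by (simp add: filterlim_at_top)
      moreover have "\<forall>\<^sub>F n in sequentially. nat \<bar>k\<bar> + 1 \<le> N n - c n" using N by (simp add: filterlim_at_top)
      ultimately show ?thesis
        by eventually_elim (auto simp: q_def qbinom_def)
    qed
    ultimately have "(\<lambda>n. q n k) \<longlonglongrightarrow> L / (L * L)"
      by (simp add: tendsto_cong)
    then show ?thesis using L(2) by simp
  qed
  have qb: "0 \<le> q n k" "q n k \<le> 1 / L" for n k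
    using qbinom_bound[OF p L(3) L(2)] L(2) by (auto simp: q_def)
  have "(\<lambda>n. \<Sum>\<^sub>\<infinity>k. q n k * g (of_int k + d)) \<longlonglongrightarrow> (\<Sum>\<^sub>\<infinity>k. 1 / L * g (of_int k + d))"
  proof (rule infsum_dominated_convergence)
    show "(\<lambda>k::int. 1 / L * exp (- (s * (of_int k + d)\<^sup>2))) summable_on UNIV"
      by (intro summable_on_cmult_right summable_on_gauss s)
    show "(\<lambda>n. q n k * g (of_int k + d)) \<longlonglongrightarrow> 1 / L * g (of_int k + d)" for k
      by (intro tendsto_intros lim)
    show "norm (q n k * g (of_int k + d)) \<le> 1 / L * exp (- (s * (of_int k + d)\<^sup>2))" for n k
      unfolding g_def norm_mult using qb[of n k] L(2)
      by (intro mult_mono) (auto intro: mult_left_le)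
  qed
  then show ?thesis
    unfolding eq[symmetric] infsum_cmult_right' by (simp add: g_def)
qed

text \<open>The squared modulus of 1 + e * cis (2 pi b), affine in the cosine with nonnegative
  coefficients for e >= 0.\<close>

abbreviation euler_factor :: "real \<Rightarrow> real \<Rightarrow> real" where
  "euler_factor e b \<equiv> 1 + 2 * e * cos (2 * pi * b) + e\<^sup>2"

lemma triple_products:
  assumes X: "X > 0"
  obtains L where "L > 0" "(\<lambda>n. \<Prod>r<n. 1 - exp (- (2 * pi * X * (real r + 1)))) \<longlonglongrightarrow> L"
    and "\<And>b. (\<lambda>n. \<Prod>r<n. euler_factor (exp (- (pi * X * (2 * real r + 1)))) b)
       \<longlonglongrightarrow> th3 X b / L"
    and "\<And>b. (\<lambda>n. 2 * cos (pi * b) * exp (- (pi * X / 4)) *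
       (\<Prod>r<n. euler_factor (exp (- (pi * X * (2 * real r + 2)))) b))
       \<longlonglongrightarrow> th2 X b / L"
proof -
  have s: "pi * X > 0" using X by simp
  have p: "0 < exp (- (2 * (pi * X)))" "exp (- (2 * (pi * X))) < 1" using X by auto
  obtain L where L: "qpoch (exp (- (2 * (pi * X)))) \<longlonglongrightarrow> L" "L > 0" "\<And>n. L \<le> qpoch (exp (- (2 * (pi * X)))) n"
    using qpoch_convergent[OF p] by blast
  have L': "(\<lambda>n. \<Prod>r<n. 1 - exp (- (2 * pi * X * (real r + 1)))) \<longlonglongrightarrow> L"
  proof -
    have "exp (- (2 * (pi * X))) ^ Suc r = exp (- (2 * pi * X * (real r + 1)))" for r
      unfolding exp_of_nat_mult[symmetric] by (simp add: algebra_simps)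
    then have "qpoch (exp (- (2 * (pi * X)))) = (\<lambda>n. \<Prod>r<n. 1 - exp (- (2 * pi * X * (real r + 1))))"
      unfolding qpoch_def by (simp only:)
    then show ?thesis using L(1) by simp
  qed
  have 3: "(\<lambda>n. fin_theta (pi * X) (2 * pi * b) (2 * n)) \<longlonglongrightarrow> th3 X b / L" for b
  proof -
    have "(\<lambda>n. fin_theta (pi * X) (2 * pi * b) (2 * n)) \<longlonglongrightarrow>
      (\<Sum>\<^sub>\<infinity>k::int. gauss X (of_int k + 0) * cos ((of_int k + 0) * (2 * pi * b))) / L"
      by (rule fin_theta_tendsto[OF s L, of "\<lambda>n. n"]) (auto simp: filterlim_ident)
    then show ?thesis by (simp add: th3_def mult_ac)
  qed
  have 2: "(\<lambda>n. fin_theta (pi * X) (2 * pi * b) (2 * n + 1)) \<longlonglongrightarrow> th2 X b / L" for b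
  proof -
    have "(\<lambda>n. fin_theta (pi * X) (2 * pi * b) (2 * n + 1)) \<longlonglongrightarrow>
      (\<Sum>\<^sub>\<infinity>k::int. gauss X (of_int k + 1/2) * cos ((of_int k + 1/2) * (2 * pi * b))) / L"
      by (rule fin_theta_tendsto[OF s L, of "\<lambda>n. n + 1"])
         (auto simp: filterlim_ident filterlim_Suc field_simps)
    then show ?thesis by (simp add: th2_def mult_ac)
  qed
  have 2: "(\<lambda>n. 2 * cos (pi * b) * exp (- (pi * X / 4)) *
       (\<Prod>r<n. euler_factor (exp (- (pi * X * (2 * real r + 2)))) b))
       \<longlonglongrightarrow> th2 X b / L" for b
    using 2[of b] unfolding fin_theta_odd[OF s] by simp
  show thesis
    by (rule that[OF L(2) L' 3[unfolded fin_theta_even[OF s]] 2])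
qed

section \<open>Slopes of theta functions\<close>

text \<open>The slopes of \<open>P\<close> lie between \<open>m = P'(-1)\<close> and \<open>M = P'(1)\<close>; the last clause compares
  logarithmic derivatives.\<close>

lemma prod_linear_slopes:
  fixes u w :: "nat \<Rightarrow> real"
  assumes uw: "\<And>r. 0 \<le> w r" "\<And>r. w r \<le> u r"
  defines "P \<equiv> \<lambda>n c. \<Prod>r<n. u r + w r * c"
  shows "0 \<le> P n (- 1) \<and> (\<forall>c1 c2. - 1 \<le> c1 \<and> c1 \<le> c2 \<and> c2 \<le> 1 \<longrightarrow> P n c1 \<le> P n c2) \<and>
    (\<exists>m M. 0 \<le> m \<and> 0 \<le> M \<and> M * P n (- 1) \<le> P n 1 * m \<and>
      (\<forall>c1 c2. - 1 \<le> c1 \<and> c1 \<le> c2 \<and> c2 \<le> 1 \<longrightarrow>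
        m * (c2 - c1) \<le> P n c2 - P n c1 \<and> P n c2 - P n c1 \<le> M * (c2 - c1)))"
proof (induction n)
  case 0 then show ?case by (auto simp: P_def intro!: exI[of _ 0])
next
  case (Suc n)
  then obtain m M where P0: "0 \<le> P n (- 1)" and mono: "\<And>c1 c2. - 1 \<le> c1 \<Longrightarrow> c1 \<le> c2 \<Longrightarrow> c2 \<le> 1 \<Longrightarrow> P n c1 \<le> P n c2"
    and mM: "0 \<le> m" "0 \<le> M" "M * P n (- 1) \<le> P n 1 * m"
    and sl: "\<And>c1 c2. - 1 \<le> c1 \<Longrightarrow> c1 \<le> c2 \<Longrightarrow> c2 \<le> 1 \<Longrightarrow> m * (c2 - c1) \<le> P n c2 - P n c1"
      "\<And>c1 c2. - 1 \<le> c1 \<Longrightarrow> c1 \<le> c2 \<Longrightarrow> c2 \<le> 1 \<Longrightarrow> P n c2 - P n c1 \<le> M * (c2 - c1)"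
    by blast
  let ?u = "u n" and ?w = "w n"
  have u: "0 \<le> ?w" "?w \<le> ?u" "0 \<le> ?u" using uw[of n] by auto
  have PS: "P (Suc n) c = P n c * (?u + ?w * c)" for c by (simp add: P_def)
  have f: "?u - ?w \<le> ?u + ?w * c" "?u + ?w * c \<le> ?u + ?w" if "- 1 \<le> c" "c \<le> 1" for c
  proof -
    show "?u - ?w \<le> ?u + ?w * c" "?u + ?w * c \<le> ?u + ?w"
      using mult_left_mono[of "- 1" c ?w] mult_left_mono[of c 1 ?w] that u by simp_all
  qed
  have P1: "0 \<le> P n 1" using P0 mono[of "-1" 1] by simp
  \<comment> \<open>The product rule at the two ends: \<open>m'\<close> is what P' (-1) becomes when
    the factor u + w * c is appended, and \<open>M'\<close> is what P' (1) becomes.\<close>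
  define m' M' where "m' = m * (?u - ?w) + P n (- 1) * ?w" and "M' = M * (?u + ?w) + P n 1 * ?w"
  have slo: "m' * (c2 - c1) \<le> P (Suc n) c2 - P (Suc n) c1" and shi: "P (Suc n) c2 - P (Suc n) c1 \<le> M' * (c2 - c1)"
    if c: "- 1 \<le> c1" "c1 \<le> c2" "c2 \<le> 1" for c1 c2
  proof -
    have e: "P (Suc n) c2 - P (Suc n) c1 = (P n c2 - P n c1) * (?u + ?w * c2) + P n c1 * ?w * (c2 - c1)"
      by (simp add: PS algebra_simps)
    have "m * (c2 - c1) * (?u - ?w) \<le> (P n c2 - P n c1) * (?u + ?w * c2)"
      using c sl(1)[OF c] f[of c2] mM u mono[OF c] by (intro mult_mono) auto
    moreover have "P n (- 1) * ?w * (c2 - c1) \<le> P n c1 * ?w * (c2 - c1)"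
      using c u mono[of "-1" c1] by (intro mult_right_mono) auto
    ultimately show "m' * (c2 - c1) \<le> P (Suc n) c2 - P (Suc n) c1"
      unfolding e m'_def by (simp add: algebra_simps)
    have "(P n c2 - P n c1) * (?u + ?w * c2) \<le> M * (c2 - c1) * (?u + ?w)"
      using c sl(2)[OF c] f[of c2] mM u mono[OF c] by (intro mult_mono) auto
    moreover have "P n c1 * ?w * (c2 - c1) \<le> P n 1 * ?w * (c2 - c1)"
      using c u mono[of c1 1] by (intro mult_right_mono) auto
    ultimately show "P (Suc n) c2 - P (Suc n) c1 \<le> M' * (c2 - c1)"
      unfolding e M'_def by (simp add: algebra_simps)
  qed
  have m'0: "0 \<le> m'" "0 \<le> M'" unfolding m'_def M'_def using mM u P0 P1 by auto
  \<comment> \<open>The appended factor contributes w / (u + w) to the logarithmic derivative at 1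
    and the larger w / (u - w) to the one at -1; the inequality is kept free of division because u =
    w is allowed.\<close>
  have "M' * P (Suc n) (- 1) \<le> P (Suc n) 1 * m'"
  proof -
    have "(M * P n (- 1)) * ((?u + ?w) * (?u - ?w)) \<le> (P n 1 * m) * ((?u + ?w) * (?u - ?w))"
      using mM u by (intro mult_right_mono) auto
    moreover have "P n 1 * P n (- 1) * ?w * (?u - ?w) \<le> P n 1 * P n (- 1) * ?w * (?u + ?w)"
      using P0 P1 u by (intro mult_left_mono mult_nonneg_nonneg) auto
    ultimately show ?thesis unfolding PS m'_def M'_def by (simp add: algebra_simps)
  qed
  moreover have "0 \<le> P (Suc n) (- 1)" unfolding PS using P0 u by simp
  moreover have "\<forall>c1 c2. - 1 \<le> c1 \<and> c1 \<le> c2 \<and> c2 \<le> 1 \<longrightarrow> P (Suc n) c1 \<le> P (Suc n) c2"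
  proof (intro allI impI)
    fix c1 c2 :: real assume c: "- 1 \<le> c1 \<and> c1 \<le> c2 \<and> c2 \<le> 1"
    then have "0 \<le> m' * (c2 - c1)" using m'0 by simp
    also have "\<dots> \<le> P (Suc n) c2 - P (Suc n) c1" using c slo by blast
    finally show "P (Suc n) c1 \<le> P (Suc n) c2" by simp
  qed
  ultimately show ?case using slo shi m'0 by blast
qed

text \<open>Every slope is at most M, every slope is at least m, and M / m <= P(1) / P(-1). Cleared
  of denominators, this survives the passage to the limit.\<close>

lemma prod_linear_cross:
  fixes u w :: "nat \<Rightarrow> real"
  assumes uw: "\<And>r. 0 \<le> w r" "\<And>r. w r \<le> u r"
  defines "P \<equiv> \<lambda>n c. \<Prod>r<n. u r + w r * c"
  assumes c: "- 1 \<le> c1" "c1 \<le> c2" "c2 \<le> 1" and d: "- 1 \<le> d1" "d1 \<le> d2" "d2 \<le> 1"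
  shows "(P n d2 - P n d1) * (c2 - c1) * P n (- 1) \<le> P n 1 * (P n c2 - P n c1) * (d2 - d1)"
proof -
  obtain m M where P0: "0 \<le> P n (- 1)" and mono: "\<And>c1 c2. - 1 \<le> c1 \<Longrightarrow> c1 \<le> c2 \<Longrightarrow> c2 \<le> 1 \<Longrightarrow> P n c1 \<le> P n c2"
    and mM: "0 \<le> m" "0 \<le> M" "M * P n (- 1) \<le> P n 1 * m"
    and sl: "\<And>c1 c2. - 1 \<le> c1 \<Longrightarrow> c1 \<le> c2 \<Longrightarrow> c2 \<le> 1 \<Longrightarrow> m * (c2 - c1) \<le> P n c2 - P n c1"
      "\<And>c1 c2. - 1 \<le> c1 \<Longrightarrow> c1 \<le> c2 \<Longrightarrow> c2 \<le> 1 \<Longrightarrow> P n c2 - P n c1 \<le> M * (c2 - c1)"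
    using prod_linear_slopes[of w u n, OF uw] unfolding P_def by blast
  have P1: "0 \<le> P n 1" using P0 mono[of "-1" 1] by simp
  have "(P n d2 - P n d1) * ((c2 - c1) * P n (- 1)) \<le> M * (d2 - d1) * ((c2 - c1) * P n (- 1))"
    using sl(2)[OF d] c P0 by (intro mult_right_mono) auto
  also have "\<dots> = (M * P n (- 1)) * ((d2 - d1) * (c2 - c1))" by simp
  also have "\<dots> \<le> (P n 1 * m) * ((d2 - d1) * (c2 - c1))"
    using mM c d by (intro mult_right_mono) auto
  also have "\<dots> = (m * (c2 - c1)) * (P n 1 * (d2 - d1))" by simp
  also have "\<dots> \<le> (P n c2 - P n c1) * (P n 1 * (d2 - d1))"
    using sl(1)[OF c] P1 d by (intro mult_right_mono) auto
  finally show ?thesis by (simp add: mult_ac)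
qed

lemma th3_product:
  assumes "X > 0"
  shows "\<exists>L>0. ((\<lambda>n. \<Prod>r<n. 1 - exp (- (2 * pi * X * (real r + 1)))) \<longlonglongrightarrow> L) \<and>
    (\<forall>b. (\<lambda>n. \<Prod>r<n. euler_factor (exp (- (pi * X * (2 * real r + 1)))) b)
       \<longlonglongrightarrow> th3 X b / L)"
  by (rule triple_products[OF assms]) (intro exI conjI allI; assumption)

lemma th2_product:
  assumes "X > 0"
  shows "\<exists>L>0. \<forall>b. (\<lambda>n. 2 * cos (pi * b) * exp (- (pi * X / 4)) *
       (\<Prod>r<n. euler_factor (exp (- (pi * X * (2 * real r + 2)))) b))
       \<longlonglongrightarrow> th2 X b / L"
  by (rule triple_products[OF assms]) (intro exI conjI allI; assumption)

text \<open>The cross inequality is homogeneous of degree two in P, so the normalising limit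
  \<open>L\<close> of the triple product cancels.\<close>

lemma th3_cross:
  assumes X: "X > 0" and c: "cos (2 * pi * b1) \<le> cos (2 * pi * b2)" and d: "cos (2 * pi * d1) \<le> cos (2 * pi * d2)"
  shows "(th3 X d2 - th3 X d1) * (cos (2 * pi * b2) - cos (2 * pi * b1)) * th3 X (1/2)
    \<le> th3 X 0 * (th3 X b2 - th3 X b1) * (cos (2 * pi * d2) - cos (2 * pi * d1))"
proof -
  define e where "e = (\<lambda>r::nat. exp (- (pi * X * (2 * real r + 1))))"
  have e: "0 < e r" for r
    by (simp add: e_def)
  define P where "P = (\<lambda>n c. \<Prod>r<n. (1 + (e r)\<^sup>2) + (2 * e r) * c)"
  obtain L where L: "L > 0" and lim0: "\<forall>b. (\<lambda>n. \<Prod>r<n. euler_factor (e r) b) \<longlonglongrightarrow> th3 X b / L"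
    using th3_product[OF X] unfolding e_def by blast
  have lim: "(\<lambda>n. P n (cos (2 * pi * b))) \<longlonglongrightarrow> th3 X b / L" for b
    using lim0[rule_format, of b] by (simp add: P_def add_ac mult_ac)
  have lim1: "(\<lambda>n. P n 1) \<longlonglongrightarrow> th3 X 0 / L" "(\<lambda>n. P n (- 1)) \<longlonglongrightarrow> th3 X (1/2) / L"
    using lim[of 0] lim[of "1/2"] by simp_all
  have "(th3 X d2 / L - th3 X d1 / L) * (cos (2 * pi * b2) - cos (2 * pi * b1)) * (th3 X (1/2) / L)
    \<le> (th3 X 0 / L) * (th3 X b2 / L - th3 X b1 / L) * (cos (2 * pi * d2) - cos (2 * pi * d1))"
  proof (rule LIMSEQ_le)
    show "\<exists>N. \<forall>n\<ge>N. (P n (cos (2 * pi * d2)) - P n (cos (2 * pi * d1))) * (cos (2 * pi * b2) - cos (2 * pi * b1)) * P n (- 1)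
      \<le> P n 1 * (P n (cos (2 * pi * b2)) - P n (cos (2 * pi * b1))) * (cos (2 * pi * d2) - cos (2 * pi * d1))"
      unfolding P_def
    proof (intro exI allI impI prod_linear_cross c d cos_ge_minus_one cos_le_one)
      fix r show "0 \<le> 2 * e r" using e[of r] by simp
      have "0 \<le> (1 - e r)\<^sup>2" by simp
      then show "2 * e r \<le> 1 + (e r)\<^sup>2" by (simp add: power2_diff)
    qed
  qed (intro tendsto_intros lim lim1)+
  then have "L * L * ((th3 X d2 / L - th3 X d1 / L) * (cos (2 * pi * b2) - cos (2 * pi * b1)) * (th3 X (1/2) / L))
    \<le> L * L * ((th3 X 0 / L) * (th3 X b2 / L - th3 X b1 / L) * (cos (2 * pi * d2) - cos (2 * pi * d1)))"
    using L by (intro mult_left_mono) auto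
  then show ?thesis using L by (simp add: diff_divide_distrib[symmetric])
qed

text \<open>The defining series alternates in sign; after Poisson summation it consists of positive
  Gaussians.\<close>

lemma th3_half_pos: "X > 0 \<Longrightarrow> th3 X (1/2) > 0"
proof -
  assume X: "X > 0"
  have s: "(\<lambda>m::int. dual_gauss X (of_int m + 1/2)) summable_on UNIV"
    using summable_on_gauss[of "pi / X" "1/2"] X by simp
  have "0 < dual_gauss X (of_int 0 + 1/2)" by simp
  also have "\<dots> = (\<Sum>m\<in>{0::int}. dual_gauss X (of_int m + 1/2))" by simp
  also have "\<dots> \<le> (\<Sum>\<^sub>\<infinity>m::int. dual_gauss X (of_int m + 1/2))"
    by (rule finite_sum_le_infsum[OF s]) auto
  also have "\<dots> = sqrt X * th3 X (1/2)" by (rule gauss_poisson[OF X])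
  finally show ?thesis using X by (simp add: zero_less_mult_iff)
qed

lemma th3_zero_ge_1: "X > 0 \<Longrightarrow> th3 X 0 \<ge> 1"
  unfolding th3_def using finite_sum_le_infsum[OF th3_summable[of X 0], of "{0}"] by simp

lemma th3_half_less: "X > 0 \<Longrightarrow> th3 X (1/2) < th3 X 0"
proof -
  assume X: "X > 0"
  let ?t = "\<lambda>b (k::int). gauss X (of_int k) * cos (2 * pi * of_int k * b)"
  have s: "(\<lambda>k. ?t 0 k - ?t (1/2) k) summable_on UNIV"
    by (intro summable_on_diff th3_summable X)
  have "0 < ?t 0 1 - ?t (1/2) 1" by simp
  also have "\<dots> = (\<Sum>k\<in>{1}. ?t 0 k - ?t (1/2) k)" by simp
  also have "\<dots> \<le> (\<Sum>\<^sub>\<infinity>k. ?t 0 k - ?t (1/2) k)"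
    by (rule finite_sum_le_infsum[OF s]) auto
  also have "\<dots> = th3 X 0 - th3 X (1/2)"
    unfolding th3_def by (intro infsum_diff th3_summable X)
  finally show ?thesis by simp
qed

text \<open>On the Gaussian side \<open>m\<^sup>2\<close> is the mean of \<open>(m - 1/2)\<^sup>2 - 1/4\<close> and \<open>(m + 1/2)\<^sup>2 - 1/4\<close>.\<close>

lemma th3_zero_le_half:
  assumes X: "X > 0"
  shows "th3 X 0 \<le> exp (pi / (4 * X)) * th3 X (1/2)"
proof -
  define c where "c = pi / X"
  have c: "c > 0" using X by (simp add: c_def)
  define t where "t = (\<lambda>m::int. exp (- (c * ((of_int m)\<^sup>2 + of_int m))))"
  have t: "t m = exp (c / 4) * dual_gauss X (of_int m + 1/2)" for m
    by (simp add: t_def c_def exp_add[symmetric] power2_eq_square algebra_simps add_divide_distrib)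
  have st: "t summable_on UNIV"
    unfolding t using summable_on_gauss[of "pi / X" "1/2"] X by (intro summable_on_cmult_right) simp
  have st': "(\<lambda>m. t (m + - 1)) summable_on UNIV"
    using st by (subst summable_on_reindex_bij_witness[of UNIV "\<lambda>m. m + 1" "\<lambda>m. m + - 1" UNIV t]) auto
  have s0: "(\<lambda>m::int. dual_gauss X (of_int m + 0)) summable_on UNIV"
    using summable_on_gauss[of "pi / X" 0] X by simp
  have "sqrt X * th3 X 0 = (\<Sum>\<^sub>\<infinity>m::int. dual_gauss X (of_int m + 0))"
    using gauss_poisson[OF X, of 0] by simp
  also have "\<dots> \<le> (\<Sum>\<^sub>\<infinity>m. 1/2 * t m + 1/2 * t (m + - 1))"
  proof (rule infsum_mono[OF s0])
    show "(\<lambda>m. 1/2 * t m + 1/2 * t (m + - 1)) summable_on UNIV"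
      by (intro summable_on_add summable_on_cmult_right st st')
    fix m :: int
    \<comment> \<open>The Gaussian at m is the geometric mean of \<open>t m\<close> and
      \<open>t (m - 1)\<close>, hence at most their arithmetic mean.\<close>
    define A B where "A = exp (- (c * ((of_int m)\<^sup>2 + of_int m)) / 2)" and "B = exp (- (c * ((of_int m)\<^sup>2 - of_int m)) / 2)"
    have "t m = A\<^sup>2" "t (m + - 1) = B\<^sup>2"
      unfolding A_def B_def t_def power2_eq_square exp_add[symmetric] by (simp_all add: algebra_simps)
    moreover have "dual_gauss X (of_int m + 0) = A * B"
      unfolding A_def B_def exp_add[symmetric] c_def
      by (simp add: power2_eq_square add_divide_distrib[symmetric] diff_divide_distrib[symmetric] algebra_simps)
    moreover have "0 \<le> (A - B)\<^sup>2" by simp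
    ultimately show "dual_gauss X (of_int m + 0) \<le> 1/2 * t m + 1/2 * t (m + - 1)"
      by (simp add: power2_diff)
  qed
  also have "\<dots> = 1/2 * infsum t UNIV + 1/2 * (\<Sum>\<^sub>\<infinity>m. t (m + - 1))"
    using infsum_add[OF summable_on_cmult_right[OF st, of "1/2"] summable_on_cmult_right[OF st', of "1/2"]]
    unfolding infsum_cmult_right' .
  also have "(\<Sum>\<^sub>\<infinity>m. t (m + - 1)) = infsum t UNIV" by (rule infsum_shift_int)
  also have "1/2 * infsum t UNIV + 1/2 * infsum t UNIV = infsum t UNIV" by simp
  also have "infsum t UNIV = exp (c / 4) * (sqrt X * th3 X (1/2))"
    unfolding t using gauss_poisson[OF X, of "1/2"] by (simp add: infsum_cmult_right')
  finally have "sqrt X * th3 X 0 \<le> sqrt X * (exp (c / 4) * th3 X (1/2))" by (simp add: mult_ac)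
  then show ?thesis using X by (simp add: c_def mult.commute)
qed

text \<open>By \<open>th3_cross\<close> two slopes in cos (2 pi b) differ at most by the factor th3
  X 0 / th3 X (1/2), which \<open>th3_zero_le_half\<close> makes explicit. One reference slope
  \<open>s\<close> thereby controls all others.\<close>

lemma th3_slopes:
  assumes X: "X > 0" and c: "cos (2 * pi * b1) < cos (2 * pi * b2)"
  obtains s where "s > 0" "th3 X b2 - th3 X b1 = s * (cos (2 * pi * b2) - cos (2 * pi * b1))"
    and "\<And>d1 d2. \<bar>th3 X d2 - th3 X d1\<bar> \<le> exp (pi / (4 * X)) * s * \<bar>cos (2 * pi * d2) - cos (2 * pi * d1)\<bar>"
proof -
  define s where "s = (th3 X b2 - th3 X b1) / (cos (2 * pi * b2) - cos (2 * pi * b1))"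
  have dc: "cos (2 * pi * b2) - cos (2 * pi * b1) > 0" using c by simp
  have e: "th3 X b2 - th3 X b1 = s * (cos (2 * pi * b2) - cos (2 * pi * b1))"
    using dc by (simp add: s_def)
  have pos: "th3 X (1/2) > 0" "th3 X 0 > 0" using th3_half_pos[OF X] th3_half_less[OF X] by auto
  have mono: "th3 X d1 \<le> th3 X d2 \<and> th3 X (1/2) * (th3 X d2 - th3 X d1) \<le> th3 X 0 * s * (cos (2 * pi * d2) - cos (2 * pi * d1)) \<and>
       (cos (2 * pi * d1) < cos (2 * pi * d2) \<longrightarrow> th3 X d1 < th3 X d2)"
    if d: "cos (2 * pi * d1) \<le> cos (2 * pi * d2)" for d1 d2
  proof (intro conjI impI)
    have "(th3 X d2 - th3 X d1) * (cos (2 * pi * b2) - cos (2 * pi * b1)) * th3 X (1/2)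
      \<le> th3 X 0 * (s * (cos (2 * pi * b2) - cos (2 * pi * b1))) * (cos (2 * pi * d2) - cos (2 * pi * d1))"
      using th3_cross[OF X less_imp_le[OF c] d] unfolding e .
    then have "(cos (2 * pi * b2) - cos (2 * pi * b1)) * (th3 X (1/2) * (th3 X d2 - th3 X d1))
       \<le> (cos (2 * pi * b2) - cos (2 * pi * b1)) * (th3 X 0 * s * (cos (2 * pi * d2) - cos (2 * pi * d1)))"
      by (simp only: mult_ac)
    then show "th3 X (1/2) * (th3 X d2 - th3 X d1) \<le> th3 X 0 * s * (cos (2 * pi * d2) - cos (2 * pi * d1))"
      using dc by (simp only: mult_le_cancel_left_pos)
    \<comment> \<open>Comparison with the extreme pair 1/2, 0, whose difference is known to be
      positive, gives monotonicity in the cosine.\<close>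
    have "(th3 X 0 - th3 X (1/2)) * (cos (2 * pi * d2) - cos (2 * pi * d1)) * th3 X (1/2)
      \<le> th3 X 0 * (th3 X d2 - th3 X d1) * 2"
      using th3_cross[OF X d, of "1/2" 0] by simp
    moreover have "0 \<le> (th3 X 0 - th3 X (1/2)) * (cos (2 * pi * d2) - cos (2 * pi * d1)) * th3 X (1/2)"
      using pos th3_half_less[OF X] d by simp
    ultimately have "0 \<le> th3 X 0 * (th3 X d2 - th3 X d1)" by linarith
    then show "th3 X d1 \<le> th3 X d2" using pos by (simp add: zero_le_mult_iff)
    assume "cos (2 * pi * d1) < cos (2 * pi * d2)"
    then have "0 < (th3 X 0 - th3 X (1/2)) * (cos (2 * pi * d2) - cos (2 * pi * d1)) * th3 X (1/2)"
      using pos th3_half_less[OF X] by simp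
    then have "0 < th3 X 0 * (th3 X d2 - th3 X d1)"
      using \<open>(th3 X 0 - th3 X (1/2)) * (cos (2 * pi * d2) - cos (2 * pi * d1)) * th3 X (1/2)
      \<le> th3 X 0 * (th3 X d2 - th3 X d1) * 2\<close> by linarith
    then show "th3 X d1 < th3 X d2" using pos by (simp add: zero_less_mult_iff)
  qed
  have s: "s > 0" using mono[OF less_imp_le[OF c]] c dc by (simp add: s_def)
  have bound: "th3 X d2 - th3 X d1 \<le> exp (pi / (4 * X)) * s * (cos (2 * pi * d2) - cos (2 * pi * d1))"
    if d: "cos (2 * pi * d1) \<le> cos (2 * pi * d2)" for d1 d2
  proof -
    have "th3 X (1/2) * (th3 X d2 - th3 X d1) \<le> th3 X 0 * (s * (cos (2 * pi * d2) - cos (2 * pi * d1)))"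
      using mono[OF d] by (simp add: mult.assoc)
    also have "\<dots> \<le> exp (pi / (4 * X)) * th3 X (1/2) * (s * (cos (2 * pi * d2) - cos (2 * pi * d1)))"
      using s d by (intro mult_right_mono th3_zero_le_half[OF X]) auto
    also have "\<dots> = th3 X (1/2) * (exp (pi / (4 * X)) * s * (cos (2 * pi * d2) - cos (2 * pi * d1)))" by simp
    finally show ?thesis using pos by (simp only: mult_le_cancel_left_pos)
  qed
  show thesis
  proof (rule that[OF s e])
    fix d1 d2
    show "\<bar>th3 X d2 - th3 X d1\<bar> \<le> exp (pi / (4 * X)) * s * \<bar>cos (2 * pi * d2) - cos (2 * pi * d1)\<bar>"
    proof (cases "cos (2 * pi * d1) \<le> cos (2 * pi * d2)")
      case True then show ?thesis using bound[OF True] mono[OF True] by simp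
    next
      case False
      then have "cos (2 * pi * d2) \<le> cos (2 * pi * d1)" by simp
      from bound[OF this] mono[OF this] False show ?thesis by simp
    qed
  qed
qed

lemma th3_min: "X > 0 \<Longrightarrow> th3 X (1/2) \<le> th3 X b"
proof -
  assume X: "X > 0"
  have "(th3 X 0 - th3 X (1/2)) * (cos (2 * pi * b) - cos (2 * pi * (1/2))) * th3 X (1/2)
      \<le> th3 X 0 * (th3 X b - th3 X (1/2)) * (cos (2 * pi * 0) - cos (2 * pi * (1/2)))"
    by (rule th3_cross[OF X]) auto
  moreover have "0 \<le> (th3 X 0 - th3 X (1/2)) * (cos (2 * pi * b) - cos (2 * pi * (1/2))) * th3 X (1/2)"
  proof (intro mult_nonneg_nonneg)
    show "0 \<le> cos (2 * pi * b) - cos (2 * pi * (1/2))"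
      using add_mono[OF cos_ge_minus_one[of "2 * pi * b"] order_refl[of 1]] by (simp add: add.commute)
  qed (use th3_half_pos[OF X] th3_half_less[OF X] in auto)
  ultimately have "0 \<le> th3 X 0 * (th3 X b - th3 X (1/2)) * 2" by simp
  then show ?thesis using th3_zero_ge_1[OF X] by (simp add: zero_le_mult_iff)
qed

section \<open>The product for theta_4 and its monotonicity\<close>

lemma th3_half_product:
  assumes X: "X > 0"
  shows "(\<lambda>n. \<Prod>r<n. (1 - exp (- (pi * X * (2 * real r + 1))))\<^sup>2 * (1 - exp (- (pi * X * (2 * real r + 2)))))
    \<longlonglongrightarrow> th3 X (1/2)"
proof -
  obtain L where L: "L > 0" and A: "(\<lambda>n. \<Prod>r<n. 1 - exp (- (2 * pi * X * (real r + 1)))) \<longlonglongrightarrow> L"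
    and B: "(\<lambda>n. \<Prod>r<n. euler_factor (exp (- (pi * X * (2 * real r + 1)))) (1/2))
       \<longlonglongrightarrow> th3 X (1/2) / L"
    using th3_product[OF X] by blast
  have "(\<lambda>n. (\<Prod>r<n. euler_factor (exp (- (pi * X * (2 * real r + 1)))) (1/2))
     * (\<Prod>r<n. 1 - exp (- (2 * pi * X * (real r + 1))))) \<longlonglongrightarrow> th3 X (1/2) / L * L"
    by (intro tendsto_mult A B)
  \<comment> \<open>At b = 1/2 the quadratic factor is the square (1 - e)^2; multiplying by the
    product for \<open>L\<close> restores the factors with even exponents.\<close>
  moreover have "(euler_factor (exp (- (pi * X * (2 * real r + 1)))) (1/2))
      * (1 - exp (- (2 * pi * X * (real r + 1))))
    = (1 - exp (- (pi * X * (2 * real r + 1))))\<^sup>2 * (1 - exp (- (pi * X * (2 * real r + 2))))" for r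
    by (simp add: power2_diff algebra_simps)
  ultimately show ?thesis using L by (simp only: prod.distrib[symmetric]) simp
qed

text \<open>By convexity of exp, the secant slope (exp x - 1) / x from the origin increases with
  x.\<close>

lemma exp_secant_mono:
  fixes u v :: real
  assumes "0 < v" "v \<le> u"
  shows "u * (exp v - 1) \<le> v * (exp u - 1)"
proof -
  have "exp ((1 - v / u) *\<^sub>R 0 + (v / u) *\<^sub>R u) \<le> (1 - v / u) * exp 0 + (v / u) * exp u"
    using assms by (intro convex_onD[OF exp_convex]) auto
  then have "exp v \<le> 1 - v / u + v / u * exp u" using assms by simp
  then have "u * exp v \<le> u * (1 - v / u + v / u * exp u)"
    using assms by (intro mult_left_mono) auto
  also have "\<dots> = u - v + v * exp u" using assms by (simp add: algebra_simps)
  finally show ?thesis by (simp add: algebra_simps)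
qed

text \<open>With u = c * Y >= v = c / Y, the sign of the derivative is that of u / (exp u - 1) - v /
  (exp v - 1), and x / (exp x - 1) decreases.\<close>

lemma one_minus_exp_pair_antimono:
  fixes c :: real
  assumes c: "c > 0" and Y: "1 \<le> Y1" "Y1 \<le> Y2"
  shows "(1 - exp (- (c * Y2))) * (1 - exp (- (c / Y2))) \<le> (1 - exp (- (c * Y1))) * (1 - exp (- (c / Y1)))"
proof (rule DERIV_nonpos_imp_nonincreasing[OF Y(2)])
  fix Y assume "Y1 \<le> Y" "Y \<le> Y2"
  then have Y0: "Y \<ge> 1" using Y by simp
  define u v where "u = c * Y" and "v = c / Y"
  have "c / Y \<le> c / 1" using c Y0 by (intro divide_left_mono) auto
  also have "c / 1 \<le> c * Y" using c Y0 by simp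
  finally have v: "0 < v" "v \<le> u" using c Y0 by (auto simp: u_def v_def)
  have d: "((\<lambda>Y. (1 - exp (- (c * Y))) * (1 - exp (- (c / Y)))) has_real_derivative
     (c * exp (- u)) * (1 - exp (- v)) + (1 - exp (- u)) * - (c / Y\<^sup>2 * exp (- v))) (at Y)"
    using Y0 unfolding u_def v_def
    by (auto intro!: derivative_eq_intros simp: power2_eq_square field_simps)
  have "Y * ((c * exp (- u)) * (1 - exp (- v)) + (1 - exp (- u)) * - (c / Y\<^sup>2 * exp (- v)))
     = u * exp (- u) * (1 - exp (- v)) - v * exp (- v) * (1 - exp (- u))"
    using Y0 by (simp add: u_def v_def power2_eq_square field_simps)
  also have "\<dots> = exp (- u) * exp (- v) * (u * (exp v - 1) - v * (exp u - 1))"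
    by (simp add: exp_minus field_simps)
  also have "\<dots> \<le> 0"
    using exp_secant_mono[OF v] by (intro mult_nonneg_nonpos) auto
  finally have "(c * exp (- u)) * (1 - exp (- v)) + (1 - exp (- u)) * - (c / Y\<^sup>2 * exp (- v)) \<le> 0"
    using Y0 by (simp add: mult_le_0_iff)
  with d show "\<exists>y. ((\<lambda>Y. (1 - exp (- (c * Y))) * (1 - exp (- (c / Y)))) has_real_derivative y) (at Y) \<and> y \<le> 0"
    by blast
qed

text \<open>In the product formula each factor of \<open>\<theta>\<^sub>4(0)\<close> contributes a pair to which the previous
  lemma applies.\<close>

lemma th3_half_pair_antimono:
  assumes b: "b > 0" and Y: "1 \<le> Y1" "Y1 \<le> Y2"
  shows "th3 (b * Y2) (1/2) * th3 (b / Y2) (1/2) \<le> th3 (b * Y1) (1/2) * th3 (b / Y1) (1/2)"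
proof -
  define h :: "real \<Rightarrow> real \<Rightarrow> real" where "h = (\<lambda>c Y. (1 - exp (- (c * Y))) * (1 - exp (- (c / Y))))"
  define A where "A = (\<lambda>Y n. \<Prod>r<n. (h (pi * b * (2 * real r + 1)) Y)\<^sup>2 * h (pi * b * (2 * real r + 2)) Y)"
  have h: "0 \<le> h c Y" "Y1 \<le> Y \<Longrightarrow> h c Y \<le> h c Y1" if "c > 0" "Y \<ge> 1" for c Y
    using that one_minus_exp_pair_antimono[OF that(1) Y(1)] by (auto simp: h_def)
  have lim: "A Y \<longlonglongrightarrow> th3 (b * Y) (1/2) * th3 (b / Y) (1/2)" if "Y \<ge> 1" for Y
  proof -
    have "(\<lambda>n. (\<Prod>r<n. (1 - exp (- (pi * (b * Y) * (2 * real r + 1))))\<^sup>2 * (1 - exp (- (pi * (b * Y) * (2 * real r + 2)))))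
      * (\<Prod>r<n. (1 - exp (- (pi * (b / Y) * (2 * real r + 1))))\<^sup>2 * (1 - exp (- (pi * (b / Y) * (2 * real r + 2))))))
      \<longlonglongrightarrow> th3 (b * Y) (1/2) * th3 (b / Y) (1/2)"
      using that b by (intro tendsto_mult th3_half_product) auto
    moreover have "A Y = (\<lambda>n. (\<Prod>r<n. (1 - exp (- (pi * (b * Y) * (2 * real r + 1))))\<^sup>2 * (1 - exp (- (pi * (b * Y) * (2 * real r + 2)))))
      * (\<Prod>r<n. (1 - exp (- (pi * (b / Y) * (2 * real r + 1))))\<^sup>2 * (1 - exp (- (pi * (b / Y) * (2 * real r + 2))))))"
      unfolding A_def h_def prod.distrib[symmetric] by (intro ext prod.cong refl) (simp add: power_mult_distrib mult_ac)
    ultimately show ?thesis by simp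
  qed
  show ?thesis
  proof (rule LIMSEQ_le[OF lim lim])
    have "A Y2 n \<le> A Y1 n" for n
      unfolding A_def using Y b
      by (intro prod_mono conjI mult_mono power_mono h mult_nonneg_nonneg zero_le_power mult_pos_pos) auto
    then show "\<exists>N. \<forall>n\<ge>N. A Y2 n \<le> A Y1 n" by blast
  qed (use Y in auto)
qed

text \<open>Gauss's formula writes theta_4(0) as the infinite product of (1 - q^n) / (1 + q^n). Only
  a lower bound for partial products is needed: they decrease, and the partial product of length 2n
  dominates the triple product of length n. The bound is used for the slopes of
  \<open>th2\<close>.\<close>

lemma gauss_product_ge:
  assumes X: "X > 0"
  shows "(\<Prod>r<n. (1 - exp (- (pi * X * (real r + 1)))) / (1 + exp (- (pi * X * (real r + 1))))) \<ge> th3 X (1/2)"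
proof -
  define q where "q = (\<lambda>k::nat. exp (- (pi * X * (real k + 1))))"
  define R where "R = (\<lambda>n. \<Prod>r<n. (1 - q r) / (1 + q r))"
  define A where "A = (\<lambda>n. \<Prod>r<n. (1 - q (2 * r))\<^sup>2 * (1 - q (2 * r + 1)))"
  have q: "0 < q k" "q k < 1" for k
  proof -
    have "0 < pi * X * (real k + 1)" using X by (intro mult_pos_pos) auto
    then show "0 < q k" "q k < 1" by (simp_all add: q_def)
  qed
  have q2: "(q k)\<^sup>2 = q (2 * k + 1)" for k
    unfolding q_def power2_eq_square exp_add[symmetric] by (simp add: algebra_simps)
  have R0: "R n \<ge> 0" for n unfolding R_def using q by (intro prod_nonneg) (auto simp: less_imp_le)
  have Rdec: "R n \<le> R m" if "m \<le> n" for m n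
    using that
  proof (induction n rule: dec_induct)
    case (step n)
    have "R (Suc n) = R n * ((1 - q n) / (1 + q n))" by (simp add: R_def)
    also have "\<dots> \<le> R n" using q[of n] R0 by (intro mult_left_le) auto
    finally show ?case using step by simp
  qed simp
  have RA: "A n \<le> R (2 * n)" for n
  proof -
    \<comment> \<open>Since \<open>q (2 * r + 1)\<close> is the square of \<open>q r\<close>,
      multiplying R by E turns each factor into (1 - q)^2. Sorting the first 2n factors by parity
      then gives A n * E n, and E decreases.\<close>
    define E where "E = (\<lambda>n. \<Prod>r<n. 1 - q (2 * r + 1))"
    have E0: "E n > 0" for n unfolding E_def using q by (intro prod_pos) auto
    have Edec: "E (2 * n) \<le> E n"
    proof -
      have "E (n + k) \<le> E n" for k
      proof (induction k)
        case (Suc k)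
        have "E (n + Suc k) = E (n + k) * (1 - q (2 * (n + k) + 1))" by (simp add: E_def)
        also have "\<dots> \<le> E (n + k)" using E0[of "n + k"] q(1) by (intro mult_left_le) (auto simp: less_imp_le)
        finally show ?case using Suc by simp
      qed simp
      from this[of n] show ?thesis by (simp add: mult_2)
    qed
    have RE: "R k * E k = (\<Prod>r<k. 1 - q r)\<^sup>2" for k
      unfolding R_def E_def prod.distrib[symmetric] prod_power_distrib
    proof (intro prod.cong refl)
      fix r
      have "1 + q r \<noteq> 0" using q(1)[of r] by linarith
      then show "(1 - q r) / (1 + q r) * (1 - q (2 * r + 1)) = (1 - q r)\<^sup>2"
        unfolding q2[symmetric] by (simp add: field_simps power2_eq_square)
    qed
    have "(\<Prod>r<2 * k. 1 - q r) = (\<Prod>r<k. (1 - q (2 * r)) * (1 - q (2 * r + 1)))" for k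
      by (induction k) (simp_all add: mult_ac)
    then have "R (2 * n) * E (2 * n) = (\<Prod>r<n. (1 - q (2 * r)) * (1 - q (2 * r + 1)))\<^sup>2"
      by (simp only: RE)
    also have "\<dots> = A n * E n"
      unfolding A_def E_def prod.distrib[symmetric] prod_power_distrib
      by (simp add: power2_eq_square mult_ac)
    finally have "R (2 * n) * E (2 * n) = A n * E n" .
    also have "\<dots> \<ge> A n * E (2 * n)"
      unfolding A_def using q Edec by (intro mult_left_mono prod_nonneg) (auto simp: less_imp_le)
    finally show ?thesis using E0[of "2 * n"] by simp
  qed
  have "A \<longlonglongrightarrow> th3 X (1/2)"
    using th3_half_product[OF X] by (simp add: A_def q_def add_ac)
  moreover have "\<exists>N. \<forall>m\<ge>N. A m \<le> R n"
    using RA Rdec by (intro exI[of _ n] allI impI order_trans[OF RA Rdec]) simp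
  ultimately have "th3 X (1/2) \<le> R n" by (rule LIMSEQ_le_const2)
  then show ?thesis by (simp add: R_def q_def)
qed

text \<open>Each new factor adds v * x^2 * T, which is increasing, so slopes never drop below 1. For
  the upper bound let P be the product of the 1 + v r: at x = 1 the derivative is P times a
  logarithmic derivative, which is at most 1 + 2 * (sum of the v r) <= P^2. This accounts for the
  cube.\<close>

lemma odd_product_slopes:
  fixes v :: "nat \<Rightarrow> real"
  assumes v: "\<And>r. 0 \<le> v r"
  defines "T \<equiv> \<lambda>n x. x * (\<Prod>r<n. 1 + v r * x\<^sup>2)"
  shows "(\<forall>x y. - 1 \<le> x \<and> x \<le> y \<and> y \<le> 1 \<longrightarrow>
    y - x \<le> T n y - T n x \<and> T n y - T n x \<le> (\<Prod>r<n. 1 + v r) ^ 3 * (y - x))"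
proof (induction n)
  case 0 then show ?case by (simp add: T_def)
next
  case (Suc n)
  define P where "P = (\<Prod>r<n. 1 + v r)"
  have P: "P \<ge> 1" unfolding P_def using v by (intro prod_ge_1) auto
  have T1: "T n 1 = P" "T n 0 = 0" by (auto simp: T_def P_def)
  have IH: "y - x \<le> T n y - T n x" "T n y - T n x \<le> P ^ 3 * (y - x)" if "- 1 \<le> x" "x \<le> y" "y \<le> 1" for x y
    using Suc that unfolding P_def by blast+
  have odd: "T n (- x) = - T n x" for x by (simp add: T_def)
  have TS: "T (Suc n) x = T n x * (1 + v n * x\<^sup>2)" for x by (simp add: T_def)
  show ?case
  proof (intro allI impI)
    fix x y :: real assume xy: "- 1 \<le> x \<and> x \<le> y \<and> y \<le> 1"
    have d1: "0 \<le> T n y - T n x" using IH(1)[of x y] xy by simp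
    have lo: "T n y - T n x \<le> T (Suc n) y - T (Suc n) x"
    proof -
      have mono: "T n x * x\<^sup>2 \<le> T n y * y\<^sup>2"
      proof -
        have T: "T n x * x\<^sup>2 = x ^ 3 * (\<Prod>r<n. 1 + v r * x\<^sup>2)" for x
          by (simp add: T_def power2_eq_square power3_eq_cube)
        have sgn: "0 \<le> z \<Longrightarrow> z \<le> 1 \<Longrightarrow> 0 \<le> T n z" for z using IH(1)[of 0 z] T1 by simp
        have sgn': "z \<le> 0 \<Longrightarrow> - 1 \<le> z \<Longrightarrow> T n z \<le> 0" for z using IH(1)[of z 0] T1 by simp
        consider "0 \<le> x" | "x \<le> 0" "0 \<le> y" | "y \<le> 0" by linarith
        then show ?thesis
        proof cases
          case 1
          then show ?thesis using xy d1 sgn[of x] sgn[of y] by (intro mult_mono power_mono) auto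
        next
          case 2
          have "T n x * x\<^sup>2 \<le> 0" using sgn'[of x] 2 xy by (simp add: mult_le_0_iff)
          moreover have "0 \<le> T n y * y\<^sup>2" using sgn[of y] 2 xy by simp
          ultimately show ?thesis by linarith
        next
          case 3
          have "- T n y * (- y)\<^sup>2 \<le> - T n x * (- x)\<^sup>2"
            using xy d1 sgn'[of x] sgn'[of y] 3 by (intro mult_mono power_mono) auto
          then show ?thesis by simp
        qed
      qed
      have "0 \<le> v n * (T n y * y\<^sup>2 - T n x * x\<^sup>2)" using mono v[of n] by simp
      then show ?thesis by (simp add: TS algebra_simps)
    qed
    have ab: "\<bar>T n x\<bar> \<le> P"
      using IH(1)[of x 1] IH(1)[of "- 1" x] xy T1 odd[of 1] by (auto simp: abs_le_iff)
    have e: "T (Suc n) y - T (Suc n) x = (T n y - T n x) * (1 + v n * y\<^sup>2) + T n x * v n * (x + y) * (y - x)"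
      by (simp add: TS algebra_simps power2_eq_square)
    have y2: "y\<^sup>2 \<le> 1" using xy abs_square_le_1[of y] by (simp add: abs_le_iff)
    have "(T n y - T n x) * (1 + v n * y\<^sup>2) \<le> (P ^ 3 * (y - x)) * (1 + v n)"
      using IH(2)[of x y] xy d1 v[of n] y2 P by (intro mult_mono add_left_mono mult_left_le) auto
    moreover have "T n x * v n * (x + y) * (y - x) \<le> 2 * P * v n * (y - x)"
    proof -
      have "\<bar>T n x * (x + y)\<bar> \<le> P * 2" unfolding abs_mult using ab xy by (intro mult_mono) auto
      then have "T n x * (x + y) \<le> P * 2" by linarith
      then have "(T n x * (x + y)) * (v n * (y - x)) \<le> (P * 2) * (v n * (y - x))"
        using v[of n] xy by (intro mult_right_mono) auto
      then show ?thesis by (simp add: mult_ac)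
    qed
    ultimately have "T (Suc n) y - T (Suc n) x \<le> (P ^ 3 * (1 + v n) + 2 * P * v n) * (y - x)"
      unfolding e by (simp add: algebra_simps)
    also have "\<dots> \<le> (P * (1 + v n)) ^ 3 * (y - x)"
    proof (intro mult_right_mono)
      have "P ^ 1 \<le> P ^ 3" using P by (intro power_increasing) auto
      then have "P * (2 * v n) \<le> P ^ 3 * (2 * v n + 3 * (v n)\<^sup>2 + (v n) ^ 3)"
        using v[of n] P by (intro mult_mono) auto
      then show "P ^ 3 * (1 + v n) + 2 * P * v n \<le> (P * (1 + v n)) ^ 3"
        by (simp add: power3_eq_cube power2_eq_square algebra_simps)
    qed (use xy in auto)
    finally show "y - x \<le> T (Suc n) y - T (Suc n) x \<and> T (Suc n) y - T (Suc n) x \<le> (\<Prod>r<Suc n. 1 + v r) ^ 3 * (y - x)"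
      using lo IH(1)[of x y] xy by (simp add: P_def)
  qed
qed

text \<open>In the variable x = cos (pi b) an Euler factor becomes (1 - e)^2 * (1 + v * x^2), so up
  to constants \<open>th2\<close> is a limit of the odd products \<open>T\<close>, whose slopes lie
  between 1 and a fixed bound \<open>B\<close>.\<close>

lemma th2_slopes:
  assumes X: "X > 0" and c: "cos (pi * b1) < cos (pi * b2)"
  obtains s where "s \<ge> 0" "th2 X b2 - th2 X b1 = s * (cos (pi * b2) - cos (pi * b1))"
    and "\<And>d1 d2. \<bar>th2 X d2 - th2 X d1\<bar> \<le> exp (3 * pi / (4 * X)) * s * \<bar>cos (pi * d2) - cos (pi * d1)\<bar>"
proof -
  define e where "e = (\<lambda>r::nat. exp (- (pi * X * (2 * real r + 2))))"
  have e: "0 < e r" "e r < 1" for r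
  proof -
    have "0 < pi * X * (2 * real r + 2)" using X by (intro mult_pos_pos) auto
    then show "0 < e r" "e r < 1" by (simp_all add: e_def)
  qed
  define v where "v = (\<lambda>r. 4 * e r / (1 - e r)\<^sup>2)"
  have v: "0 \<le> v r" for r using e[of r] by (simp add: v_def)
  define T where "T = (\<lambda>n x. x * (\<Prod>r<n. 1 + v r * x\<^sup>2))"
  define Z where "Z = (\<lambda>n. 2 * exp (- (pi * X / 4)) * (\<Prod>r<n. (1 - e r)\<^sup>2))"
  define B where "B = exp (3 * pi / (4 * X))"
  have Z0: "Z n \<ge> 0" for n unfolding Z_def by (intro mult_nonneg_nonneg prod_nonneg) auto
  obtain L where L: "L > 0" and lim0: "\<forall>b. (\<lambda>n. 2 * cos (pi * b) * exp (- (pi * X / 4)) *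
       (\<Prod>r<n. euler_factor (e r) b)) \<longlonglongrightarrow> th2 X b / L"
    using th2_product[OF X] unfolding e_def by blast
  have lim: "(\<lambda>n. Z n * T n (cos (pi * b))) \<longlonglongrightarrow> th2 X b / L" for b
  proof -
    have "euler_factor (e r) b = (1 - e r)\<^sup>2 * (1 + v r * (cos (pi * b))\<^sup>2)" for r
    proof -
      have "cos (2 * pi * b) = 2 * (cos (pi * b))\<^sup>2 - 1" using cos_double_cos[of "pi * b"] by (simp add: mult_ac)
      moreover have "(1 - e r)\<^sup>2 * v r = 4 * e r" using e[of r] by (simp add: v_def)
      then have "(1 - e r)\<^sup>2 * (1 + v r * (cos (pi * b))\<^sup>2) = (1 - e r)\<^sup>2 + 4 * e r * (cos (pi * b))\<^sup>2"
        by (simp add: distrib_left mult.assoc[symmetric])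
      ultimately have "(1 - e r)\<^sup>2 * (1 + v r * (cos (pi * b))\<^sup>2) = (1 - e r)\<^sup>2 + 2 * e r * (1 + cos (2 * pi * b))"
        by simp
      then show ?thesis by (simp add: power2_diff algebra_simps)
    qed
    then have "2 * cos (pi * b) * exp (- (pi * X / 4)) * (\<Prod>r<n. euler_factor (e r) b)
      = Z n * T n (cos (pi * b))" for n
      by (simp add: Z_def T_def prod.distrib mult_ac)
    then show ?thesis using lim0[rule_format, of b] by simp
  qed
  \<comment> \<open>Here 1 + v = ((1 + e) / (1 - e))^2, so the product of the 1 + v is R^(-2) for
    the Gauss product R at 2 * X. With R >= th3 (2 * X) (1/2) >= exp (- pi / (8 * X)), its cube is
    at most exp (3 * pi / (4 * X)).\<close>
  have PB: "(\<Prod>r<n. 1 + v r) ^ 3 \<le> B" for n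
  proof -
    define R where "R = (\<Prod>r<n. (1 - exp (- (pi * (2 * X) * (real r + 1)))) / (1 + exp (- (pi * (2 * X) * (real r + 1)))))"
    have R: "R = (\<Prod>r<n. (1 - e r) / (1 + e r))"
      unfolding R_def e_def by (intro prod.cong refl) (simp add: algebra_simps)
    have "exp (- (pi / (8 * X))) \<le> th3 (2 * X) (1/2)"
    proof -
      have "1 \<le> exp (pi / (4 * (2 * X))) * th3 (2 * X) (1/2)"
        using th3_zero_ge_1[of "2 * X"] th3_zero_le_half[of "2 * X"] X by auto
      then show ?thesis by (simp add: exp_minus field_simps)
    qed
    also have "\<dots> \<le> R" unfolding R_def using X by (intro gauss_product_ge) auto
    finally have RL: "exp (- (pi / (8 * X))) \<le> R" .
    then have R0: "R > 0" by (rule less_le_trans[OF exp_gt_zero])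
    have "1 + v r = inverse (((1 - e r) / (1 + e r))\<^sup>2)" for r
    proof -
      have "1 - e r \<noteq> 0" "1 + e r \<noteq> 0" using e[of r] by linarith+
      then have "1 + v r = ((1 - e r)\<^sup>2 + 4 * e r) / (1 - e r)\<^sup>2"
        by (simp add: v_def add_divide_distrib)
      also have "(1 - e r)\<^sup>2 + 4 * e r = (1 + e r)\<^sup>2" by (simp add: power2_eq_square algebra_simps)
      finally show ?thesis by (simp add: power_divide)
    qed
    then have "(\<Prod>r<n. 1 + v r) = inverse (R\<^sup>2)"
      unfolding R prod_power_distrib prod_inversef[symmetric] by (simp only: o_def)
    also have "\<dots> \<le> inverse ((exp (- (pi / (8 * X))))\<^sup>2)"
      using RL by (intro le_imp_inverse_le power_mono) auto
    also have "\<dots> = exp (pi / (4 * X))"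
      by (simp add: exp_of_nat_mult[symmetric] exp_minus[symmetric] power2_eq_square exp_add[symmetric])
    finally have "(\<Prod>r<n. 1 + v r) ^ 3 \<le> exp (pi / (4 * X)) ^ 3"
      using v by (intro power_mono prod_nonneg) auto
    also have "\<dots> = B" by (simp add: B_def exp_of_nat_mult[symmetric])
    finally show ?thesis .
  qed
  have sl: "y - x \<le> T n y - T n x" "T n y - T n x \<le> B * (y - x)" if "- 1 \<le> x" "x \<le> y" "y \<le> 1" for n x y
  proof -
    have "y - x \<le> T n y - T n x \<and> T n y - T n x \<le> (\<Prod>r<n. 1 + v r) ^ 3 * (y - x)"
      using odd_product_slopes[of v n] v that unfolding T_def by blast
    moreover have "(\<Prod>r<n. 1 + v r) ^ 3 * (y - x) \<le> B * (y - x)"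
      using PB that by (intro mult_right_mono) auto
    ultimately show "y - x \<le> T n y - T n x" "T n y - T n x \<le> B * (y - x)" by auto
  qed
  define s where "s = (th2 X b2 - th2 X b1) / (cos (pi * b2) - cos (pi * b1))"
  have dc: "cos (pi * b2) - cos (pi * b1) > 0" using c by simp
  have mono: "th2 X d1 \<le> th2 X d2" "(th2 X d2 - th2 X d1) * (cos (pi * b2) - cos (pi * b1)) \<le> B * (th2 X b2 - th2 X b1) * (cos (pi * d2) - cos (pi * d1))"
    if d: "cos (pi * d1) \<le> cos (pi * d2)" for d1 d2
  proof -
    have 1: "0 \<le> Z n * T n (cos (pi * d2)) - Z n * T n (cos (pi * d1))" for n
    proof -
      have "0 \<le> T n (cos (pi * d2)) - T n (cos (pi * d1))" using sl(1)[of "cos (pi * d1)" "cos (pi * d2)" n] d by simp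
      then show ?thesis using Z0[of n] by (simp add: right_diff_distrib[symmetric])
    qed
    have "0 \<le> th2 X d2 / L - th2 X d1 / L"
      by (rule LIMSEQ_le_const[OF tendsto_diff[OF lim lim]]) (use 1 in blast)
    then show "th2 X d1 \<le> th2 X d2" using L by (simp add: divide_right_mono field_simps)
    have "(th2 X d2 / L - th2 X d1 / L) * (cos (pi * b2) - cos (pi * b1)) \<le> B * (th2 X b2 / L - th2 X b1 / L) * (cos (pi * d2) - cos (pi * d1))"
    proof (rule LIMSEQ_le)
      show "\<exists>N. \<forall>n\<ge>N. (Z n * T n (cos (pi * d2)) - Z n * T n (cos (pi * d1))) * (cos (pi * b2) - cos (pi * b1))
        \<le> B * (Z n * T n (cos (pi * b2)) - Z n * T n (cos (pi * b1))) * (cos (pi * d2) - cos (pi * d1))"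
      proof (intro exI allI impI)
        fix n
        have "(T n (cos (pi * d2)) - T n (cos (pi * d1))) * (cos (pi * b2) - cos (pi * b1))
          \<le> (B * (cos (pi * d2) - cos (pi * d1))) * (cos (pi * b2) - cos (pi * b1))"
          using sl(2)[of "cos (pi * d1)" "cos (pi * d2)" n] d dc by (intro mult_right_mono) auto
        also have "\<dots> \<le> (B * (cos (pi * d2) - cos (pi * d1))) * (T n (cos (pi * b2)) - T n (cos (pi * b1)))"
          using sl(1)[of "cos (pi * b1)" "cos (pi * b2)" n] d c by (intro mult_left_mono) (auto simp: B_def)
        finally have "Z n * ((T n (cos (pi * d2)) - T n (cos (pi * d1))) * (cos (pi * b2) - cos (pi * b1)))
          \<le> Z n * ((B * (cos (pi * d2) - cos (pi * d1))) * (T n (cos (pi * b2)) - T n (cos (pi * b1))))"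
          using Z0 by (rule mult_left_mono)
        then show "(Z n * T n (cos (pi * d2)) - Z n * T n (cos (pi * d1))) * (cos (pi * b2) - cos (pi * b1))
        \<le> B * (Z n * T n (cos (pi * b2)) - Z n * T n (cos (pi * b1))) * (cos (pi * d2) - cos (pi * d1))"
          by (simp only: right_diff_distrib[symmetric] mult_ac)
      qed
    qed (intro tendsto_intros lim)+
    then have "L * ((th2 X d2 / L - th2 X d1 / L) * (cos (pi * b2) - cos (pi * b1))) \<le> L * (B * (th2 X b2 / L - th2 X b1 / L) * (cos (pi * d2) - cos (pi * d1)))"
      using L by (intro mult_left_mono) auto
    then show "(th2 X d2 - th2 X d1) * (cos (pi * b2) - cos (pi * b1)) \<le> B * (th2 X b2 - th2 X b1) * (cos (pi * d2) - cos (pi * d1))"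
      using L by (simp add: diff_divide_distrib[symmetric])
  qed
  have s: "s \<ge> 0" "th2 X b2 - th2 X b1 = s * (cos (pi * b2) - cos (pi * b1))"
    using mono(1)[of b1 b2] c dc by (auto simp: s_def)
  have bound: "th2 X d2 - th2 X d1 \<le> B * s * (cos (pi * d2) - cos (pi * d1))" if d: "cos (pi * d1) \<le> cos (pi * d2)" for d1 d2
  proof -
    have "(cos (pi * b2) - cos (pi * b1)) * (th2 X d2 - th2 X d1) \<le> (cos (pi * b2) - cos (pi * b1)) * (B * s * (cos (pi * d2) - cos (pi * d1)))"
      using mono(2)[OF d] unfolding s(2) by (simp only: mult_ac)
    then show ?thesis using dc by (simp only: mult_le_cancel_left_pos)
  qed
  show thesis
  proof (rule that[OF s])
    fix d1 d2
    show "\<bar>th2 X d2 - th2 X d1\<bar> \<le> exp (3 * pi / (4 * X)) * s * \<bar>cos (pi * d2) - cos (pi * d1)\<bar>"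
    proof (cases "cos (pi * d1) \<le> cos (pi * d2)")
      case True then show ?thesis using bound[OF True] mono(1)[OF True] by (simp add: B_def)
    next
      case False
      then have "cos (pi * d2) \<le> cos (pi * d1)" by simp
      from bound[OF this] mono(1)[OF this] False show ?thesis by (simp add: B_def)
    qed
  qed
qed

section \<open>Moving to a rhombic lattice\<close>

lemma has_sum_int_half_powers: "((\<lambda>k::int. (1/2::real) ^ nat \<bar>k\<bar>) has_sum 3) UNIV"
proof -
  have 1: "((\<lambda>n::nat. (1/2::real) ^ n) has_sum 2) UNIV"
    using geometric_sums[of "1/2::real"] by (intro sums_nonneg_imp_has_sum) auto
  have 2: "((\<lambda>n::nat. (1/2::real) ^ Suc n) has_sum 1) UNIV"
    using geometric_sums[of "1/2::real"] sums_mult[of "\<lambda>n. (1/2::real) ^ n" 2 "1/2"]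
    by (intro sums_nonneg_imp_has_sum) auto
  have a: "((\<lambda>k::int. (1/2::real) ^ nat \<bar>k\<bar>) has_sum 2) (range int)"
    by (subst has_sum_reindex) (auto simp: o_def 1)
  have b: "((\<lambda>k::int. (1/2::real) ^ nat \<bar>k\<bar>) has_sum 1) (range (\<lambda>n. - int (Suc n)))"
    by (subst has_sum_reindex) (use 2 in \<open>auto simp: o_def inj_on_def nat_add_distrib\<close>)
  have "range int \<inter> range (\<lambda>n. - int (Suc n)) = {}" by auto
  moreover have "range int \<union> range (\<lambda>n. - int (Suc n)) = UNIV"
  proof -
    have "k \<in> range int \<union> range (\<lambda>n. - int (Suc n))" for k
      by (cases "0 \<le> k") (auto intro: range_eqI[of _ _ "nat k"] range_eqI[of _ _ "nat (- k - 1)"])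
    then show ?thesis by blast
  qed
  ultimately show ?thesis using has_sum_Un_disjoint[OF a b] by simp
qed

text \<open>Adding l * 2^(-|n|) makes the tail nonnegative, so it may be dropped; the total amount
  added is 3 * l.\<close>

lemma infsum_int_dominant_terms:
  fixes t :: "int \<Rightarrow> real"
  assumes t: "t summable_on UNIV" and F: "finite F"
    and tail: "\<And>n. n \<notin> F \<Longrightarrow> t n \<ge> - (l * (1/2) ^ nat \<bar>n\<bar>)"
  shows "(\<Sum>n\<in>F. t n + l * (1/2) ^ nat \<bar>n\<bar>) - 3 * l \<le> infsum t UNIV"
proof -
  have h: "(\<lambda>n::int. l * (1/2) ^ nat \<bar>n\<bar>) summable_on UNIV" "(\<Sum>\<^sub>\<infinity>n::int. l * (1/2) ^ nat \<bar>n\<bar>) = 3 * l"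
    using has_sum_cmult_right[OF has_sum_int_half_powers, of l] by (auto simp: has_sum_iff)
  have "(\<Sum>n\<in>F. t n + l * (1/2) ^ nat \<bar>n\<bar>) \<le> (\<Sum>\<^sub>\<infinity>n. t n + l * (1/2) ^ nat \<bar>n\<bar>)"
  proof (rule finite_sum_le_infsum)
    show "0 \<le> t n + l * (1/2) ^ nat \<bar>n\<bar>" if "n \<in> UNIV - F" for n
      using tail[of n] that by simp
  qed (use F in \<open>auto intro!: summable_on_add t h(1)\<close>)
  also have "\<dots> = infsum t UNIV + 3 * l" using infsum_add[OF t h(1)] h(2) by simp
  finally show ?thesis by simp
qed

text \<open>For n >= 2 one has n^2 <= exp n and u * (n^2 - 2) >= 2 * n, which leaves exp (-
  n).\<close>

lemma square_exp_bound:
  fixes u :: real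
  assumes "2 \<le> n" "2 \<le> u"
  shows "(real n)\<^sup>2 * exp (- (u * ((real n)\<^sup>2 - 2))) \<le> (1/2) ^ n"
proof -
  define x where "x = real n"
  have x: "x \<ge> 2" using assms by (simp add: x_def)
  have "x \<le> exp (x / 2)"
  proof -
    have "0 \<le> (1 - x / 2)\<^sup>2 + 1" by simp
    then have "x \<le> 1 + x / 2 + (x / 2)\<^sup>2 / 2" by (simp add: power2_eq_square algebra_simps)
    also have "\<dots> \<le> exp (x / 2)" using x by (intro exp_lower_Taylor_quadratic) auto
    finally show ?thesis .
  qed
  then have "x\<^sup>2 \<le> (exp (x / 2))\<^sup>2" using x by (intro power_mono) auto
  also have "\<dots> = exp x" by (simp add: exp_of_nat_mult[symmetric])
  finally have 1: "x\<^sup>2 \<le> exp x" .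
  have "2 * x \<le> u * (x\<^sup>2 - 2)"
  proof (rule mult_mono)
    have "0 \<le> (x - 2) * (x + 1)" using x by (intro mult_nonneg_nonneg) auto
    then show "x \<le> x\<^sup>2 - 2" by (simp add: power2_eq_square algebra_simps)
  qed (use assms x in auto)
  then have "exp x * exp (- (u * (x\<^sup>2 - 2))) \<le> exp (- x)"
    unfolding exp_add[symmetric] by simp
  with 1 have "x\<^sup>2 * exp (- (u * (x\<^sup>2 - 2))) \<le> exp (- x)"
    by (meson exp_ge_zero mult_right_mono order_trans)
  also have "exp (- x) = exp (- 1) ^ n" by (simp add: x_def exp_of_nat_mult[symmetric])
  also have "\<dots> \<le> (1/2) ^ n"
    using exp_ge_add_one_self[of 1] by (intro power_mono) (auto simp: exp_minus field_simps)
  finally show ?thesis by (simp add: x_def)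
qed

text \<open>The threshold 12/5 turns n^2 + n - 1/3 >= 5/3 * n into the exponent 4 * n. The factor 2
  * n + 1 <= exp (2 * n) uses up half of it, and 2 * n >= n + 1.\<close>

lemma odd_exp_bound:
  fixes u :: real
  assumes "1 \<le> n" "12/5 \<le> u"
  shows "(2 * real n + 1) * exp (- (u * ((real n)\<^sup>2 + real n - 1/3))) \<le> (1/2) ^ (n + 1)"
proof -
  define x where "x = real n"
  have x: "x \<ge> 1" using assms by (simp add: x_def)
  have 1: "2 * x + 1 \<le> exp (2 * x)" using exp_ge_add_one_self[of "2 * x"] by linarith
  have "12/5 * (5/3 * x) \<le> u * (x\<^sup>2 + x - 1/3)"
  proof (rule mult_mono)
    have "0 \<le> (x - 1) * (x + 1/3)" using x by (intro mult_nonneg_nonneg) auto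
    moreover have "(x - 1) * (x + 1/3) = x\<^sup>2 + x - 1/3 - 5/3 * x" by (simp add: power2_eq_square field_simps)
    ultimately show "5/3 * x \<le> x\<^sup>2 + x - 1/3" by linarith
  qed (use assms x in auto)
  then have "exp (2 * x) * exp (- (u * (x\<^sup>2 + x - 1/3))) \<le> exp (- (x + 1))"
    unfolding exp_add[symmetric] using x by simp
  with 1 have "(2 * x + 1) * exp (- (u * (x\<^sup>2 + x - 1/3))) \<le> exp (- (x + 1))"
    by (meson exp_ge_zero mult_right_mono order_trans)
  also have "exp (- (x + 1)) = exp (- 1) ^ (n + 1)" unfolding exp_of_nat_mult[symmetric] by (simp add: x_def)
  also have "\<dots> \<le> (1/2) ^ (n + 1)"
    using exp_ge_add_one_self[of 1] by (intro power_mono) (auto simp: exp_minus field_simps)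
  finally show ?thesis by (simp add: x_def)
qed

lemma abs_sin_mult_le: "\<bar>sin (real n * t)\<bar> \<le> real n * \<bar>sin t\<bar>"
proof (induction n)
  case (Suc n)
  have "sin (real (Suc n) * t) = sin (real n * t) * cos t + cos (real n * t) * sin t"
    by (simp add: distrib_right sin_add add.commute)
  then have "\<bar>sin (real (Suc n) * t)\<bar> \<le> \<bar>sin (real n * t)\<bar> * \<bar>cos t\<bar> + \<bar>cos (real n * t)\<bar> * \<bar>sin t\<bar>"
    by (metis abs_mult abs_triangle_ineq)
  also have "\<dots> \<le> \<bar>sin (real n * t)\<bar> * 1 + 1 * \<bar>sin t\<bar>"
    by (intro add_mono mult_mono) auto
  also have "\<dots> \<le> real (Suc n) * \<bar>sin t\<bar>" using Suc by (simp add: algebra_simps)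
  finally show ?case .
qed simp

lemma abs_cos_odd_mult_le: "\<bar>cos ((2 * real n + 1) * t)\<bar> \<le> (2 * real n + 1) * \<bar>cos t\<bar>"
proof (induction n)
  case (Suc n)
  define w where "w = (2 * real n + 1) * t"
  have "cos ((2 * real (Suc n) + 1) * t) = 2 * cos t * cos (w + t) - cos w"
  proof -
    have "(2 * real (Suc n) + 1) * t = (w + t) + t" by (simp add: w_def algebra_simps)
    moreover have "cos ((w + t) + t) + cos ((w + t) - t) = 2 * cos t * cos (w + t)"
      by (simp only: cos_add[of "w + t" t] cos_diff[of "w + t" t]) simp
    ultimately show ?thesis by simp
  qed
  then have "\<bar>cos ((2 * real (Suc n) + 1) * t)\<bar> \<le> \<bar>2 * cos t * cos (w + t)\<bar> + \<bar>cos w\<bar>"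
    by (simp only: abs_triangle_ineq4)
  also have "\<bar>2 * cos t * cos (w + t)\<bar> \<le> 2 * \<bar>cos t\<bar> * 1"
    unfolding abs_mult by (intro mult_mono) auto
  also have "2 * \<bar>cos t\<bar> * 1 + \<bar>cos w\<bar> \<le> (2 * real (Suc n) + 1) * \<bar>cos t\<bar>"
    using Suc by (simp add: w_def algebra_simps)
  finally show ?case by simp
qed simp

text \<open>Centred at x = 1/2 by phi = pi * x - pi / 2, the difference is 2 * sin (j * phi)^2 up to
  sign, and |sin (j * phi)| <= j * |sin phi| = j * |cos (pi * x)|.\<close>

lemma cos_nat_pi_diff_bound: "\<bar>cos (2 * pi * real j * x) - cos (pi * real j)\<bar> \<le> 2 * (real j)\<^sup>2 * (cos (pi * x))\<^sup>2"
proof -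
  define \<phi> where "\<phi> = pi * x - pi / 2"
  have "cos (2 * pi * real j * x) = cos (2 * (real j * \<phi>) + pi * real j)"
    by (simp add: \<phi>_def algebra_simps)
  also have "\<dots> = cos (2 * (real j * \<phi>)) * cos (pi * real j)"
    using sin_npi2[of j] by (simp add: cos_add)
  finally have "cos (2 * pi * real j * x) - cos (pi * real j) = - (2 * (sin (real j * \<phi>))\<^sup>2 * cos (pi * real j))"
    unfolding cos_double_sin[of "real j * \<phi>"] by (simp only: left_diff_distrib mult_1_left)
  then have "\<bar>cos (2 * pi * real j * x) - cos (pi * real j)\<bar> = 2 * (sin (real j * \<phi>))\<^sup>2 * \<bar>cos (pi * real j)\<bar>"
    by (simp add: abs_mult)
  also have "\<dots> \<le> 2 * (sin (real j * \<phi>))\<^sup>2" by (intro mult_left_le) auto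
  also have "(sin (real j * \<phi>))\<^sup>2 \<le> (real j * \<bar>sin \<phi>\<bar>)\<^sup>2"
    using abs_sin_mult_le[of j \<phi>] by (subst power2_abs[symmetric]) (intro power_mono, auto)
  also have "sin \<phi> = - cos (pi * x)" by (simp add: \<phi>_def sin_diff)
  finally show ?thesis by (simp add: power_mult_distrib)
qed

section \<open>Planar theta functions as single series over one-dimensional ones\<close>

lemma th3_cong_cos:
  assumes X: "X > 0" and c: "cos (2 * pi * d1) = cos (2 * pi * d2)"
  shows "th3 X d1 = th3 X d2"
proof -
  obtain s where "\<bar>th3 X d2 - th3 X d1\<bar> \<le> exp (pi / (4 * X)) * s * \<bar>cos (2 * pi * d2) - cos (2 * pi * d1)\<bar>"
    by (rule th3_slopes[OF X, of "1/2" 0]) auto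
  then show ?thesis using c by simp
qed

lemma th3_minus [simp]: "th3 X (- b) = th3 X b"
  by (simp add: th3_def)

lemma th2_minus [simp]: "th2 X (- b) = th2 X b"
  by (simp add: th2_def)

lemma th3_bounds:
  assumes X: "X > 0"
  shows "0 \<le> th3 X b" "th3 X b \<le> th3 X 0"
proof -
  show "0 \<le> th3 X b" using th3_half_pos[OF X] th3_min[OF X, of b] by linarith
  show "th3 X b \<le> th3 X 0"
    unfolding th3_def using X
    by (intro infsum_mono th3_summable) (auto intro: mult_left_le)
qed

lemma th2_abs_le:
  assumes X: "X > 0"
  shows "\<bar>th2 X b\<bar> \<le> th2 X 0"
proof -
  have s: "(\<lambda>k::int. norm (gauss X (of_int k + 1/2) * cos (2 * pi * (of_int k + 1/2) * b))) summable_on UNIV"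
    by (rule iffD1[OF summable_on_iff_abs_summable_on_real th2_summable[OF X, of b]])
  have "norm (th2 X b) \<le> (\<Sum>\<^sub>\<infinity>k::int. norm (gauss X (of_int k + 1/2) * cos (2 * pi * (of_int k + 1/2) * b)))"
    unfolding th2_def by (rule norm_infsum_bound[OF s])
  also have "\<dots> \<le> th2 X 0"
    unfolding th2_def
    by (rule infsum_mono[OF s th2_summable[OF X]]) (auto simp: abs_mult intro: mult_left_le)
  finally show ?thesis by simp
qed

lemma th2_half [simp]: "th2 X (1/2) = 0"
proof -
  have "cos (2 * pi * (of_int k + 1/2) * (1/2)) = 0" for k :: int
    using sin_npi_int[of k] by (simp add: algebra_simps cos_add add_divide_distrib)
  then show ?thesis by (simp add: th2_def)
qed

text \<open>With \<open>a = \<alpha> * y\<close> and \<open>X = y / \<alpha>\<close>, these are, up to the factor \<open>sqrt X\<close>, the theta functions at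
  \<open>\<alpha>\<close> of the lattice with parameter \<open>x + \<i> y\<close> and of its translate by the cell centre, after Poisson
  summation in one of the two variables. Exchanging \<open>a\<close> and \<open>X\<close> corresponds to duality.\<close>

definition Phi :: "real \<Rightarrow> real \<Rightarrow> real \<Rightarrow> real" where
  "Phi a X x = (\<Sum>\<^sub>\<infinity>n::int. gauss a (of_int n) * th3 X (of_int n * x))"

definition Psi :: "real \<Rightarrow> real \<Rightarrow> real \<Rightarrow> real" where
  "Psi a X x = (\<Sum>\<^sub>\<infinity>n::int. gauss a (of_int n + 1/2) * th3 X (1/2 + (of_int n + 1/2) * x))"

lemma Phi_summable: "a > 0 \<Longrightarrow> X > 0 \<Longrightarrow> (\<lambda>n::int. gauss a (of_int n) * th3 X (of_int n * x)) summable_on UNIV"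
  by (rule summable_on_bounded_mult[where B = "th3 X 0"])
     (auto intro!: summable_on_gauss0 th3_bounds simp: abs_of_nonneg th3_bounds)

lemma Psi_summable: "a > 0 \<Longrightarrow> X > 0 \<Longrightarrow> (\<lambda>n::int. gauss a (of_int n + 1/2) * th3 X (1/2 + (of_int n + 1/2) * x)) summable_on UNIV"
  by (rule summable_on_bounded_mult[where B = "th3 X 0"])
     (auto intro!: summable_on_gauss th3_bounds simp: abs_of_nonneg th3_bounds)

lemma product_summable:
  fixes f :: "'a \<Rightarrow> real" and g :: "'b \<Rightarrow> real"
  assumes "f summable_on UNIV" "g summable_on UNIV" "\<And>x. 0 \<le> f x" "\<And>x. 0 \<le> g x" "\<And>x y. \<bar>h x y\<bar> \<le> 1"
  shows "(\<lambda>(x, y). f x * (g y * h x y)) summable_on UNIV"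
proof -
  have "(\<lambda>(x, y). f x * g y) summable_on UNIV \<times> UNIV"
    by (rule summable_on_SigmaI[where g = "\<lambda>x. f x * infsum g UNIV"])
       (auto intro!: has_sum_cmult_right has_sum_infsum summable_on_cmult_left assms mult_nonneg_nonneg)
  then have "(\<lambda>z. (case z of (x, y) \<Rightarrow> f x * g y) * (case z of (x, y) \<Rightarrow> h x y)) summable_on UNIV"
    by (intro summable_on_bounded_mult[where B = 1]) (auto simp: assms)
  then show ?thesis by (simp add: case_prod_unfold mult.assoc)
qed

text \<open>Expanding \<open>th3\<close> gives a double series whose oscillating factor cos (2 pi k
  n x) is symmetric in the two indices.\<close>

lemma Phi_commute:
  assumes "a > 0" "X > 0"
  shows "Phi a X x = Phi X a x"
proof -
  have "Phi a X x = (\<Sum>\<^sub>\<infinity>n::int. \<Sum>\<^sub>\<infinity>k::int. gauss a (of_int n) * (gauss X (of_int k) * cos (2 * pi * of_int k * (of_int n * x))))"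
    unfolding Phi_def th3_def by (simp add: infsum_cmult_right')
  also have "\<dots> = (\<Sum>\<^sub>\<infinity>k::int. \<Sum>\<^sub>\<infinity>n::int. gauss a (of_int n) * (gauss X (of_int k) * cos (2 * pi * of_int k * (of_int n * x))))"
  proof (rule infsum_swap_banach)
    show "(\<lambda>(n::int, k::int). gauss a (of_int n) * (gauss X (of_int k) * cos (2 * pi * of_int k * (of_int n * x)))) summable_on UNIV \<times> UNIV"
      unfolding UNIV_Times_UNIV using assms by (intro product_summable summable_on_gauss0) simp_all
  qed
  also have "\<dots> = (\<Sum>\<^sub>\<infinity>k::int. \<Sum>\<^sub>\<infinity>n::int. gauss X (of_int k) * (gauss a (of_int n) * cos (2 * pi * of_int n * (of_int k * x))))"
    by (simp add: mult_ac)
  also have "\<dots> = Phi X a x"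
    unfolding Phi_def th3_def by (simp add: infsum_cmult_right')
  finally show ?thesis .
qed

lemma cos_int_pi_sin: "sin (pi * of_int k) = 0"
  using sin_npi_int[of k] by (simp add: mult.commute)

text \<open>The same exchange breaks the symmetry here: the half-integral index stays with a, giving
  \<open>th2\<close>, and the half period in the argument leaves the sign (-1)^k. This form
  converges fast when X is large.\<close>

lemma Psi_swap:
  assumes "a > 0" "X > 0"
  shows "Psi a X x = (\<Sum>\<^sub>\<infinity>k::int. cos (pi * of_int k) * gauss X (of_int k) * th2 a (of_int k * x))"
proof -
  have "Psi a X x = (\<Sum>\<^sub>\<infinity>n::int. \<Sum>\<^sub>\<infinity>k::int. gauss a (of_int n + 1/2) * (gauss X (of_int k) * cos (2 * pi * of_int k * (1/2 + (of_int n + 1/2) * x))))"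
    unfolding Psi_def th3_def by (simp add: infsum_cmult_right')
  also have "\<dots> = (\<Sum>\<^sub>\<infinity>k::int. \<Sum>\<^sub>\<infinity>n::int. gauss a (of_int n + 1/2) * (gauss X (of_int k) * cos (2 * pi * of_int k * (1/2 + (of_int n + 1/2) * x))))"
  proof (rule infsum_swap_banach)
    show "(\<lambda>(n::int, k::int). gauss a (of_int n + 1/2) * (gauss X (of_int k) * cos (2 * pi * of_int k * (1/2 + (of_int n + 1/2) * x)))) summable_on UNIV \<times> UNIV"
      unfolding UNIV_Times_UNIV using assms by (intro product_summable summable_on_gauss0 summable_on_gauss) simp_all
  qed
  also have "\<dots> = (\<Sum>\<^sub>\<infinity>k::int. \<Sum>\<^sub>\<infinity>n::int. cos (pi * of_int k) * gauss X (of_int k) * (gauss a (of_int n + 1/2) * cos (2 * pi * (of_int n + 1/2) * (of_int k * x))))"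
  proof (intro infsum_cong)
    fix k n :: int
    have "2 * pi * of_int k * (1/2 + (of_int n + 1/2) * x) = pi * of_int k + 2 * pi * (of_int n + 1/2) * (of_int k * x)"
      by (simp add: algebra_simps)
    then have "cos (2 * pi * of_int k * (1/2 + (of_int n + 1/2) * x)) = cos (pi * of_int k) * cos (2 * pi * (of_int n + 1/2) * (of_int k * x))"
      by (simp add: cos_add cos_int_pi_sin)
    then show "gauss a (of_int n + 1/2) * (gauss X (of_int k) * cos (2 * pi * of_int k * (1/2 + (of_int n + 1/2) * x)))
      = cos (pi * of_int k) * gauss X (of_int k) * (gauss a (of_int n + 1/2) * cos (2 * pi * (of_int n + 1/2) * (of_int k * x)))"
      by (simp only: mult_ac)
  qed
  also have "\<dots> = (\<Sum>\<^sub>\<infinity>k::int. cos (pi * of_int k) * gauss X (of_int k) * th2 a (of_int k * x))"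
    unfolding th2_def by (simp add: infsum_cmult_right')
  finally show ?thesis .
qed

lemma square_tail_term_ge:
  fixes u l :: real and n :: int
  assumes n: "\<bar>n\<bar> \<ge> 2" and u: "2 \<le> u" and l: "0 \<le> l" and z: "\<bar>z\<bar> \<le> l * ((of_int n)\<^sup>2 * exp (- (u * ((of_int n)\<^sup>2 - 2))))"
  shows "- (l * (1/2) ^ nat \<bar>n\<bar>) \<le> z"
proof -
  have "(real (nat \<bar>n\<bar>))\<^sup>2 * exp (- (u * ((real (nat \<bar>n\<bar>))\<^sup>2 - 2))) \<le> (1/2) ^ nat \<bar>n\<bar>"
    using n u by (intro square_exp_bound) auto
  then have "l * ((of_int n)\<^sup>2 * exp (- (u * ((of_int n)\<^sup>2 - 2)))) \<le> l * (1/2) ^ nat \<bar>n\<bar>"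
    using l by (intro mult_left_mono) auto
  with z show ?thesis by linarith
qed

lemma cos_int_pi_diff_bound: "\<bar>cos (2 * pi * of_int j * x) - cos (pi * of_int j)\<bar> \<le> 2 * (of_int j)\<^sup>2 * (cos (pi * x))\<^sup>2"
proof (cases "0 \<le> j")
  case True
  then show ?thesis using cos_nat_pi_diff_bound[of "nat j" x] by simp
next
  case False
  then have "real (nat (- j)) = - of_int j" by simp
  then show ?thesis using cos_nat_pi_diff_bound[of "nat (- j)" x] by simp
qed

lemma pi_bounds: "3 < pi" "pi < 3.15"
  using pi_approx by simp_all

lemma one_plus_cos_double: "1 + cos (2 * pi * x) = 2 * (cos (pi * x))\<^sup>2"
  using cos_double_cos[of "pi * x"] by (simp add: mult_ac)

text \<open>The terms \<open>n = \<plusminus>1\<close> dominate: the slope of \<open>th3 X\<close> that they produce bounds all other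
  slopes up to the factor \<open>exp (pi / (4 * X)) \<le> exp (pi * a / 3)\<close>.\<close>

lemma Phi_half_less_aux:
  assumes a: "0.866 \<le> a" and X: "X > 0" and aX: "3/4 \<le> a * X" and x: "cos (pi * x) \<noteq> 0"
  shows "Phi a X (1/2) < Phi a X x"
proof -
  define D where "D = 2 * (cos (pi * x))\<^sup>2"
  have D: "D > 0" "cos (2 * pi * x) - cos (2 * pi * (1/2)) = D"
    using x one_plus_cos_double[of x] by (auto simp: D_def)
  obtain s where s: "s > 0" "th3 X x - th3 X (1/2) = s * (cos (2 * pi * x) - cos (2 * pi * (1/2)))"
    and sb: "\<And>d1 d2. \<bar>th3 X d2 - th3 X d1\<bar> \<le> exp (pi / (4 * X)) * s * \<bar>cos (2 * pi * d2) - cos (2 * pi * d1)\<bar>"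
    by (rule th3_slopes[OF X, of "1/2" x]) (use D in auto)
  define t where "t = (\<lambda>n::int. gauss a (of_int n) * th3 X (of_int n * x) - gauss a (of_int n) * th3 X (of_int n * (1/2)))"
  define l where "l = exp (- (pi * a)) * (s * D)"
  have a0: "a > 0" using a by simp
  have l: "l > 0" using s D by (simp add: l_def)
  have ts: "t summable_on UNIV" unfolding t_def by (intro summable_on_diff Phi_summable a0 X)
  have "(\<Sum>n\<in>{-1, 0, 1}. t n + l * (1/2) ^ nat \<bar>n\<bar>) - 3 * l \<le> infsum t UNIV"
  proof (rule infsum_int_dominant_terms[OF ts])
    fix n :: int assume "n \<notin> {-1, 0, 1}"
    then have n: "\<bar>n\<bar> \<ge> 2" by auto
    show "- (l * (1/2) ^ nat \<bar>n\<bar>) \<le> t n"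
    \<comment> \<open>For odd n the value at x = 1/2 is already the minimum of \<open>th3 X\<close>,
      so the term is nonnegative and only even n need a bound.\<close>
    proof (cases "even n")
      case False
      then obtain j where "n = 2 * j + 1" by (elim oddE)
      then have "cos (2 * pi * (of_int n * (1/2))) = cos (2 * pi * (1/2))"
        using cos_int_2pin[of j] sin_int_2pin[of j] by (simp add: algebra_simps cos_add)
      then have "th3 X (of_int n * (1/2)) = th3 X (1/2)" by (rule th3_cong_cos[OF X])
      then have "0 \<le> t n" using th3_min[OF X, of "of_int n * x"]
        by (simp add: t_def mult_left_mono)
      moreover have "0 \<le> l * (1/2) ^ nat \<bar>n\<bar>" using l by simp
      ultimately show ?thesis by linarith
    next
      case True
      define N where "N = (real_of_int n)\<^sup>2"
      have tn: "t n = exp (- (pi * a * N)) * (th3 X (of_int n * x) - th3 X (of_int n * (1/2)))"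
        by (simp add: t_def N_def algebra_simps)
      have "\<bar>th3 X (of_int n * x) - th3 X (of_int n * (1/2))\<bar>
        \<le> exp (pi / (4 * X)) * s * \<bar>cos (2 * pi * (of_int n * x)) - cos (2 * pi * (of_int n * (1/2)))\<bar>"
        by (rule sb)
      also have "\<dots> \<le> exp (pi * a / 3) * s * (N * D)"
      proof (intro mult_mono mult_nonneg_nonneg)
        have "pi * (3/4) \<le> pi * (a * X)" using aX by (intro mult_left_mono) auto
        then show "exp (pi / (4 * X)) \<le> exp (pi * a / 3)" using X by (simp add: field_simps)
        show "\<bar>cos (2 * pi * (of_int n * x)) - cos (2 * pi * (of_int n * (1/2)))\<bar> \<le> N * D"
          using cos_int_pi_diff_bound[of n x] by (simp add: N_def D_def mult_ac)
      qed (use s in auto)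
      finally have "\<bar>t n\<bar> \<le> exp (- (pi * a * N)) * (exp (pi * a / 3) * s * (N * D))"
        unfolding tn abs_mult abs_exp_cancel by (intro mult_left_mono) auto
      also have "\<dots> = (s * D) * (N * (exp (- (pi * a * N)) * exp (pi * a / 3)))" by simp
      also have "\<dots> \<le> (s * D) * (N * (exp (- (pi * a)) * exp (- (pi * a * (N - 2)))))"
        unfolding exp_add[symmetric] using s D a0
        by (intro mult_left_mono) (auto simp: algebra_simps N_def)
      also have "\<dots> = l * (N * exp (- (pi * a * (N - 2))))" by (simp add: l_def)
      finally have "\<bar>t n\<bar> \<le> l * (N * exp (- (pi * a * (N - 2))))" .
      moreover have "2 \<le> pi * a" using mult_mono[of 3 pi "0.866" a] pi_bounds a by simp
      ultimately show ?thesis using n l unfolding N_def by (intro square_tail_term_ge[where u = "pi * a"]) auto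
    qed
  qed simp
  moreover have "t 0 = 0" by (simp add: t_def)
  moreover have "t 1 = l" using s D by (simp add: t_def l_def right_diff_distrib[symmetric])
  moreover have "t (- 1) = l" using s D by (simp add: t_def l_def right_diff_distrib[symmetric])
  \<comment> \<open>The balance is 2 * (l + l/2) + l - 3 * l = l, which keeps the inequality
    strict.\<close>
  ultimately have "l \<le> infsum t UNIV" by simp
  also have "infsum t UNIV = Phi a X x - Phi a X (1/2)"
    unfolding t_def Phi_def by (intro infsum_diff Phi_summable a0 X)
  finally show ?thesis using l by simp
qed

text \<open>The constant lies just below sqrt 3 / 2, so its square falls just short of 3/4.\<close>

lemma factor_ge_of_product:
  fixes a X :: real
  assumes "3/4 \<le> a * X" "a > 0" "X > 0"
  shows "0.866 \<le> a \<or> 0.866 \<le> X"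
proof (rule ccontr)
  assume "\<not> ?thesis"
  then have "a * X \<le> 0.866 * 0.866" using assms by (intro mult_mono) auto
  then show False using assms by simp
qed

lemma Phi_half_less:
  assumes "a > 0" "X > 0" "3/4 \<le> a * X" "cos (pi * x) \<noteq> 0"
  shows "Phi a X (1/2) < Phi a X x"
  using factor_ge_of_product[of a X] Phi_half_less_aux[of a X x] Phi_half_less_aux[of X a x] assms
    Phi_commute[of a X "1/2"] Phi_commute[of a X x] by (auto simp: mult.commute)

text \<open>For large a the terms n = 0 and n = -1 dominate. Both give the slope of
  \<open>th3 X\<close> between 1/2 + x/2 and 3/4, the latter being the value of the former at x =
  1/2, and every other term is bounded through that slope.\<close>

lemma Psi_le_half_aux1:
  assumes a: "0.866 \<le> a" and X: "X > 0" and aX: "3/4 \<le> a * X" and x: "cos (pi * x) > 0"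
  shows "Psi a X x \<le> Psi a X (1/2)"
proof -
  define D where "D = cos (pi * x)"
  have c34: "cos (2 * pi * (3/4)) = 0"
  proof -
    have "2 * pi * (3/4) = pi + pi / 2" by simp
    then show ?thesis by (simp only: cos_add) simp
  qed
  have cx: "cos (2 * pi * (1/2 + x / 2)) = - D" by (simp add: D_def distrib_left cos_add)
  have D: "D > 0" "cos (2 * pi * (3/4)) - cos (2 * pi * (1/2 + x / 2)) = D"
    using x unfolding c34 cx by (auto simp: D_def)
  obtain s where s: "s > 0" "th3 X (3/4) - th3 X (1/2 + x / 2) = s * (cos (2 * pi * (3/4)) - cos (2 * pi * (1/2 + x / 2)))"
    and sb: "\<And>d1 d2. \<bar>th3 X d2 - th3 X d1\<bar> \<le> exp (pi / (4 * X)) * s * \<bar>cos (2 * pi * d2) - cos (2 * pi * d1)\<bar>"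
    by (rule th3_slopes[OF X, of "1/2 + x / 2" "3/4"]) (use D in auto)
  define t where "t = (\<lambda>n::int. gauss a (of_int n + 1/2) * th3 X (1/2 + (of_int n + 1/2) * (1/2))
     - gauss a (of_int n + 1/2) * th3 X (1/2 + (of_int n + 1/2) * x))"
  define l where "l = exp (- (pi * a / 4)) * (s * D)"
  have a0: "a > 0" using a by simp
  have l: "l > 0" using s D by (simp add: l_def)
  have ts: "t summable_on UNIV" unfolding t_def by (intro summable_on_diff Psi_summable a0 X)
  have "(\<Sum>n\<in>{0, -1}. t n + l * (1/2) ^ nat \<bar>n\<bar>) - 3 * l \<le> infsum t UNIV"
  proof (rule infsum_int_dominant_terms[OF ts])
    fix n :: int assume n: "n \<notin> {0, -1}"
    \<comment> \<open>Half-integers come in pairs of opposite sign; m >= 1 labels the pair, so n +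
      1/2 is plus or minus m + 1/2 and |n| <= m + 1.\<close>
    define m where "m = (if 0 \<le> n then nat n else nat (- n - 1))"
    have m: "m \<ge> 1" "real_of_int n + 1/2 = (real m + 1/2) \<or> real_of_int n + 1/2 = - (real m + 1/2)" "nat \<bar>n\<bar> \<le> m + 1"
      using n by (auto simp: m_def)
    have "\<exists>\<epsilon>. (\<epsilon> = 1 \<or> \<epsilon> = - 1) \<and> real_of_int n + 1/2 = \<epsilon> * (real m + 1/2)"
      using m(2) by (metis mult_1 mult_minus1)
    then obtain \<epsilon> :: real where \<epsilon>: "\<epsilon> = 1 \<or> \<epsilon> = - 1" "real_of_int n + 1/2 = \<epsilon> * (real m + 1/2)" by blast
    have c: "cos (2 * pi * (1/2 + \<epsilon> * (real m + 1/2) * z)) = - cos ((2 * real m + 1) * (pi * z))" for z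
    proof -
      have "2 * pi * (1/2 + \<epsilon> * (real m + 1/2) * z) = pi + \<epsilon> * ((2 * real m + 1) * (pi * z))"
        by (simp add: algebra_simps)
      then show ?thesis using \<epsilon>(1) by (auto simp only: cos_add) auto
    qed
    have n2: "(real_of_int n + 1/2)\<^sup>2 = (real m + 1/2)\<^sup>2"
      unfolding \<epsilon>(2) power_mult_distrib using \<epsilon>(1) by auto
    have tn: "\<bar>t n\<bar> = gauss a (real m + 1/2) * \<bar>th3 X (1/2 + \<epsilon> * (real m + 1/2) * (1/2)) - th3 X (1/2 + \<epsilon> * (real m + 1/2) * x)\<bar>"
      unfolding t_def n2 unfolding \<epsilon>(2) by (simp add: right_diff_distrib[symmetric] abs_mult)
    have "\<bar>th3 X (1/2 + \<epsilon> * (real m + 1/2) * (1/2)) - th3 X (1/2 + \<epsilon> * (real m + 1/2) * x)\<bar>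
      \<le> exp (pi / (4 * X)) * s * \<bar>cos (2 * pi * (1/2 + \<epsilon> * (real m + 1/2) * (1/2))) - cos (2 * pi * (1/2 + \<epsilon> * (real m + 1/2) * x))\<bar>"
      by (rule sb)
    also have "\<dots> \<le> exp (pi * a / 3) * s * ((2 * real m + 1) * D)"
    proof (intro mult_mono mult_nonneg_nonneg)
      have "pi * (3/4) \<le> pi * (a * X)" using aX by (intro mult_left_mono) auto
      then show "exp (pi / (4 * X)) \<le> exp (pi * a / 3)" using X by (simp add: field_simps)
      have "cos ((2 * real m + 1) * (pi * (1/2))) = 0"
        using abs_cos_odd_mult_le[of m "pi * (1/2)"] by simp
      then show "\<bar>cos (2 * pi * (1/2 + \<epsilon> * (real m + 1/2) * (1/2))) - cos (2 * pi * (1/2 + \<epsilon> * (real m + 1/2) * x))\<bar> \<le> (2 * real m + 1) * D"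
        unfolding c using abs_cos_odd_mult_le[of m "pi * x"] x by (simp add: D_def)
    qed (use s in auto)
    finally have "\<bar>t n\<bar> \<le> gauss a (real m + 1/2) * (exp (pi * a / 3) * s * ((2 * real m + 1) * D))"
      unfolding tn by (intro mult_left_mono) auto
    also have "\<dots> = (s * D) * ((2 * real m + 1) * (gauss a (real m + 1/2) * exp (pi * a / 3)))" by simp
    also have "gauss a (real m + 1/2) * exp (pi * a / 3)
        = exp (- (pi * a / 4)) * exp (- (pi * a * ((real m)\<^sup>2 + real m - 1/3)))"
      unfolding exp_add[symmetric] by (simp add: algebra_simps power2_eq_square)
    also have "(s * D) * ((2 * real m + 1) * (exp (- (pi * a / 4)) * exp (- (pi * a * ((real m)\<^sup>2 + real m - 1/3)))))
       = l * ((2 * real m + 1) * exp (- (pi * a * ((real m)\<^sup>2 + real m - 1/3))))"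
      by (simp add: l_def)
    also have "\<dots> \<le> l * (1/2) ^ (m + 1)"
    proof -
      have "12/5 \<le> pi * a" using mult_mono[of 3 pi "0.866" a] pi_bounds a by simp
      then show ?thesis using l m(1) by (intro mult_left_mono odd_exp_bound) auto
    qed
    also have "\<dots> \<le> l * (1/2) ^ nat \<bar>n\<bar>" using l m(3) by (intro mult_left_mono power_decreasing) auto
    finally show "- (l * (1/2) ^ nat \<bar>n\<bar>) \<le> t n" by linarith
  qed simp
  moreover have "t 0 = l"
    using s D by (simp add: t_def l_def right_diff_distrib[symmetric] power2_eq_square)
  moreover have "t (- 1) = l"
  proof -
    have "th3 X (1/2 - 1/4) = th3 X (3/4)"
    proof (rule th3_cong_cos[OF X])
      have "cos (2 * pi * (1/2 - 1/4)) = 0" by (simp add: field_simps)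
      then show "cos (2 * pi * (1/2 - 1/4)) = cos (2 * pi * (3/4))" using c34 by simp
    qed
    moreover have "th3 X (1/2 - x / 2) = th3 X (1/2 + x / 2)"
      by (rule th3_cong_cos[OF X]) (simp add: distrib_left right_diff_distrib cos_add cos_diff)
    ultimately show ?thesis
      using s D by (simp add: t_def l_def right_diff_distrib[symmetric] power2_eq_square)
  qed
  \<comment> \<open>The weights at 0 and -1 are l and l/2, so the balance is 2 * l + 3/2 * l - 3 * l
    = l/2.\<close>
  ultimately have "0 \<le> infsum t UNIV" using l by simp
  also have "infsum t UNIV = Psi a X (1/2) - Psi a X x"
    unfolding t_def Psi_def by (intro infsum_diff Psi_summable a0 X)
  finally show ?thesis by simp
qed

text \<open>For large X the exchanged series is used. Its term k = 0 does not depend on x, the terms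
  k = 1 and k = -1 dominate, and slopes are those of \<open>th2 a\<close> in cos (pi b), with exp (3
  * pi / (4 * a)) <= exp (pi * X) since a * X >= 3/4.\<close>

lemma Psi_le_half_aux2:
  assumes X: "0.866 \<le> X" and a: "a > 0" and aX: "3/4 \<le> a * X" and x: "cos (pi * x) > 0"
  shows "Psi a X x \<le> Psi a X (1/2)"
proof -
  define D where "D = cos (pi * x)"
  have D: "D > 0" "cos (pi * x) - cos (pi * (1/2)) = D" using x by (auto simp: D_def)
  obtain s where s: "s \<ge> 0" "th2 a x - th2 a (1/2) = s * (cos (pi * x) - cos (pi * (1/2)))"
    and sb: "\<And>d1 d2. \<bar>th2 a d2 - th2 a d1\<bar> \<le> exp (3 * pi / (4 * a)) * s * \<bar>cos (pi * d2) - cos (pi * d1)\<bar>"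
    by (rule th2_slopes[OF a, of "1/2" x]) (use D in auto)
  define u where "u = (\<lambda>x (k::int). gauss X (of_int k) * (cos (pi * of_int k) * th2 a (of_int k * x)))"
  have X0: "X > 0" using X by simp
  have us: "u x summable_on UNIV" for x
    unfolding u_def
  proof (rule summable_on_bounded_mult[where B = "1 * th2 a 0"])
    show "\<bar>cos (pi * of_int k) * th2 a (of_int k * x)\<bar> \<le> 1 * th2 a 0" for k :: int
      unfolding abs_mult by (intro mult_mono th2_abs_le a) auto
  qed (use X0 in \<open>auto intro!: summable_on_gauss0\<close>)
  have Pu: "Psi a X x = infsum (u x) UNIV" for x
    unfolding Psi_swap[OF a X0] u_def by (simp add: mult_ac)
  define t where "t = (\<lambda>k. u (1/2) k - u x k)"
  define l where "l = exp (- (pi * X)) * (s * D)"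
  have l: "l \<ge> 0" using s D by (simp add: l_def)
  have ts: "t summable_on UNIV" unfolding t_def by (intro summable_on_diff us)
  have "(\<Sum>n\<in>{-1, 0, 1}. t n + l * (1/2) ^ nat \<bar>n\<bar>) - 3 * l \<le> infsum t UNIV"
  proof (rule infsum_int_dominant_terms[OF ts])
    fix n :: int assume "n \<notin> {-1, 0, 1}"
    then have n: "\<bar>n\<bar> \<ge> 2" by auto
    define N where "N = (real_of_int n)\<^sup>2"
    \<comment> \<open>At x = 1/2 the cosine is a sign for even n, and the difference is quadratic in
      cos (pi * x); for odd n it vanishes there and the bound is linear. As 0 < cos (pi * x) <= 1,
      both are covered by n^2 * D.\<close>
    have cb: "\<bar>cos (pi * (of_int n * (1/2))) - cos (pi * (of_int n * x))\<bar> \<le> N * D"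
    proof (cases "even n")
      case True
      then obtain j where j: "n = 2 * j" by (elim evenE)
      have "\<bar>cos (pi * (of_int n * (1/2))) - cos (pi * (of_int n * x))\<bar> = \<bar>cos (2 * pi * of_int j * x) - cos (pi * of_int j)\<bar>"
        by (simp add: j abs_minus_commute mult_ac)
      also have "\<dots> \<le> 2 * (of_int j)\<^sup>2 * (cos (pi * x))\<^sup>2" by (rule cos_int_pi_diff_bound)
      also have "\<dots> \<le> N * D"
      proof (rule mult_mono)
        show "(cos (pi * x))\<^sup>2 \<le> D" using x mult_left_le[of "cos (pi * x)" "cos (pi * x)"] by (simp add: D_def power2_eq_square)
      qed (use D in \<open>auto simp: N_def j power2_eq_square\<close>)
      finally show ?thesis .
    next
      case False
      then obtain j where j: "n = 2 * j + 1" by (elim oddE)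
      define m where "m = (if 0 \<le> j then nat j else nat (- j - 1))"
      have nm: "n = 2 * int m + 1 \<or> n = - (2 * int m + 1)" by (auto simp: m_def j)
      have cn: "\<bar>cos (pi * (of_int n * z))\<bar> \<le> \<bar>of_int n\<bar> * \<bar>cos (pi * z)\<bar>" for z
      proof -
        have "cos (pi * (of_int n * z)) = cos ((2 * real m + 1) * (pi * z))"
          using nm
        proof
          assume "n = 2 * int m + 1"
          then have "pi * (of_int n * z) = (2 * real m + 1) * (pi * z)" by (simp add: algebra_simps)
          then show ?thesis by (simp only:)
        next
          assume "n = - (2 * int m + 1)"
          then have "real_of_int n = - (2 * real m + 1)" by simp
          then have "pi * (of_int n * z) = - ((2 * real m + 1) * (pi * z))" by (simp only:) (simp add: algebra_simps)
          then show ?thesis by (simp only: cos_minus)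
        qed
        moreover have "\<bar>real_of_int n\<bar> = 2 * real m + 1" using nm by auto
        ultimately show ?thesis using abs_cos_odd_mult_le[of m "pi * z"] by simp
      qed
      have "cos (pi * (of_int n * (1/2))) = 0" using cn[of "1/2"] by simp
      then have "\<bar>cos (pi * (of_int n * (1/2))) - cos (pi * (of_int n * x))\<bar> \<le> \<bar>of_int n\<bar> * D"
        using cn[of x] D by (simp add: D_def)
      also have "\<dots> \<le> N * D"
      proof -
        have "\<bar>real_of_int n\<bar> * 1 \<le> \<bar>of_int n\<bar> * \<bar>of_int n\<bar>" using n by (intro mult_left_mono) auto
        then show ?thesis using D by (intro mult_right_mono) (auto simp: N_def power2_eq_square)
      qed
      finally show ?thesis .
    qed
    have "t n = exp (- (pi * X * N)) * (cos (pi * of_int n) * (th2 a (of_int n * (1/2)) - th2 a (of_int n * x)))"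
      by (simp add: t_def u_def N_def algebra_simps)
    then have "\<bar>t n\<bar> = exp (- (pi * X * N)) * (\<bar>cos (pi * of_int n)\<bar> * \<bar>th2 a (of_int n * (1/2)) - th2 a (of_int n * x)\<bar>)"
      by (simp add: abs_mult)
    also have "\<dots> \<le> exp (- (pi * X * N)) * (1 * (exp (pi * X) * s * (N * D)))"
    proof (intro mult_left_mono mult_mono)
      have "\<bar>th2 a (of_int n * (1/2)) - th2 a (of_int n * x)\<bar> \<le> exp (3 * pi / (4 * a)) * s * \<bar>cos (pi * (of_int n * (1/2))) - cos (pi * (of_int n * x))\<bar>"
        by (rule sb)
      also have "\<dots> \<le> exp (pi * X) * s * (N * D)"
      proof (intro mult_mono mult_nonneg_nonneg cb)
        have "pi * (3/4) \<le> pi * (a * X)" using aX by (intro mult_left_mono) auto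
        then show "exp (3 * pi / (4 * a)) \<le> exp (pi * X)" using a by (simp add: field_simps)
      qed (use s in auto)
      finally show "\<bar>th2 a (of_int n * (1/2)) - th2 a (of_int n * x)\<bar> \<le> exp (pi * X) * s * (N * D)" .
    qed auto
    also have "\<dots> = (s * D) * (N * (exp (- (pi * X * N)) * exp (pi * X)))" by simp
    also have "exp (- (pi * X * N)) * exp (pi * X) = exp (- (pi * X)) * exp (- (pi * X * (N - 2)))"
      unfolding exp_add[symmetric] by (simp add: algebra_simps)
    also have "(s * D) * (N * (exp (- (pi * X)) * exp (- (pi * X * (N - 2))))) = l * (N * exp (- (pi * X * (N - 2))))" by (simp add: l_def)
    finally have "\<bar>t n\<bar> \<le> l * (N * exp (- (pi * X * (N - 2))))" .
    moreover have "2 \<le> pi * X" using mult_mono[of 3 pi "0.866" X] pi_bounds X by simp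
    ultimately show "- (l * (1/2) ^ nat \<bar>n\<bar>) \<le> t n"
      using n l unfolding N_def by (intro square_tail_term_ge[where u = "pi * X"]) auto
  qed simp
  moreover have "t 0 = 0" by (simp add: t_def u_def)
  \<comment> \<open>The sign cos (pi * k) = -1 reverses the difference, so that the larger value of
    \<open>th2\<close> at x counts in favour of 1/2.\<close>
  moreover have "t 1 = l" "t (- 1) = l" using s D by (simp_all add: t_def u_def l_def)
  ultimately have "0 \<le> infsum t UNIV" using l by simp
  also have "infsum t UNIV = Psi a X (1/2) - Psi a X x"
    unfolding t_def Pu by (intro infsum_diff us)
  finally show ?thesis by simp
qed

lemma Psi_le_half:
  assumes "a > 0" "X > 0" "3/4 \<le> a * X" "cos (pi * x) > 0"
  shows "Psi a X x \<le> Psi a X (1/2)"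
  using factor_ge_of_product[of a X] Psi_le_half_aux1[of a X x] Psi_le_half_aux2[of X a x] assms by auto

text \<open>At x = 1/2 the odd k drop out, because the cosines in \<open>th2\<close> are taken at
  odd multiples of pi / 2. For k = 2 * j the values are (-1)^j * th2 a 0, so the double sum factors;
  Poisson summation turns th2 a 0 into theta_4.\<close>

lemma Psi_half:
  assumes a: "a > 0" and X: "X > 0"
  shows "Psi a X (1/2) = sqrt (1 / a) * th3 (1 / a) (1/2) * th3 (4 * X) (1/2)"
proof -
  define u where "u = (\<lambda>k::int. cos (pi * of_int k) * gauss X (of_int k) * th2 a (of_int k * (1/2)))"
  have "Psi a X (1/2) = infsum u UNIV" unfolding Psi_swap[OF a X] u_def ..
  also have "\<dots> = infsum u (range (\<lambda>j. 2 * j))"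
  proof (rule infsum_cong_neutral)
    fix k assume "k \<in> UNIV - range (\<lambda>j::int. 2 * j)"
    then have "odd k" by (auto elim!: evenE)
    then obtain j where j: "k = 2 * j + 1" by (elim oddE)
    have "cos (2 * pi * (of_int m + 1/2) * (of_int k * (1/2))) = 0" for m :: int
    proof -
      have "2 * pi * (of_int m + 1/2) * (of_int k * (1/2)) = pi * of_int (2 * m * j + m + j) + pi / 2"
        by (simp add: j algebra_simps add_divide_distrib)
      then show ?thesis by (simp only: cos_add cos_int_pi_sin cos_pi_half)
    qed
    then show "u k = 0" by (simp add: u_def th2_def)
  qed auto
  also have "\<dots> = (\<Sum>\<^sub>\<infinity>j. u (2 * j))"
    by (subst infsum_reindex) (auto simp: inj_on_def o_def)
  also have "\<dots> = (\<Sum>\<^sub>\<infinity>j::int. th2 a 0 * (gauss (4 * X) (of_int j) * cos (2 * pi * of_int j * (1/2))))"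
  proof (rule infsum_cong)
    fix j :: int
    have "th2 a (of_int j) = cos (pi * of_int j) * th2 a 0"
    proof -
      have h: "cos (2 * pi * (of_int m + 1/2) * of_int j) = cos (pi * of_int j)" for m :: int
      proof -
        have "2 * pi * (of_int m + 1/2) * of_int j = 2 * pi * of_int (m * j) + pi * of_int j"
          by (simp add: algebra_simps)
        then show ?thesis using cos_int_2pin[of "m * j"] sin_int_2pin[of "m * j"] by (simp add: cos_add)
      qed
      have "th2 a (of_int j) = (\<Sum>\<^sub>\<infinity>k::int. gauss a (of_int k + 1/2) * cos (pi * of_int j))"
        unfolding th2_def h ..
      also have "\<dots> = (\<Sum>\<^sub>\<infinity>k::int. gauss a (of_int k + 1/2)) * cos (pi * of_int j)"
        by (rule infsum_cmult_left')
      also have "(\<Sum>\<^sub>\<infinity>k::int. gauss a (of_int k + 1/2)) = th2 a 0" by (simp add: th2_def)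
      finally show ?thesis by (simp only: mult.commute)
    qed
    moreover have "cos (pi * of_int (2 * j)) = 1" using cos_int_2pin[of j] by (simp add: mult_ac)
    ultimately show "u (2 * j) = th2 a 0 * (gauss (4 * X) (of_int j) * cos (2 * pi * of_int j * (1/2)))"
      by (simp add: u_def power_mult_distrib mult_ac)
  qed
  also have "\<dots> = th2 a 0 * th3 (4 * X) (1/2)"
    by (simp add: th3_def infsum_cmult_right')
  also have "th2 a 0 = sqrt (1 / a) * th3 (1 / a) (1/2)"
    unfolding th2_def
    using gauss_poisson[of "1 / a" "1/2"] a by (simp add: mult_ac)
  finally show ?thesis .
qed

section \<open>Theta functions of planar lattices\<close>

text \<open>The pair \<open>(n, m)\<close> stands for the lattice vector \<open>m + n * (x + \<i> y)\<close>, scaled to unit covolume.\<close>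

definition theta :: "real \<Rightarrow> real \<Rightarrow> real \<Rightarrow> real" where
  "theta \<alpha> x y = (\<Sum>\<^sub>\<infinity>(n::int, m::int). exp (- (pi * \<alpha> * (((of_int m + of_int n * x)\<^sup>2 + (of_int n * y)\<^sup>2) / y))))"

definition theta_center :: "real \<Rightarrow> real \<Rightarrow> real \<Rightarrow> real" where
  "theta_center \<alpha> x y = (\<Sum>\<^sub>\<infinity>(n::int, m::int). exp (- (pi * \<alpha> *
     (((of_int m + 1/2 + (of_int n + 1/2) * x)\<^sup>2 + ((of_int n + 1/2) * y)\<^sup>2) / y))))"

text \<open>Row by row: the sum over m is evaluated by Poisson summation, the Gaussian in n remains.
  The offset d is 0 for the lattice and 1/2 for the translate by the cell centre.\<close>

lemma shifted_theta_has_sum: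
  fixes d \<alpha> x y :: real and c :: "real \<Rightarrow> real"
  assumes \<alpha>: "\<alpha> > 0" and y: "y > 0"
    and s: "(\<lambda>n::int. gauss (\<alpha> * y) (of_int n + d) * th3 (y / \<alpha>) (d + (of_int n + d) * x)) summable_on UNIV"
  shows "((\<lambda>(n::int, m::int). exp (- (pi * \<alpha> * (((of_int m + d + (of_int n + d) * x)\<^sup>2 + ((of_int n + d) * y)\<^sup>2) / y))))
    has_sum (sqrt (y / \<alpha>) * (\<Sum>\<^sub>\<infinity>n::int. gauss (\<alpha> * y) (of_int n + d) * th3 (y / \<alpha>) (d + (of_int n + d) * x)))) UNIV"
proof -
  define f where "f = (\<lambda>(n::int, m::int). exp (- (pi * \<alpha> * (((of_int m + d + (of_int n + d) * x)\<^sup>2 + ((of_int n + d) * y)\<^sup>2) / y))))"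
  define g where "g = (\<lambda>n::int. sqrt (y / \<alpha>) * (gauss (\<alpha> * y) (of_int n + d) * th3 (y / \<alpha>) (d + (of_int n + d) * x)))"
  have X: "y / \<alpha> > 0" using \<alpha> y by simp
  have inner: "((\<lambda>m. f (n, m)) has_sum g n) UNIV" for n
  proof -
    have e: "f (n, m) = gauss (\<alpha> * y) (of_int n + d) * dual_gauss (y / \<alpha>) (of_int m + (d + (of_int n + d) * x))" for m
      unfolding f_def exp_add[symmetric] using y by (simp add: power2_eq_square field_simps)
    have sm: "(\<lambda>m::int. dual_gauss (y / \<alpha>) (of_int m + (d + (of_int n + d) * x))) summable_on UNIV"
    proof -
      have "(\<lambda>m::int. exp (- (pi / (y / \<alpha>) * (of_int m + (d + (of_int n + d) * x))\<^sup>2))) summable_on UNIV"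
        using \<alpha> y by (intro summable_on_gauss divide_pos_pos) auto
      then show ?thesis by (simp add: mult_ac)
    qed
    have "((\<lambda>m::int. dual_gauss (y / \<alpha>) (of_int m + (d + (of_int n + d) * x))) has_sum
       (sqrt (y / \<alpha>) * th3 (y / \<alpha>) (d + (of_int n + d) * x))) UNIV"
      using has_sum_infsum[OF sm] unfolding gauss_poisson[OF X] .
    from has_sum_cmult_right[OF this, of "gauss (\<alpha> * y) (of_int n + d)"]
    show ?thesis unfolding e g_def by (simp add: mult_ac)
  qed
  have gs: "(g has_sum (sqrt (y / \<alpha>) * (\<Sum>\<^sub>\<infinity>n::int. gauss (\<alpha> * y) (of_int n + d) * th3 (y / \<alpha>) (d + (of_int n + d) * x)))) UNIV"
    unfolding g_def by (intro has_sum_cmult_right has_sum_infsum s)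
  have fs: "f summable_on Sigma UNIV (\<lambda>_. UNIV)"
    by (rule summable_on_SigmaI[OF inner]) (use gs in \<open>auto simp: f_def has_sum_imp_summable\<close>)
  have "(f has_sum (sqrt (y / \<alpha>) * (\<Sum>\<^sub>\<infinity>n::int. gauss (\<alpha> * y) (of_int n + d) * th3 (y / \<alpha>) (d + (of_int n + d) * x)))) (Sigma UNIV (\<lambda>_. UNIV))"
    by (rule has_sum_SigmaI[OF inner gs fs])
  then show ?thesis by (simp add: f_def)
qed

lemma theta_has_sum:
  assumes \<alpha>: "\<alpha> > 0" and y: "y > 0"
  shows "((\<lambda>(n::int, m::int). exp (- (pi * \<alpha> * (((of_int m + of_int n * x)\<^sup>2 + (of_int n * y)\<^sup>2) / y)))) has_sum theta \<alpha> x y) UNIV"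
    and "theta \<alpha> x y = sqrt (y / \<alpha>) * Phi (\<alpha> * y) (y / \<alpha>) x"
proof -
  have "((\<lambda>(n::int, m::int). exp (- (pi * \<alpha> * (((of_int m + 0 + (of_int n + 0) * x)\<^sup>2 + ((of_int n + 0) * y)\<^sup>2) / y))))
    has_sum (sqrt (y / \<alpha>) * (\<Sum>\<^sub>\<infinity>n::int. gauss (\<alpha> * y) (of_int n + 0) * th3 (y / \<alpha>) (0 + (of_int n + 0) * x)))) UNIV"
    using \<alpha> y Phi_summable[of "\<alpha> * y" "y / \<alpha>" x] by (intro shifted_theta_has_sum) simp_all
  then have h: "((\<lambda>(n::int, m::int). exp (- (pi * \<alpha> * (((of_int m + of_int n * x)\<^sup>2 + (of_int n * y)\<^sup>2) / y)))) has_sum sqrt (y / \<alpha>) * Phi (\<alpha> * y) (y / \<alpha>) x) UNIV"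
    by (simp add: Phi_def)
  then show t: "theta \<alpha> x y = sqrt (y / \<alpha>) * Phi (\<alpha> * y) (y / \<alpha>) x"
    unfolding theta_def by (rule infsumI)
  show "((\<lambda>(n::int, m::int). exp (- (pi * \<alpha> * (((of_int m + of_int n * x)\<^sup>2 + (of_int n * y)\<^sup>2) / y)))) has_sum theta \<alpha> x y) UNIV"
    using h unfolding t .
qed

lemma theta_center_has_sum:
  assumes \<alpha>: "\<alpha> > 0" and y: "y > 0"
  shows "((\<lambda>(n::int, m::int). exp (- (pi * \<alpha> * (((of_int m + 1/2 + (of_int n + 1/2) * x)\<^sup>2 + ((of_int n + 1/2) * y)\<^sup>2) / y)))) has_sum theta_center \<alpha> x y) UNIV"
    and "theta_center \<alpha> x y = sqrt (y / \<alpha>) * Psi (\<alpha> * y) (y / \<alpha>) x"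
proof -
  have h: "((\<lambda>(n::int, m::int). exp (- (pi * \<alpha> * (((of_int m + 1/2 + (of_int n + 1/2) * x)\<^sup>2 + ((of_int n + 1/2) * y)\<^sup>2) / y))))
    has_sum sqrt (y / \<alpha>) * Psi (\<alpha> * y) (y / \<alpha>) x) UNIV"
    unfolding Psi_def using \<alpha> y Psi_summable[of "\<alpha> * y" "y / \<alpha>" x] by (intro shifted_theta_has_sum) simp_all
  then show t: "theta_center \<alpha> x y = sqrt (y / \<alpha>) * Psi (\<alpha> * y) (y / \<alpha>) x"
    unfolding theta_center_def by (rule infsumI)
  show "((\<lambda>(n::int, m::int). exp (- (pi * \<alpha> * (((of_int m + 1/2 + (of_int n + 1/2) * x)\<^sup>2 + ((of_int n + 1/2) * y)\<^sup>2) / y)))) has_sum theta_center \<alpha> x y) UNIV"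
    using h unfolding t .
qed

text \<open>Replacing alpha by 1 / alpha exchanges the arguments alpha * y and y / alpha of the
  symmetric \<open>Phi\<close>. Geometrically, the dual of a planar unit lattice is its image under
  a quarter turn.\<close>

lemma theta_functional:
  assumes "\<alpha> > 0" "y > 0"
  shows "theta (1 / \<alpha>) x y = \<alpha> * theta \<alpha> x y"
proof -
  have "theta (1 / \<alpha>) x y = sqrt (y * \<alpha>) * Phi (y / \<alpha>) (\<alpha> * y) x"
    using theta_has_sum(2)[of "1 / \<alpha>" y x] assms by (simp add: mult.commute)
  also have "Phi (y / \<alpha>) (\<alpha> * y) x = Phi (\<alpha> * y) (y / \<alpha>) x"
    using assms by (intro Phi_commute) auto
  also have "sqrt (y * \<alpha>) = \<alpha> * sqrt (y / \<alpha>)"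
  proof -
    have e: "y * \<alpha> = \<alpha>\<^sup>2 * (y / \<alpha>)" using assms by (simp add: power2_eq_square)
    show ?thesis unfolding e real_sqrt_mult real_sqrt_abs using assms by simp
  qed
  finally show ?thesis using theta_has_sum(2)[OF assms] by simp
qed

lemma theta_half_less:
  assumes "\<alpha> > 0" "y > 0" "3/4 \<le> y\<^sup>2" "cos (pi * x) \<noteq> 0"
  shows "theta \<alpha> (1/2) y < theta \<alpha> x y"
proof -
  have "Phi (\<alpha> * y) (y / \<alpha>) (1/2) < Phi (\<alpha> * y) (y / \<alpha>) x"
    using assms by (intro Phi_half_less) (auto simp: power2_eq_square)
  then show ?thesis using assms by (simp add: theta_has_sum(2))
qed

lemma theta_center_le_half:
  assumes "\<alpha> > 0" "y > 0" "3/4 \<le> y\<^sup>2" "cos (pi * x) > 0"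
  shows "theta_center \<alpha> x y \<le> theta_center \<alpha> (1/2) y"
proof -
  have "Psi (\<alpha> * y) (y / \<alpha>) x \<le> Psi (\<alpha> * y) (y / \<alpha>) (1/2)"
    using assms by (intro Psi_le_half) (auto simp: power2_eq_square)
  then show ?thesis using assms by (simp add: theta_center_has_sum(2) mult_left_mono)
qed

text \<open>By \<open>Psi_half\<close> the function is, up to 1 / alpha, a product of theta_4 values
  at b * Y and b / Y with b = 2 / alpha and Y = 2 * y; the condition Y >= 1 is y >= 1/2.\<close>

lemma theta_center_half_antimono:
  assumes \<alpha>: "\<alpha> > 0" and y: "1/2 \<le> y1" "y1 \<le> y2"
  shows "theta_center \<alpha> (1/2) y2 \<le> theta_center \<alpha> (1/2) y1"
proof -
  have e: "theta_center \<alpha> (1/2) y = 1 / \<alpha> * (th3 (2 / \<alpha> * (2 * y)) (1/2) * th3 (2 / \<alpha> / (2 * y)) (1/2))" if y: "y > 0" for y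
  proof -
    have "sqrt (y / \<alpha>) * sqrt (1 / (\<alpha> * y)) = 1 / \<alpha>"
    proof -
      have "y / \<alpha> * (1 / (\<alpha> * y)) = (1 / \<alpha>)\<^sup>2" using \<alpha> y by (simp add: power2_eq_square)
      then show ?thesis using \<alpha> by (simp only: real_sqrt_mult[symmetric] real_sqrt_abs) simp
    qed
    moreover have "theta_center \<alpha> (1/2) y = sqrt (y / \<alpha>) * (sqrt (1 / (\<alpha> * y)) * th3 (1 / (\<alpha> * y)) (1/2) * th3 (4 * (y / \<alpha>)) (1/2))"
      using \<alpha> y by (simp add: theta_center_has_sum(2) Psi_half)
    moreover have "2 / \<alpha> * (2 * y) = 4 * (y / \<alpha>)" "2 / \<alpha> / (2 * y) = 1 / (\<alpha> * y)" by simp_all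
    ultimately show ?thesis by (simp only: mult_ac) (simp only: mult.assoc[symmetric])
  qed
  have "th3 (2 / \<alpha> * (2 * y2)) (1/2) * th3 (2 / \<alpha> / (2 * y2)) (1/2) \<le> th3 (2 / \<alpha> * (2 * y1)) (1/2) * th3 (2 / \<alpha> / (2 * y1)) (1/2)"
    using \<alpha> y by (intro th3_half_pair_antimono) auto
  then have "1 / \<alpha> * (th3 (2 / \<alpha> * (2 * y2)) (1/2) * th3 (2 / \<alpha> / (2 * y2)) (1/2)) \<le> 1 / \<alpha> * (th3 (2 / \<alpha> * (2 * y1)) (1/2) * th3 (2 / \<alpha> / (2 * y1)) (1/2))"
    using \<alpha> by (intro mult_left_mono) auto
  then show ?thesis using e[of y1] e[of y2] y by simp
qed

section \<open>The norm form of the Eisenstein integers and Gaussian sums weighted by it\<close>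

definition hex_norm :: "int \<times> int \<Rightarrow> int" where
  "hex_norm = (\<lambda>(n, m). m\<^sup>2 + m * n + n\<^sup>2)"

lemma hex_norm_ge: "m\<^sup>2 + n\<^sup>2 \<le> 2 * hex_norm (n, m)" "0 \<le> hex_norm p"
proof -
  have a: "m\<^sup>2 + n\<^sup>2 \<le> 2 * hex_norm (n, m)" for m n
  proof -
    have "0 \<le> (m + n)\<^sup>2" by simp
    then show ?thesis by (simp add: hex_norm_def power2_eq_square algebra_simps)
  qed
  then show "m\<^sup>2 + n\<^sup>2 \<le> 2 * hex_norm (n, m)" .
  obtain n m where p: "p = (n, m)" by (cases p)
  have "0 \<le> m\<^sup>2 + n\<^sup>2" by simp
  with a[of m n] show "0 \<le> hex_norm p" unfolding p by linarith
qed

text \<open>The origin and the six minimal vectors.\<close>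

definition hex_shell :: "(int \<times> int) set" where
  "hex_shell = {(0, 0), (0, 1), (0, -1), (1, 0), (-1, 0), (1, -1), (-1, 1)}"

text \<open>The form does not represent 2: a value below 3 forces both coordinates into {-1, 0, 1}.
  The second part uses (|m| + |n|)^2 <= 4 * N, which for N >= 3 implies |m| + |n| <= N.\<close>

lemma hex_norm_ge_3:
  assumes "p \<notin> hex_shell"
  shows "3 \<le> hex_norm p" "nat \<bar>fst p\<bar> + nat \<bar>snd p\<bar> \<le> nat (hex_norm p)"
proof -
  obtain n m where p: "p = (n, m)" by (cases p)
  have s: "4 * hex_norm p = (2 * m + n)\<^sup>2 + 3 * n\<^sup>2" "4 * hex_norm p = (2 * n + m)\<^sup>2 + 3 * m\<^sup>2"
    by (simp_all add: p hex_norm_def power2_eq_square algebra_simps)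
  show 3: "3 \<le> hex_norm p"
  proof (rule ccontr)
    assume "\<not> 3 \<le> hex_norm p"
    then have "n\<^sup>2 < 4" "m\<^sup>2 < 4"
      using s zero_le_power2[of "2 * m + n"] zero_le_power2[of "2 * n + m"] by linarith+
    then have "\<bar>n\<bar> < 2" "\<bar>m\<bar> < 2"
      using power2_less_imp_less[of "\<bar>n\<bar>" 2] power2_less_imp_less[of "\<bar>m\<bar>" 2] by simp_all
    then have "n \<in> {-1, 0, 1}" "m \<in> {-1, 0, 1}" by auto
    then show False using assms \<open>\<not> 3 \<le> hex_norm p\<close>
      by (elim insertE emptyE) (simp_all add: p hex_shell_def hex_norm_def)
  qed
  have "(\<bar>m\<bar> + \<bar>n\<bar>)\<^sup>2 \<le> 4 * hex_norm p"
  proof -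
    have "0 \<le> 3 * (\<bar>m\<bar> - \<bar>n\<bar>)\<^sup>2" by simp
    moreover have "- (m * n) \<le> \<bar>m\<bar> * \<bar>n\<bar>" using abs_ge_minus_self[of "m * n"] by (simp only: abs_mult)
    ultimately show ?thesis by (simp add: p hex_norm_def power2_eq_square algebra_simps)
  qed
  moreover have "S \<le> N" if "S\<^sup>2 \<le> 4 * N" "3 \<le> N" for S N :: int
  proof (cases "4 \<le> S")
    case True
    then have "4 * S \<le> S\<^sup>2" unfolding power2_eq_square by (intro mult_right_mono) auto
    then show ?thesis using that by linarith
  qed (use that in linarith)
  ultimately have "\<bar>m\<bar> + \<bar>n\<bar> \<le> hex_norm p" using 3 by blast
  then show "nat \<bar>fst p\<bar> + nat \<bar>snd p\<bar> \<le> nat (hex_norm p)" by (simp add: p)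
qed

text \<open>The factor 2^n is spare decay that will sum the tail over both coordinates. There the
  powers of 1/2 sum to 3 * 3 = 9, so 1/18 makes the whole tail exp (- E) / 2.\<close>

lemma shell_weight_bound: "3 \<le> n \<Longrightarrow> real n * 2 ^ n * exp (- (18/5 * (real n - 1))) \<le> 1/18"
proof (induction n rule: dec_induct)
  case base
  have "2.3 \<le> exp (9/10::real)" using exp_lower_Taylor_quadratic[of "9/10"] by (simp add: power2_eq_square)
  then have "2.3 ^ 8 \<le> exp (9/10::real) ^ 8" by (intro power_mono) auto
  also have "\<dots> = exp (36/5)" by (simp add: exp_of_nat_mult[symmetric])
  finally have "432 \<le> exp (36/5::real)" by (simp add: power_numeral_reduce)
  then show ?case by (simp add: exp_minus field_simps)
next
  case (step n)
  have "4 \<le> exp (18/5::real)" using exp_lower_Taylor_quadratic[of "18/5"] by (simp add: power2_eq_square)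
  have "real (Suc n) * 2 ^ Suc n * exp (- (18/5 * (real (Suc n) - 1))) = (real (Suc n) * 2 * exp (- (18/5))) * (2 ^ n * exp (- (18/5 * (real n - 1))))"
    by (simp add: exp_add[symmetric] algebra_simps diff_divide_distrib)
  also have "\<dots> \<le> real n * (2 ^ n * exp (- (18/5 * (real n - 1))))"
  proof (intro mult_right_mono)
    have "real (Suc n) * 2 * exp (- (18/5)) \<le> (2 * real n) * 2 * (1/4)"
      using \<open>4 \<le> exp (18/5)\<close> step by (intro mult_mono) (auto simp: exp_minus field_simps)
    then show "real (Suc n) * 2 * exp (- (18/5)) \<le> real n" by simp
  qed auto
  also have "\<dots> \<le> 1/18" using step by (simp add: mult_ac)
  finally show ?case .
qed

lemma infsum_le_dominant_terms:
  fixes t :: "'a \<Rightarrow> real"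
  assumes t: "t summable_on UNIV" and g: "(g has_sum G) UNIV" and F: "finite F"
    and tail: "\<And>p. p \<notin> F \<Longrightarrow> t p \<le> g p" and g0: "\<And>p. 0 \<le> g p"
  shows "infsum t UNIV \<le> sum t F + G"
proof -
  have gs: "g summable_on UNIV" "infsum g UNIV = G" using g by (auto simp: has_sum_iff)
  have "(\<Sum>p\<in>F. g p - t p) \<le> (\<Sum>\<^sub>\<infinity>p. g p - t p)"
    by (rule finite_sum_le_infsum) (auto intro!: summable_on_diff gs t F tail)
  also have "\<dots> = G - infsum t UNIV" using infsum_diff[OF gs(1) t] gs(2) by simp
  finally have "infsum t UNIV \<le> sum t F + G - sum g F" by (simp add: sum_subtractf)
  moreover have "0 \<le> sum g F" by (intro sum_nonneg g0)
  ultimately show ?thesis by simp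
qed

context
  fixes E :: real
  assumes E: "18/5 \<le> E"
begin

definition hex_wt :: "int \<times> int \<Rightarrow> real" where
  "hex_wt p = exp (- (E * of_int (hex_norm p)))"

text \<open>Half of the exponent absorbs the factor N, as N <= 2 / E * exp (E * N / 2). By N >= (m^2
  + n^2) / 2 the other half is at most a product of one-dimensional Gaussians.\<close>

lemma hex_norm_wt_summable: "(\<lambda>p. of_int (hex_norm p) * hex_wt p) summable_on UNIV"
proof (rule summable_on_comparison_test)
  have "(\<lambda>(n::int, m::int). exp (- (E / 4 * (of_int n)\<^sup>2)) * (exp (- (E / 4 * (of_int m)\<^sup>2)) * 1)) summable_on UNIV"
    using E by (intro product_summable summable_on_gauss0) auto
  then show "(\<lambda>p. 2 / E * (case p of (n::int, m::int) \<Rightarrow> exp (- (E / 4 * (of_int n)\<^sup>2)) * (exp (- (E / 4 * (of_int m)\<^sup>2)) * 1))) summable_on UNIV"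
    by (intro summable_on_cmult_right)
  fix p :: "int \<times> int"
  obtain n m where p: "p = (n, m)" by (cases p)
  define N where "N = real_of_int (hex_norm p)"
  have N: "N \<ge> 0" using hex_norm_ge(2)[of p] by (simp add: N_def)
  show "0 \<le> of_int (hex_norm p) * hex_wt p" using N by (simp add: hex_wt_def N_def)
  have "E / 2 * N \<le> exp (E / 2 * N)" using exp_ge_add_one_self[of "E / 2 * N"] by linarith
  then have "N \<le> 2 / E * exp (E / 2 * N)" using E by (simp add: field_simps)
  then have "N * exp (- (E * N)) \<le> 2 / E * exp (E / 2 * N) * exp (- (E * N))" by (intro mult_right_mono) auto
  also have "\<dots> = 2 / E * exp (- (E / 2 * N))"
    unfolding mult.assoc exp_add[symmetric] by (simp add: field_simps)
  also have "\<dots> \<le> 2 / E * exp (- (E / 4 * ((of_int n)\<^sup>2 + (of_int m)\<^sup>2)))"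
  proof -
    have "real_of_int (m\<^sup>2 + n\<^sup>2) \<le> real_of_int (2 * hex_norm p)" using hex_norm_ge(1)[of m n] unfolding p by (simp only: of_int_le_iff)
    then have "E / 4 * ((of_int n)\<^sup>2 + (of_int m)\<^sup>2) \<le> E / 4 * (2 * N)" using E by (intro mult_left_mono) (auto simp: N_def)
    then show ?thesis using E by (intro mult_left_mono) (auto simp: field_simps)
  qed
  finally show "of_int (hex_norm p) * hex_wt p \<le> 2 / E * (case p of (n::int, m::int) \<Rightarrow> exp (- (E / 4 * (of_int n)\<^sup>2)) * (exp (- (E / 4 * (of_int m)\<^sup>2)) * 1))"
    unfolding p prod.case mult_1_right exp_add[symmetric] by (simp add: hex_wt_def N_def p distrib_left)
qed

lemma poly_wt_summable:
  assumes "\<And>p. \<bar>h p\<bar> \<le> c * of_int (hex_norm p)"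
  shows "(\<lambda>p. h p * hex_wt p) summable_on UNIV"
proof -
  have "(\<lambda>p. \<bar>h p * hex_wt p\<bar>) summable_on UNIV"
  proof (rule summable_on_comparison_test)
    show "(\<lambda>p. c * (of_int (hex_norm p) * hex_wt p)) summable_on UNIV"
      by (intro summable_on_cmult_right hex_norm_wt_summable)
  next
    fix p
    have "\<bar>h p\<bar> * hex_wt p \<le> (c * of_int (hex_norm p)) * hex_wt p" using assms by (intro mult_right_mono) (auto simp: hex_wt_def)
    then show "\<bar>h p * hex_wt p\<bar> \<le> c * (of_int (hex_norm p) * hex_wt p)" by (simp add: abs_mult hex_wt_def mult.assoc)
  qed simp
  then show ?thesis using summable_on_iff_abs_summable_on_real by fastforce
qed

text \<open>One factor exp (- E) is set aside, so that the tail is measured in units of a minimal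
  vector; the rest is estimated at the smallest admissible E.\<close>

lemma wt_tail:
  assumes "p \<notin> hex_shell"
  shows "of_int (hex_norm p) * hex_wt p \<le> exp (- E) / 18 * ((1/2) ^ nat \<bar>fst p\<bar> * (1/2) ^ nat \<bar>snd p\<bar>)"
proof -
  define n where "n = nat (hex_norm p)"
  have n: "3 \<le> n" "real_of_int (hex_norm p) = real n" "nat \<bar>fst p\<bar> + nat \<bar>snd p\<bar> \<le> n"
    using hex_norm_ge_3[OF assms] by (auto simp: n_def)
  have "real n * hex_wt p = exp (- E) * (real n * exp (- (E * (real n - 1))))"
    unfolding hex_wt_def n(2) by (simp add: exp_add[symmetric] algebra_simps)
  also have "\<dots> \<le> exp (- E) * (real n * exp (- (18/5 * (real n - 1))))"
  proof -
    have "18/5 * (real n - 1) \<le> E * (real n - 1)" using n(1) E by (intro mult_right_mono) auto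
    then show ?thesis by (intro mult_left_mono) auto
  qed
  also have "real n * exp (- (18/5 * (real n - 1))) = real n * 2 ^ n * exp (- (18/5 * (real n - 1))) * (1/2) ^ n"
    by (simp add: power_one_over)
  also have "exp (- E) * \<dots> \<le> exp (- E) * (1/18 * (1/2) ^ n)"
    using shell_weight_bound[OF n(1)] by (intro mult_left_mono mult_right_mono) auto
  also have "\<dots> \<le> exp (- E) * (1/18 * (1/2) ^ (nat \<bar>fst p\<bar> + nat \<bar>snd p\<bar>))"
    using n(3) by (intro mult_left_mono power_decreasing) auto
  finally show ?thesis unfolding n(2) by (simp add: power_add)
qed

lemma half_powers_pair: "((\<lambda>p::int \<times> int. exp (- E) / 18 * ((1/2) ^ nat \<bar>fst p\<bar> * (1/2) ^ nat \<bar>snd p\<bar>)) has_sum exp (- E) / 2) UNIV"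
proof -
  define f where "f = (\<lambda>p::int \<times> int. (1/2::real) ^ nat \<bar>fst p\<bar> * (1/2) ^ nat \<bar>snd p\<bar>)"
  have i: "((\<lambda>m. f (n, m)) has_sum ((1/2) ^ nat \<bar>n\<bar> * 3)) UNIV" for n
    unfolding f_def using has_sum_cmult_right[OF has_sum_int_half_powers, of "(1/2) ^ nat \<bar>n\<bar>"] by simp
  have o: "((\<lambda>n::int. (1/2) ^ nat \<bar>n\<bar> * (3::real)) has_sum (3 * 3)) UNIV"
    by (rule has_sum_cmult_left[OF has_sum_int_half_powers])
  have "f summable_on Sigma UNIV (\<lambda>_. UNIV)"
    by (rule summable_on_SigmaI[OF i]) (use o in \<open>auto simp: f_def has_sum_imp_summable\<close>)
  then have "(f has_sum 9) UNIV" using has_sum_SigmaI[OF i o] by simp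
  from has_sum_cmult_right[OF this, of "exp (- E) / 18"] show ?thesis by (simp add: f_def)
qed

lemma wt_summable: "hex_wt summable_on UNIV"
proof -
  have "(\<lambda>p. (of_int (hex_norm p) * hex_wt p) + (if p \<in> hex_shell then hex_wt p else 0)) summable_on UNIV"
    by (intro summable_on_add hex_norm_wt_summable finite_nonzero_values_imp_summable_on)
       (auto intro: finite_subset[of _ hex_shell] simp: hex_shell_def)
  then show ?thesis
  proof (rule summable_on_comparison_test)
    fix p show "hex_wt p \<le> (of_int (hex_norm p) * hex_wt p) + (if p \<in> hex_shell then hex_wt p else 0)"
    proof (cases "p \<in> hex_shell")
      case True then show ?thesis using hex_norm_ge(2)[of p] by (simp add: hex_wt_def)
    next
      case False
      then have "1 \<le> real_of_int (hex_norm p)" using hex_norm_ge_3(1)[of p] by linarith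
      then have "1 * hex_wt p \<le> real_of_int (hex_norm p) * hex_wt p" by (intro mult_right_mono) (simp_all add: hex_wt_def)
      then show ?thesis using False by simp
    qed
  qed (simp add: hex_wt_def)
qed

text \<open>In 13/2 = 6 + 1/2, the 6 counts the minimal vectors and the 1/2 bounds everything beyond
  them.\<close>

lemma wt_sum_le: "infsum hex_wt UNIV \<le> 1 + 13/2 * exp (- E)"
proof -
  have "infsum hex_wt UNIV \<le> sum hex_wt hex_shell + exp (- E) / 2"
  proof (rule infsum_le_dominant_terms[OF wt_summable half_powers_pair])
    fix p assume p: "p \<notin> hex_shell"
    then have "1 * hex_wt p \<le> real_of_int (hex_norm p) * hex_wt p"
      using hex_norm_ge_3(1)[OF p] by (intro mult_right_mono) (simp_all add: hex_wt_def)
    then show "hex_wt p \<le> exp (- E) / 18 * ((1/2) ^ nat \<bar>fst p\<bar> * (1/2) ^ nat \<bar>snd p\<bar>)"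
      using wt_tail[OF p] by linarith
  qed (simp_all add: hex_shell_def)
  then show ?thesis by (simp add: hex_shell_def hex_wt_def hex_norm_def)
qed

lemma hex_norm_wt_sum_le: "(\<Sum>\<^sub>\<infinity>p. of_int (hex_norm p) * hex_wt p) \<le> 13/2 * exp (- E)"
proof -
  have "(\<Sum>\<^sub>\<infinity>p. of_int (hex_norm p) * hex_wt p) \<le> (\<Sum>p\<in>hex_shell. of_int (hex_norm p) * hex_wt p) + exp (- E) / 2"
  proof (rule infsum_le_dominant_terms[OF hex_norm_wt_summable half_powers_pair])
    show "of_int (hex_norm p) * hex_wt p \<le> exp (- E) / 18 * ((1/2) ^ nat \<bar>fst p\<bar> * (1/2) ^ nat \<bar>snd p\<bar>)" if "p \<notin> hex_shell" for p
      using that by (rule wt_tail)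
  qed (simp_all add: hex_shell_def)
  then show ?thesis by (simp add: hex_shell_def hex_wt_def hex_norm_def)
qed

end

lemma exp_lower_cubic:
  fixes x :: real
  assumes "x \<ge> 0"
  shows "1 + x + x\<^sup>2 / 2 + x ^ 3 / 6 \<le> exp x"
proof -
  have "(\<Sum>k<4. x ^ k /\<^sub>R fact k) \<le> (\<Sum>k. x ^ k /\<^sub>R fact k)"
    by (rule sum_le_suminf[OF summable_exp_generic]) (use assms in auto)
  then show ?thesis by (simp add: exp_def eval_nat_numeral field_simps)
qed

lemma coord_bounds:
  "\<bar>(real_of_int m)\<^sup>2\<bar> \<le> 2 * real_of_int (hex_norm (n, m))"
  "\<bar>(real_of_int n)\<^sup>2\<bar> \<le> 2 * real_of_int (hex_norm (n, m))"
  "\<bar>real_of_int m * (real_of_int m + 2 * real_of_int n)\<bar> \<le> 6 * real_of_int (hex_norm (n, m))"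
proof -
  have "real_of_int (m\<^sup>2 + n\<^sup>2) \<le> real_of_int (2 * hex_norm (n, m))" using hex_norm_ge(1)[of m n] by (simp only: of_int_le_iff)
  then have s: "(real_of_int m)\<^sup>2 + (real_of_int n)\<^sup>2 \<le> 2 * real_of_int (hex_norm (n, m))" by simp
  then show "\<bar>(real_of_int m)\<^sup>2\<bar> \<le> 2 * real_of_int (hex_norm (n, m))" "\<bar>(real_of_int n)\<^sup>2\<bar> \<le> 2 * real_of_int (hex_norm (n, m))"
    using zero_le_power2[of "real_of_int m"] zero_le_power2[of "real_of_int n"] unfolding abs_power2 by linarith+
  have "\<bar>x * (x + 2 * z)\<bar> \<le> 3 * (x\<^sup>2 + z\<^sup>2)" for x z :: real
  proof -
    have "0 \<le> (x - z)\<^sup>2" "0 \<le> (x + z)\<^sup>2" by simp_all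
    then have "2 * (x * z) \<le> x\<^sup>2 + z\<^sup>2" "- (2 * (x * z)) \<le> x\<^sup>2 + z\<^sup>2"
      by (simp_all add: power2_eq_square algebra_simps)
    moreover have "x * (x + 2 * z) = x\<^sup>2 + 2 * (x * z)" by (simp add: power2_eq_square algebra_simps)
    moreover have "\<bar>a + 2 * u\<bar> \<le> 3 * (a + c)" if "2 * u \<le> a + c" "- (2 * u) \<le> a + c" "0 \<le> a" "0 \<le> c" for a c u :: real
      using that by (simp add: abs_if)
    ultimately show ?thesis by (metis zero_le_power2)
  qed
  then have "\<bar>real_of_int m * (real_of_int m + 2 * real_of_int n)\<bar> \<le> 3 * ((real_of_int m)\<^sup>2 + (real_of_int n)\<^sup>2)" .
  also have "\<dots> \<le> 3 * (2 * real_of_int (hex_norm (n, m)))" using s by (intro mult_left_mono) auto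
  finally show "\<bar>real_of_int m * (real_of_int m + 2 * real_of_int n)\<bar> \<le> 6 * real_of_int (hex_norm (n, m))" by simp
qed

context
  fixes E :: real
  assumes E: "18/5 \<le> E"
begin

lemma snd_square_wt_summable: "(\<lambda>p. (real_of_int (snd p))\<^sup>2 * hex_wt E p) summable_on UNIV"
  by (rule poly_wt_summable[OF E, of _ 2]) (use coord_bounds(1) in \<open>auto simp: split_paired_all\<close>)

lemma fst_square_wt_summable: "(\<lambda>p. (real_of_int (fst p))\<^sup>2 * hex_wt E p) summable_on UNIV"
  by (rule poly_wt_summable[OF E, of _ 2]) (use coord_bounds(2) in \<open>auto simp: split_paired_all\<close>)

lemma mixed_wt_summable: "(\<lambda>p. (real_of_int (snd p) * (real_of_int (snd p) + 2 * real_of_int (fst p))) * hex_wt E p) summable_on UNIV"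
  by (rule poly_wt_summable[OF E, of _ 6]) (use coord_bounds(3) in \<open>auto simp: split_paired_all\<close>)

lemma wt_swap: "(\<Sum>\<^sub>\<infinity>p. (real_of_int (snd p))\<^sup>2 * hex_wt E p) = (\<Sum>\<^sub>\<infinity>p. (real_of_int (fst p))\<^sup>2 * hex_wt E p)"
  by (rule infsum_reindex_bij_witness[of _ prod.swap prod.swap])
     (auto simp: hex_wt_def[OF E] hex_norm_def algebra_simps)

text \<open>The involution (n, m) -> (- m - n, m) preserves the form and changes the sign of m + 2 *
  n. Together with the swap of coordinates it generates the symmetry of order three.\<close>

lemma wt_antisym: "(\<Sum>\<^sub>\<infinity>p. (real_of_int (snd p) * (real_of_int (snd p) + 2 * real_of_int (fst p))) * hex_wt E p) = 0" (is "?S = 0")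
proof -
  define r where "r = (\<lambda>(n::int, m::int). (- m - n, m))"
  have "?S = (\<Sum>\<^sub>\<infinity>p. - ((real_of_int (snd p) * (real_of_int (snd p) + 2 * real_of_int (fst p))) * hex_wt E p))"
    by (rule infsum_reindex_bij_witness[of _ r r])
       (auto simp: r_def hex_wt_def[OF E] hex_norm_def power2_eq_square algebra_simps)
  then show ?thesis by (simp add: infsum_uminus)
qed

text \<open>The coordinates of a lattice vector are m + n/2 and sqrt 3 / 2 * n. Both squares reduce
  to the moments of m^2, n^2 and m * (m + 2 * n), where the first two agree and the third vanishes,
  so the second moments in the two directions coincide.\<close>

lemma wt_isotropic:
  shows "(\<Sum>\<^sub>\<infinity>p. (real_of_int (snd p) + real_of_int (fst p) / 2)\<^sup>2 * hex_wt E p) = 3/4 * (\<Sum>\<^sub>\<infinity>p. (real_of_int (fst p))\<^sup>2 * hex_wt E p)"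
    and "(\<Sum>\<^sub>\<infinity>p. of_int (hex_norm p) * hex_wt E p) = 3/2 * (\<Sum>\<^sub>\<infinity>p. (real_of_int (fst p))\<^sup>2 * hex_wt E p)"
    and "(\<lambda>p. (real_of_int (snd p) + real_of_int (fst p) / 2)\<^sup>2 * hex_wt E p) summable_on UNIV"
proof -
  let ?m = "\<lambda>p. (real_of_int (snd p))\<^sup>2 * hex_wt E p" and ?n = "\<lambda>p. (real_of_int (fst p))\<^sup>2 * hex_wt E p"
    and ?x = "\<lambda>p. (real_of_int (snd p) * (real_of_int (snd p) + 2 * real_of_int (fst p))) * hex_wt E p"
  have A: "(real_of_int (snd p) + real_of_int (fst p) / 2)\<^sup>2 * hex_wt E p = (1/2 * ?x p + 1/2 * ?m p) + 1/4 * ?n p" for p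
    by (simp add: power2_eq_square algebra_simps add_divide_distrib)
  have N: "of_int (hex_norm p) * hex_wt E p = (1/2 * ?x p + 1/2 * ?m p) + 1 * ?n p" for p
    by (cases p) (simp add: hex_norm_def power2_eq_square algebra_simps add_divide_distrib)
  have c: "(\<Sum>\<^sub>\<infinity>p. (1/2 * ?x p + 1/2 * ?m p) + k * ?n p) = (1/2 * 0 + 1/2 * infsum ?n UNIV) + k * infsum ?n UNIV"
    and s: "(\<lambda>p. (1/2 * ?x p + 1/2 * ?m p) + k * ?n p) summable_on UNIV" for k
  proof -
    have "((\<lambda>p. (1/2 * ?x p + 1/2 * ?m p) + k * ?n p) has_sum ((1/2 * infsum ?x UNIV + 1/2 * infsum ?m UNIV) + k * infsum ?n UNIV)) UNIV"
      by (intro has_sum_add has_sum_cmult_right has_sum_infsum snd_square_wt_summable fst_square_wt_summable mixed_wt_summable)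
    then show "(\<Sum>\<^sub>\<infinity>p. (1/2 * ?x p + 1/2 * ?m p) + k * ?n p) = (1/2 * 0 + 1/2 * infsum ?n UNIV) + k * infsum ?n UNIV"
      "(\<lambda>p. (1/2 * ?x p + 1/2 * ?m p) + k * ?n p) summable_on UNIV"
      unfolding wt_antisym wt_swap by (auto simp: has_sum_iff)
  qed
  show "(\<Sum>\<^sub>\<infinity>p. (real_of_int (snd p) + real_of_int (fst p) / 2)\<^sup>2 * hex_wt E p) = 3/4 * infsum ?n UNIV"
    unfolding A c by simp
  show "(\<Sum>\<^sub>\<infinity>p. of_int (hex_norm p) * hex_wt E p) = 3/2 * infsum ?n UNIV"
    unfolding N c by simp
  show "(\<lambda>p. (real_of_int (snd p) + real_of_int (fst p) / 2)\<^sup>2 * hex_wt E p) summable_on UNIV"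
    unfolding A by (rule s)
qed

end

text \<open>The one-parameter comparison along \<open>x = 1/2\<close> with \<open>s = 1 / y\<close>: each exponential is bounded
  below by its tangent at the hexagonal parameter, except for the two terms \<open>(0, \<plusminus>1)\<close>, which are
  kept and pay for the curvature.\<close>

lemma rhombic_sum_greater:
  fixes b s :: real
  defines "s0 \<equiv> 2 / sqrt 3"
  assumes E: "18/5 \<le> b * s0" and b: "b > 0" and s: "0 < s" "s < s0"
    and T: "((\<lambda>(n::int, m::int). exp (- (b * ((of_int m + of_int n / 2)\<^sup>2 * s + (of_int n)\<^sup>2 / s)))) has_sum T) UNIV"
  shows "infsum (hex_wt (b * s0)) UNIV < T"
proof -
  define e where "e = exp (- (b * s0))"
  define w where "w = b * (s0 - s)"
  have s03: "s0\<^sup>2 = 4/3" "s0 > 0" by (auto simp: s0_def power_divide)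
  have w: "w > 0" "b * s = b * s0 - w" using b s by (auto simp: w_def algebra_simps)
  have e: "e > 0" by (simp add: e_def)
  define t where "t = (\<lambda>p::int \<times> int. exp (- (b * ((of_int (snd p) + of_int (fst p) / 2)\<^sup>2 * s + (of_int (fst p))\<^sup>2 / s))))"
  have T: "(t has_sum T) UNIV" using T by (simp add: t_def case_prod_unfold)
  have ts: "t summable_on UNIV" "infsum t UNIV = T" using T by (auto simp: has_sum_iff)
  let ?W = "hex_wt (b * s0)"
  let ?A = "\<lambda>p::int \<times> int. (real_of_int (snd p) + real_of_int (fst p) / 2)\<^sup>2"
  let ?B = "\<lambda>p::int \<times> int. (real_of_int (fst p))\<^sup>2"
  have W: "?W p = exp (- (b * (?A p * s0 + ?B p / s0)))" for p
  proof -
    have i: "1 / s0 = 3/4 * s0" using s03 by (simp add: field_simps power2_eq_square)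
    have "?B p / s0 = ?B p * (1 / s0)" by simp
    then have "?A p * s0 + ?B p / s0 = s0 * (?A p + 3/4 * ?B p)"
      unfolding i by (simp add: algebra_simps)
    also have "?A p + 3/4 * ?B p = of_int (hex_norm p)"
      by (cases p) (simp add: hex_norm_def power2_eq_square algebra_simps add_divide_distrib)
    finally show ?thesis by (simp add: hex_wt_def[OF E] mult.assoc)
  qed
  have W0: "?W (0, 1) = e" "?W (0, - 1) = e" "?W (0, 0) = 1"
    by (simp_all add: hex_wt_def[OF E] hex_norm_def e_def)
  have t01: "t (0, 1) = e * exp w" "t (0, - 1) = e * exp w" "t (0, 0) = 1"
    using w(2) by (simp_all add: t_def e_def exp_add[symmetric])
  define M where "M = (\<Sum>\<^sub>\<infinity>p. ?A p * ?W p)"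
  have M: "M = 1/2 * (\<Sum>\<^sub>\<infinity>p. of_int (hex_norm p) * ?W p)" "(\<Sum>\<^sub>\<infinity>p. ?B p * ?W p) = 4/3 * M"
    unfolding M_def wt_isotropic(1,2)[OF E] by simp_all
  have Mle: "M \<le> 13/4 * e" using hex_norm_wt_sum_le[OF E] unfolding M(1) e_def by simp
  have Wsum: "infsum ?W UNIV \<le> 1 + 13/2 * e" using wt_sum_le[OF E] by (simp add: e_def)
  show ?thesis
  \<comment> \<open>For w > 5/4 the three terms (0, 0), (0, 1), (0, -1) suffice: their sum 1 + 2 * e
    * exp w exceeds the bound 1 + 13/2 * e for the hexagonal sum, because exp (5/4) > 13/4.\<close>
  proof (cases "w \<le> 5/4")
    case False
    have "t (0, 0) + t (0, 1) + t (0, - 1) = sum t {(0, 0), (0, 1), (0, - 1)}" by simp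
    also have "\<dots> \<le> T" unfolding ts(2)[symmetric] by (rule finite_sum_le_infsum[OF ts(1)]) (auto simp: t_def)
    finally have "1 + 2 * (e * exp w) \<le> T" unfolding t01 by simp
    moreover have "13/4 < exp w"
    proof -
      have "13/4 < exp (5/4::real)" using exp_lower_cubic[of "5/4"] by (simp add: power2_eq_square power3_eq_cube)
      also have "\<dots> \<le> exp w" using False by simp
      finally show ?thesis .
    qed
    then have "e * (13/4) < e * exp w" using e by (simp only: mult_less_cancel_left_pos)
    ultimately show ?thesis using Wsum by linarith
  next
    case True
    \<comment> \<open>\<open>c\<close> and \<open>d\<close> are the increments of the two
      coefficients in the exponent. By isotropy the tangents lose (c + 4/3 * d) * M in total, while
      the two retained terms gain 2 * e * (exp w - 1 - w).\<close>
    define c where "c = b * (s - s0)"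
    define d where "d = b * (1 / s - 1 / s0)"
    define tan where "tan = (\<lambda>p. ?W p - c * (?A p * ?W p) - d * (?B p * ?W p))"
    have tan: "tan p \<le> t p" for p
    proof -
      have "t p = ?W p * exp (- (c * ?A p + d * ?B p))"
        unfolding W t_def exp_add[symmetric] c_def d_def by (simp add: algebra_simps)
      also have "\<dots> \<ge> ?W p * (1 - (c * ?A p + d * ?B p))"
      proof (rule mult_left_mono)
        have "1 - z \<le> exp (- z)" for z :: real using exp_ge_add_one_self[of "- z"] by simp
        then show "1 - (c * ?A p + d * ?B p) \<le> exp (- (c * ?A p + d * ?B p))" .
      qed (simp add: W)
      finally show ?thesis by (simp add: tan_def algebra_simps)
    qed
    have tansum: "(tan has_sum (infsum ?W UNIV - c * M - d * (4/3 * M))) UNIV"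
    proof -
      have "(tan has_sum (infsum ?W UNIV + - c * M + - d * (4/3 * M))) UNIV"
      proof -
        have "((\<lambda>p. ?W p + - c * (?A p * ?W p) + - d * (?B p * ?W p)) has_sum (infsum ?W UNIV + - c * M + - d * (4/3 * M))) UNIV"
          unfolding M(2)[symmetric] unfolding M_def
          by (intro has_sum_add has_sum_cmult_right has_sum_infsum wt_summable[OF E] wt_isotropic(3)[OF E] fst_square_wt_summable[OF E])
        then show ?thesis by (simp add: tan_def)
      qed
      then show ?thesis by simp
    qed
    have "(\<Sum>p\<in>{(0, 1), (0, - 1)}. t p - tan p) \<le> (\<Sum>\<^sub>\<infinity>p. t p - tan p)"
    proof (rule finite_sum_le_infsum)
      show "(\<lambda>p. t p - tan p) summable_on UNIV" using ts tansum by (intro summable_on_diff) (auto simp: has_sum_iff)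
      show "0 \<le> t p - tan p" for p using tan[of p] by simp
    qed auto
    also have "\<dots> = T - (infsum ?W UNIV - c * M - d * (4/3 * M))"
      using infsum_diff[of t UNIV tan] ts tansum by (auto simp: has_sum_iff)
    also have "(\<Sum>p\<in>{(0, 1), (0, - 1)}. t p - tan p) = 2 * (e * exp w - (e + w * e))"
    proof -
      have "tan (0, 1) = e + w * e" "tan (0, - 1) = e + w * e"
        using W0 by (auto simp: tan_def c_def w_def algebra_simps)
      then show ?thesis using t01 by simp
    qed
    finally have 1: "2 * (e * (exp w - 1 - w)) - (c + 4/3 * d) * M \<le> T - infsum ?W UNIV"
      by (simp add: algebra_simps)
    have bs: "b * s > 0" using b s by simp
    \<comment> \<open>Because s0^2 = 4/3, the first-order parts of c and 4/3 * d in s - s0 cancel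
      and the loss is of second order, as is the gain.\<close>
    have cd: "(c + 4/3 * d) * (b * s) = w\<^sup>2"
    proof -
      have "4/3 = s0 * s0" using s03(1) by (simp add: power2_eq_square)
      then have "c + 4/3 * d = b * (s - s0 + s0 * s0 * (1 / s - 1 / s0))"
        unfolding c_def d_def by (simp only: algebra_simps)
      moreover have "(s - s0 + s0 * s0 * (1 / s - 1 / s0)) * s = (s0 - s)\<^sup>2"
        using s s03(2) by (simp add: field_simps power2_eq_square)
      moreover have "b * z * (b * s) = b * b * (z * s)" for z by simp
      ultimately have "(c + 4/3 * d) * (b * s) = b * b * (s0 - s)\<^sup>2" by (simp only:)
      then show ?thesis unfolding w_def power_mult_distrib by (simp only: power2_eq_square)
    qed
    \<comment> \<open>Here 13/4 bounds M / e. The Taylor bound exp w - 1 - w >= w^2 / 2 * (1 + w /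
      3) and b * s >= 18/5 - w reduce the claim to 13/4 < (1 + w / 3) * (18/5 - w), which holds for
      w <= 5/4.\<close>
    have quad: "w\<^sup>2 * (13/4) < 2 * (exp w - 1 - w) * (b * s)"
    proof -
      have "w\<^sup>2 * (13/4) < w\<^sup>2 * ((1 + w / 3) * (18/5 - w))"
      proof (rule mult_strict_left_mono)
        have "0 \<le> w * (5/4 - w)" using w True by simp
        then have "w * w \<le> 5/4 * w" by (simp add: algebra_simps)
        then show "13/4 < (1 + w / 3) * (18/5 - w)" using True by (simp add: algebra_simps)
      qed (use w in simp)
      also have "\<dots> = (w\<^sup>2 * (1 + w / 3)) * (18/5 - w)" by simp
      also have "\<dots> \<le> (2 * (exp w - 1 - w)) * (b * s)"
      proof (rule mult_mono)
        show "w\<^sup>2 * (1 + w / 3) \<le> 2 * (exp w - 1 - w)"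
          using exp_lower_cubic[of w] w by (simp add: power2_eq_square power3_eq_cube algebra_simps)
        show "0 \<le> 2 * (exp w - 1 - w)"
          using exp_ge_add_one_self[of w] by (intro mult_nonneg_nonneg) linarith+
        show "18/5 - w \<le> b * s" "0 \<le> 18/5 - w" using w E True by auto
      qed
      finally show ?thesis .
    qed
    have "(c + 4/3 * d) * M * (b * s) \<le> (w\<^sup>2 * (13/4)) * e"
    proof -
      have "(c + 4/3 * d) * M * (b * s) = w\<^sup>2 * M" using cd by (simp add: mult_ac)
      also have "\<dots> \<le> w\<^sup>2 * (13/4 * e)" using Mle by (intro mult_left_mono) auto
      finally show ?thesis by (simp add: mult_ac)
    qed
    also have "\<dots> < 2 * (exp w - 1 - w) * (b * s) * e" using quad e by (simp only: mult_less_cancel_right_pos)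
    finally have "(c + 4/3 * d) * M * (b * s) < (2 * (e * (exp w - 1 - w))) * (b * s)" by (simp add: mult_ac)
    then have "(c + 4/3 * d) * M < 2 * (e * (exp w - 1 - w))" using bs by (simp only: mult_less_cancel_right_pos)
    then show ?thesis using 1 by linarith
  qed
qed

lemma theta_rhombic_greater_aux:
  assumes \<alpha>: "\<alpha> \<ge> 1" and y: "sqrt 3 / 2 < y"
  shows "theta \<alpha> (1/2) (sqrt 3 / 2) < theta \<alpha> (1/2) y"
proof -
  define b where "b = pi * \<alpha>"
  define s0 where "s0 = 2 / sqrt 3"
  have y0: "y > 0" by (rule order.strict_trans[OF _ y]) simp
  have "sqrt 3 \<le> 7/4" by (rule real_le_lsqrt) (auto simp: power2_eq_square)
  have "3.14 \<le> pi" using pi_approx by simp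
  \<comment> \<open>For alpha = 1 the left-hand quantity is 2 pi / sqrt 3, about 3.63; 18/5 is a
    rational just below it.\<close>
  have E: "18/5 \<le> b * s0"
  proof -
    have "18/5 * sqrt 3 \<le> 2 * (3.14 * 1)"
    proof -
      have "sqrt 3 \<le> 157/90" by (rule real_le_lsqrt) (auto simp: power2_eq_square)
      then show ?thesis by simp
    qed
    also have "\<dots> \<le> 2 * (pi * \<alpha>)"
      using \<open>3.14 \<le> pi\<close> \<alpha> by (intro mult_left_mono mult_mono) auto
    finally show ?thesis by (simp add: b_def s0_def field_simps)
  qed
  have sq: "((m + n * (1/2))\<^sup>2 + (n * z)\<^sup>2) / z = (m + n / 2)\<^sup>2 * (1 / z) + n\<^sup>2 / (1 / z)" if "z > 0" for m n z :: real
    using that by (simp add: field_simps power2_eq_square)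
  have h: "((\<lambda>(n::int, m::int). exp (- (b * ((of_int m + of_int n / 2)\<^sup>2 * (1 / z) + (of_int n)\<^sup>2 / (1 / z))))) has_sum theta \<alpha> (1/2) z) UNIV"
    if "z > 0" for z
    using theta_has_sum(1)[of \<alpha> z "1/2"] \<alpha> that unfolding b_def sq[OF that] by simp
  have "infsum (hex_wt (b * s0)) UNIV < theta \<alpha> (1/2) y"
    unfolding s0_def
  proof (rule rhombic_sum_greater)
    show "1 / y < 2 / sqrt 3" using y y0 by (simp add: field_simps)
  qed (use E \<alpha> y0 h[OF y0] in \<open>auto simp: b_def s0_def\<close>)
  moreover have "infsum (hex_wt (b * s0)) UNIV = theta \<alpha> (1/2) (sqrt 3 / 2)"
  proof -
    have "hex_wt (b * s0) p = (case p of (n::int, m::int) \<Rightarrow> exp (- (pi * \<alpha> * (((of_int m + of_int n * (1/2))\<^sup>2 + (of_int n * (sqrt 3 / 2))\<^sup>2) / (sqrt 3 / 2)))))" for p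
    proof -
      obtain n m where p: "p = (n, m)" by (cases p)
      have "((of_int m + of_int n * (1/2))\<^sup>2 + (of_int n * (sqrt 3 / 2))\<^sup>2) / (sqrt 3 / 2) = s0 * of_int (hex_norm p)"
        by (simp add: p hex_norm_def s0_def power_mult_distrib power_divide) (simp add: power2_eq_square field_simps)
      then show ?thesis unfolding p prod.case hex_wt_def[OF E] by (simp only: b_def mult.assoc)
    qed
    then show ?thesis unfolding theta_def by (rule infsum_cong)
  qed
  ultimately show ?thesis by simp
qed

text \<open>The tail estimates require alpha >= 1; for smaller alpha the functional equation scales
  both sides by the same factor.\<close>

lemma theta_rhombic_greater:
  assumes \<alpha>: "\<alpha> > 0" and y: "sqrt 3 / 2 < y"
  shows "theta \<alpha> (1/2) (sqrt 3 / 2) < theta \<alpha> (1/2) y"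
proof (cases "1 \<le> \<alpha>")
  case False
  then have "theta (1 / \<alpha>) (1/2) (sqrt 3 / 2) < theta (1 / \<alpha>) (1/2) y"
    using \<alpha> by (intro theta_rhombic_greater_aux y) auto
  moreover have "y > 0" by (rule order.strict_trans[OF _ y]) simp
  ultimately show ?thesis using \<alpha> by (simp add: theta_functional)
next
  case True
  then show ?thesis using y by (rule theta_rhombic_greater_aux)
qed

section \<open>Extremality over all reduced parameters\<close>

lemma cos_pi_eq_0_iff:
  assumes "\<bar>x\<bar> \<le> 1/2"
  shows "0 \<le> cos (pi * x)" "cos (pi * x) = 0 \<longleftrightarrow> \<bar>x\<bar> = 1/2"
proof -
  have r: "- (pi / 2) \<le> pi * x" "pi * x \<le> pi / 2"
    using mult_left_mono[of "- (1/2)" x pi] mult_left_mono[of x "1/2" pi] assms by auto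
  then show "0 \<le> cos (pi * x)" by (intro cos_ge_zero) auto
  show "cos (pi * x) = 0 \<longleftrightarrow> \<bar>x\<bar> = 1/2"
  proof
    assume 0: "cos (pi * x) = 0"
    show "\<bar>x\<bar> = 1/2"
    proof (rule ccontr)
      assume "\<bar>x\<bar> \<noteq> 1/2"
      then have "\<bar>x\<bar> < 1/2" using assms by simp
      then have "- (pi / 2) < pi * x" "pi * x < pi / 2"
        using mult_strict_left_mono[of "- (1/2)" x pi] mult_strict_left_mono[of x "1/2" pi] by auto
      then show False using cos_gt_zero_pi[of "pi * x"] 0 by simp
    qed
  next
    assume "\<bar>x\<bar> = 1/2"
    then have "x = 1/2 \<or> x = - (1/2)" by arith
    then show "cos (pi * x) = 0"
    proof
      assume x: "x = 1/2" show ?thesis unfolding x by simp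
    next
      assume x: "x = - (1/2)" show ?thesis unfolding x by simp
    qed
  qed
qed

lemma theta_minus: "\<alpha> > 0 \<Longrightarrow> y > 0 \<Longrightarrow> theta \<alpha> (- x) y = theta \<alpha> x y"
  by (simp add: theta_has_sum(2) Phi_def)

lemma theta_center_minus:
  assumes "\<alpha> > 0" "y > 0"
  shows "theta_center \<alpha> (- x) y = theta_center \<alpha> x y"
proof -
  have "th3 (y / \<alpha>) (1/2 + (of_int n + 1/2) * - x) = th3 (y / \<alpha>) (1/2 + (of_int n + 1/2) * x)" for n :: int
    using assms by (intro th3_cong_cos) (auto simp: distrib_left right_diff_distrib cos_add cos_diff)
  then show ?thesis using assms by (simp only: theta_center_has_sum(2) Psi_def)
qed

lemma reduced_y:
  fixes x y :: real
  assumes "\<bar>x\<bar> \<le> 1/2" "1 \<le> x\<^sup>2 + y\<^sup>2" "y > 0"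
  shows "3/4 \<le> y\<^sup>2" "sqrt 3 / 2 \<le> y"
proof -
  have "x\<^sup>2 \<le> (1/2)\<^sup>2" using assms(1) by (subst power2_abs[symmetric]) (intro power_mono, auto)
  then show "3/4 \<le> y\<^sup>2" using assms(2) by (simp add: power2_eq_square)
  then have "(sqrt 3 / 2)\<^sup>2 \<le> y\<^sup>2" by (simp add: power_divide)
  then show "sqrt 3 / 2 \<le> y" using assms(3) by (rule power2_le_imp_le[OF _ less_imp_le])
qed

theorem theta_min:
  assumes \<alpha>: "\<alpha> > 0" and x: "\<bar>x\<bar> \<le> 1/2" and xy: "1 \<le> x\<^sup>2 + y\<^sup>2" and y: "y > 0"
    and ne: "\<not> (\<bar>x\<bar> = 1/2 \<and> y = sqrt 3 / 2)"
  shows "theta \<alpha> (1/2) (sqrt 3 / 2) < theta \<alpha> x y"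
proof -
  note r = reduced_y[OF x xy y]
  have 1: "theta \<alpha> (1/2) (sqrt 3 / 2) \<le> theta \<alpha> (1/2) y"
    using theta_rhombic_greater[OF \<alpha>, of y] r(2) unfolding le_less by blast
  show ?thesis
  proof (cases "\<bar>x\<bar> = 1/2")
    case True
    then have "x = 1/2 \<or> x = - (1/2)" by arith
    then have "theta \<alpha> x y = theta \<alpha> (1/2) y" using theta_minus[OF \<alpha> y, of "1/2"] by metis
    moreover have "sqrt 3 / 2 < y" using True ne r(2) by auto
    ultimately show ?thesis using theta_rhombic_greater[OF \<alpha>] by simp
  next
    case False
    then have "cos (pi * x) \<noteq> 0" using cos_pi_eq_0_iff[OF x] by simp
    then show ?thesis using theta_half_less[OF \<alpha> y r(1)] 1 by fastforce
  qed
qed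

theorem theta_center_max:
  assumes \<alpha>: "\<alpha> > 0" and x: "\<bar>x\<bar> \<le> 1/2" and xy: "1 \<le> x\<^sup>2 + y\<^sup>2" and y: "y > 0"
  shows "theta_center \<alpha> x y \<le> theta_center \<alpha> (1/2) (sqrt 3 / 2)"
proof -
  note r = reduced_y[OF x xy y]
  have "theta_center \<alpha> x y \<le> theta_center \<alpha> (1/2) y"
  proof (cases "\<bar>x\<bar> = 1/2")
    case True
    then have "x = 1/2 \<or> x = - (1/2)" by arith
    then show ?thesis using theta_center_minus[OF \<alpha> y, of "1/2"] by (metis order_refl)
  next
    case False
    then have "cos (pi * x) > 0" using cos_pi_eq_0_iff[OF x] by simp
    then show ?thesis by (rule theta_center_le_half[OF \<alpha> y r(1)])
  qed
  also have "\<dots> \<le> theta_center \<alpha> (1/2) (sqrt 3 / 2)"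
  proof (rule theta_center_half_antimono[OF \<alpha> _ r(2)])
    show "1/2 \<le> sqrt 3 / 2" using real_sqrt_le_mono[of 1 3] by simp
  qed
  finally show ?thesis .
qed

section \<open>Reduced bases\<close>

definition det2 :: "real^2 \<Rightarrow> real^2 \<Rightarrow> real" where
  "det2 u v = u $ 1 * v $ 2 - u $ 2 * v $ 1"

lemma det_vector_2: "det (vector [u, v] :: real^2^2) = det2 u v"
  by (simp add: det_2 det2_def mult.commute)

definition grid :: "real^2 \<Rightarrow> real^2 \<Rightarrow> (real^2) set" where
  "grid u v = {of_int m *\<^sub>R u + of_int n *\<^sub>R v | m n :: int. True}"

lemma gridI: "of_int m *\<^sub>R u + of_int n *\<^sub>R v \<in> grid u v"
  by (auto simp: grid_def)

lemma lattice_basis_iff: "lattice_basis L u v \<longleftrightarrow> independent {u, v} \<and> span {u, v} = UNIV \<and> L = grid u v"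
  by (simp add: lattice_basis_def grid_def)

lemma det2_nonzero_basis:
  assumes "det2 u v \<noteq> 0"
  shows "independent {u, v}" "span {u, v} = UNIV"
proof -
  have rep: "x = (det2 x v / det2 u v) *\<^sub>R u + (det2 u x / det2 u v) *\<^sub>R v" for x
    using assms by (simp add: vec_eq_iff forall_2 field_simps) (simp add: det2_def algebra_simps)
  show span: "span {u, v} = UNIV"
  proof (intro equalityI subsetI)
    fix x
    show "x \<in> span {u, v}"
      by (subst rep[of x]) (intro span_add span_scale span_base; simp)
  qed simp
  have "u \<noteq> v" using assms by (auto simp: det2_def)
  then show "independent {u, v}"
    by (intro card_le_dim_spanning[where V = UNIV]) (auto simp: span dim_UNIV)
qed

lemma grid_add: "x \<in> grid u v \<Longrightarrow> y \<in> grid u v \<Longrightarrow> x + y \<in> grid u v"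
proof -
  assume "x \<in> grid u v" "y \<in> grid u v"
  then obtain m n m' n' where "x = of_int m *\<^sub>R u + of_int n *\<^sub>R v" "y = of_int m' *\<^sub>R u + of_int n' *\<^sub>R v"
    by (auto simp: grid_def)
  then have "x + y = of_int (m + m') *\<^sub>R u + of_int (n + n') *\<^sub>R v" by (simp add: scaleR_add_left)
  then show ?thesis by (simp only: gridI)
qed

lemma grid_scale: "x \<in> grid u v \<Longrightarrow> of_int k *\<^sub>R x \<in> grid u v"
proof -
  assume "x \<in> grid u v"
  then obtain m n where "x = of_int m *\<^sub>R u + of_int n *\<^sub>R v" by (auto simp: grid_def)
  then have "of_int k *\<^sub>R x = of_int (k * m) *\<^sub>R u + of_int (k * n) *\<^sub>R v" by (simp add: scaleR_add_right)
  then show ?thesis by (simp only: gridI)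
qed

lemma grid_subset:
  assumes "u \<in> grid u' v'" "v \<in> grid u' v'"
  shows "grid u v \<subseteq> grid u' v'"
  using assms by (auto simp: grid_def[of u v] intro!: grid_add grid_scale)

lemma grid_base1: "u \<in> grid u v"
  using gridI[of 1 u 0 v] by simp

lemma grid_base2: "v \<in> grid u v"
  using gridI[of 0 u 1 v] by simp

lemma grid_uminus: "grid u (- v) = grid u v"
  using grid_scale[OF grid_base2[of v u], of "-1"] grid_scale[OF grid_base2[of "- v" u], of "-1"]
  by (intro equalityI grid_subset) (auto intro: grid_base1)

lemma grid_shear: "grid u (v + u) = grid u v"
proof (intro equalityI grid_subset)
  show "v \<in> grid u (v + u)"
    using gridI[of "-1" u 1 "v + u"] by simp
qed (auto intro: grid_base1 grid_base2 grid_add)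

lemma grid_swap: "grid v u = grid u v"
  by (intro equalityI grid_subset grid_base1 grid_base2)

lemma det2_grid:
  assumes "u' \<in> grid u v" "v' \<in> grid u v"
  obtains k :: int where "det2 u' v' = of_int k * det2 u v"
proof -
  obtain a b c d :: int where "u' = of_int a *\<^sub>R u + of_int b *\<^sub>R v" "v' = of_int c *\<^sub>R u + of_int d *\<^sub>R v"
    using assms by (auto simp: grid_def)
  then have "det2 u' v' = of_int (a * d - b * c) * det2 u v"
    by (simp add: det2_def algebra_simps)
  then show thesis by (rule that)
qed

text \<open>The determinants of two bases of the same lattice are integer multiples of each other,
  so the multiplier is a unit of the integers.\<close>

lemma unit_lattice_det:
  assumes L: "L \<in> lattices 1" and b: "lattice_basis L u v"
  shows "\<bar>det2 u v\<bar> = 1"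
proof -
  obtain u0 v0 where 0: "L = grid u0 v0" "\<bar>det2 u0 v0\<bar> = 1"
    using L by (auto simp: lattices_def lattice_basis_iff det_vector_2)
  have 1: "L = grid u v" using b by (simp add: lattice_basis_iff)
  obtain k :: int where k: "det2 u v = of_int k * det2 u0 v0"
    using det2_grid[of u u0 v0 v] 0(1) 1 grid_base1[of u v] grid_base2[of v u] by auto
  obtain k' :: int where k': "det2 u0 v0 = of_int k' * det2 u v"
    using det2_grid[of u0 u v v0] 0(1) 1 grid_base1[of u0 v0] grid_base2[of v0 u0] by auto
  have "det2 u0 v0 = of_int (k' * k) * det2 u0 v0" using k' unfolding k by (simp only: of_int_mult mult.assoc)
  moreover have "det2 u0 v0 \<noteq> 0" using 0(2) by auto
  ultimately have "of_int (k' * k) = (1::real)" by simp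
  then have "k' * k = 1" by (simp only: of_int_eq_1_iff)
  then have "\<bar>k\<bar> = 1" by (auto simp: zmult_eq_1_iff)
  then show ?thesis using k 0(2) by (simp add: abs_mult of_int_abs[symmetric] del: of_int_abs)
qed

lemma norm2_sq: "(norm (x::real^2))\<^sup>2 = (x $ 1)\<^sup>2 + (x $ 2)\<^sup>2"
  by (simp add: norm_vec_def L2_set_def sum_2)

lemma inner2: "(x::real^2) \<bullet> y = x $ 1 * y $ 1 + x $ 2 * y $ 2"
  by (simp add: inner_vec_def sum_2)

text \<open>\<open>par_x u v + \<i> par_y u\<close> is, up to the sign of the imaginary part, the quotient \<open>v / u\<close> of
  the basis vectors as complex numbers, provided that the determinant is \<open>\<plusminus>1\<close>.\<close>

definition par_y :: "real^2 \<Rightarrow> real" where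
  "par_y u = 1 / (norm u)\<^sup>2"

definition par_x :: "real^2 \<Rightarrow> real^2 \<Rightarrow> real" where
  "par_x u v = (u \<bullet> v) / (norm u)\<^sup>2"

text \<open>Lagrange's identity |u|^2 * |v|^2 = (u . v)^2 + det^2 with determinant of modulus 1
  eliminates |v| in favour of the two parameters.\<close>

lemma norm_combination:
  assumes d: "\<bar>det2 u v\<bar> = 1"
  shows "par_y u > 0"
    and "(norm (m *\<^sub>R u + n *\<^sub>R v))\<^sup>2 = ((m + n * par_x u v)\<^sup>2 + (n * par_y u)\<^sup>2) / par_y u"
proof -
  have "u \<noteq> 0" using d by (auto simp: det2_def)
  then have U: "(norm u)\<^sup>2 > 0" by simp
  then show "par_y u > 0" by (simp add: par_y_def)
  have "(det2 u v)\<^sup>2 = 1" using d by (metis abs_1 one_power2 power2_abs)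
  then have lag: "(norm u)\<^sup>2 * (norm v)\<^sup>2 = (u \<bullet> v)\<^sup>2 + 1"
    unfolding norm2_sq inner2 det2_def by (simp add: power2_eq_square algebra_simps)
  have "(norm (m *\<^sub>R u + n *\<^sub>R v))\<^sup>2 = m\<^sup>2 * (norm u)\<^sup>2 + 2 * m * n * (u \<bullet> v) + n\<^sup>2 * (norm v)\<^sup>2"
    unfolding norm2_sq inner2 by (simp add: power2_eq_square algebra_simps)
  moreover have "((m + n * par_x u v)\<^sup>2 + (n * par_y u)\<^sup>2) / par_y u
      = m\<^sup>2 * (norm u)\<^sup>2 + 2 * m * n * (u \<bullet> v) + n\<^sup>2 * (((u \<bullet> v)\<^sup>2 + 1) / (norm u)\<^sup>2)"
    using U by (simp add: par_x_def par_y_def field_simps power2_eq_square)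
  moreover have "((u \<bullet> v)\<^sup>2 + 1) / (norm u)\<^sup>2 = (norm v)\<^sup>2" using U by (simp add: lag[symmetric])
  ultimately show "(norm (m *\<^sub>R u + n *\<^sub>R v))\<^sup>2 = ((m + n * par_x u v)\<^sup>2 + (n * par_y u)\<^sup>2) / par_y u" by simp
qed

text \<open>Three competing bases are enough: (v, u) gives |u| <= |v|, while (u, v + u) and (u, u -
  v) give 2 * |u . v| <= |u|^2. In the parameters these are the inequalities of the classical
  fundamental domain.\<close>

lemma minkowski_reduced:
  assumes L: "L \<in> lattices 1" and mb: "minkowski_basis L u v"
  shows "\<bar>det2 u v\<bar> = 1" "L = grid u v" "\<bar>par_x u v\<bar> \<le> 1/2" "1 \<le> (par_x u v)\<^sup>2 + (par_y u)\<^sup>2" "par_y u > 0"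
proof -
  have b: "lattice_basis L u v" using mb by (simp add: minkowski_basis_def)
  show d: "\<bar>det2 u v\<bar> = 1" by (rule unit_lattice_det[OF L b])
  show g: "L = grid u v" using b by (simp add: lattice_basis_iff)
  have basis: "lattice_basis L u' v'" if "det2 u' v' \<noteq> 0" "grid u' v' = grid u v" for u' v'
    using det2_nonzero_basis[OF that(1)] that(2) g by (simp add: lattice_basis_iff)
  have d0: "det2 u v \<noteq> 0" using d by auto
  have ds: "det2 v u = - det2 u v" "det2 u (v + u) = det2 u v" "det2 u (- v + u) = - det2 u v"
    by (simp_all add: det2_def algebra_simps)
  show y: "par_y u > 0" by (rule norm_combination(1)[OF d])
  have U: "(norm u)\<^sup>2 > 0" using y by (simp add: par_y_def)
  have "norm u \<le> norm v"
  proof -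
    have "lattice_basis L v u" using d0 by (intro basis grid_swap) (simp add: ds)
    then show ?thesis using mb by (auto simp: minkowski_basis_def)
  qed
  then have uv: "(norm u)\<^sup>2 \<le> (norm v)\<^sup>2" by (intro power_mono) auto
  have "(norm v)\<^sup>2 = ((par_x u v)\<^sup>2 + (par_y u)\<^sup>2) / par_y u"
    using norm_combination(2)[OF d, of 0 1] by simp
  then show "1 \<le> (par_x u v)\<^sup>2 + (par_y u)\<^sup>2" 
  proof -
    have "1 / par_y u \<le> ((par_x u v)\<^sup>2 + (par_y u)\<^sup>2) / par_y u"
      using uv \<open>(norm v)\<^sup>2 = _\<close> by (simp add: par_y_def)
    then show ?thesis using y by (simp only: divide_le_cancel)
  qed
  have half: "2 * \<bar>u \<bullet> v\<bar> \<le> (norm u)\<^sup>2"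
  proof -
    have "lattice_basis L u (v + u)" using d0 by (intro basis grid_shear) (simp add: ds)
    then have "norm v \<le> norm (v + u)" using mb by (auto simp: minkowski_basis_def)
    then have "(norm v)\<^sup>2 \<le> (norm (v + u))\<^sup>2" by (intro power_mono) auto
    then have 1: "- 2 * (u \<bullet> v) \<le> (norm u)\<^sup>2"
      unfolding norm2_sq inner2 by (simp add: power2_eq_square algebra_simps)
    have "grid u (- v + u) = grid u v" using grid_shear[of u "- v"] grid_uminus[of u v] by simp
    then have "lattice_basis L u (- v + u)" using d0 by (intro basis) (simp_all only: ds neg_equal_0_iff_equal not_False_eq_True)
    then have "norm v \<le> norm (- v + u)" using mb by (auto simp: minkowski_basis_def)
    then have "(norm v)\<^sup>2 \<le> (norm (- v + u))\<^sup>2" by (intro power_mono) auto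
    then have 2: "2 * (u \<bullet> v) \<le> (norm u)\<^sup>2"
      unfolding norm2_sq inner2 by (simp add: power2_eq_square algebra_simps)
    from 1 2 show ?thesis by simp
  qed
  show "\<bar>par_x u v\<bar> \<le> 1/2" using half U by (simp add: par_x_def field_simps)
qed

lemma grid_bij:
  assumes "det2 u v \<noteq> 0"
  shows "bij_betw (\<lambda>(n::int, m::int). of_int m *\<^sub>R u + of_int n *\<^sub>R v) UNIV (grid u v)"
    and "of_int m *\<^sub>R u + of_int n *\<^sub>R v = 0 \<longleftrightarrow> n = 0 \<and> m = (0::int)"
proof -
  have lin: "a = 0 \<and> b = 0" if "a *\<^sub>R u + b *\<^sub>R v = 0" for a b
  proof -
    have "det2 (a *\<^sub>R u + b *\<^sub>R v) v = a * det2 u v" "det2 u (a *\<^sub>R u + b *\<^sub>R v) = b * det2 u v"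
      by (simp_all add: det2_def algebra_simps)
    moreover have "det2 0 v = 0" "det2 u 0 = 0" by (simp_all add: det2_def)
    ultimately show ?thesis using assms unfolding that by auto
  qed
  show "of_int m *\<^sub>R u + of_int n *\<^sub>R v = 0 \<longleftrightarrow> n = 0 \<and> m = (0::int)"
    using lin[of "of_int m" "of_int n"] by auto
  have "inj (\<lambda>(n::int, m::int). of_int m *\<^sub>R u + of_int n *\<^sub>R v)"
  proof (rule injI, clarify)
    fix n m n' m' :: int
    assume "of_int m *\<^sub>R u + of_int n *\<^sub>R v = of_int m' *\<^sub>R u + of_int n' *\<^sub>R v"
    then have "(of_int m - of_int m') *\<^sub>R u + (of_int n - of_int n') *\<^sub>R v = 0"
      by (simp add: scaleR_diff_left algebra_simps)
    from lin[OF this] show "n = n' \<and> m = m'" by simp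
  qed
  moreover have "range (\<lambda>(n::int, m::int). of_int m *\<^sub>R u + of_int n *\<^sub>R v) = grid u v"
    by (auto simp: grid_def)
  ultimately show "bij_betw (\<lambda>(n::int, m::int). of_int m *\<^sub>R u + of_int n *\<^sub>R v) UNIV (grid u v)"
    by (simp add: bij_betw_def)
qed

lemma grid_bij_nonzero:
  assumes "det2 u v \<noteq> 0"
  shows "bij_betw (\<lambda>(n::int, m::int). of_int m *\<^sub>R u + of_int n *\<^sub>R v) (UNIV - {(0, 0)}) (grid u v - {0})"
proof -
  let ?g = "\<lambda>(n::int, m::int). of_int m *\<^sub>R u + of_int n *\<^sub>R v"
  have g: "inj ?g" "range ?g = grid u v" using grid_bij(1)[OF assms] by (auto simp only: bij_betw_def)
  have "?g ` (UNIV - {(0, 0)}) = grid u v - {0}"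
    unfolding image_set_diff[OF g(1)] g(2) by simp
  then show ?thesis using inj_on_subset[OF g(1)] by (simp add: bij_betw_def)
qed

text \<open>Since q / k differs from the centre by a lattice vector, q + k * L is the k-fold dilate
  of the centred translate, with half-integral coordinates. An odd integer is not 0, so the origin
  is missed and the exclusion of 0 in \<open>energy\<close> removes nothing.\<close>

lemma translated_sublattice_bij:
  assumes d: "det2 u v \<noteq> 0" and k: "k > 0" and c: "(1 / real k) *\<^sub>R q - cell_center u v \<in> grid u v"
  shows "bij_betw (\<lambda>(n::int, m::int). real k *\<^sub>R ((of_int m + 1/2) *\<^sub>R u + (of_int n + 1/2) *\<^sub>R v)) UNIV
           (translated_sublattice q k (grid u v))"
    and "0 \<notin> translated_sublattice q k (grid u v)"
proof -
  obtain a b :: int where ab: "(1 / real k) *\<^sub>R q - cell_center u v = of_int a *\<^sub>R u + of_int b *\<^sub>R v"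
    using c by (auto simp: grid_def)
  have "q = real k *\<^sub>R ((1 / real k) *\<^sub>R q)" using k by simp
  also have "(1 / real k) *\<^sub>R q = (of_int a + 1/2) *\<^sub>R u + (of_int b + 1/2) *\<^sub>R v"
    using ab by (simp add: cell_center_def scaleR_add_left scaleR_add_right algebra_simps)
  finally have q: "q = real k *\<^sub>R ((of_int a + 1/2) *\<^sub>R u + (of_int b + 1/2) *\<^sub>R v)" .
  let ?f = "\<lambda>(n::int, m::int). real k *\<^sub>R ((of_int m + 1/2) *\<^sub>R u + (of_int n + 1/2) *\<^sub>R v)"
  let ?g = "\<lambda>(n::int, m::int). of_int m *\<^sub>R u + of_int n *\<^sub>R v"
  have fg: "?f (n + b, m + a) = q + real k *\<^sub>R ?g (n, m)" for n m
    by (simp add: q scaleR_add_left scaleR_add_right algebra_simps)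
  have ran: "range ?f = translated_sublattice q k (grid u v)"
  proof (intro equalityI subsetI)
    fix z assume "z \<in> range ?f"
    then obtain n m where "z = ?f (n, m)" by auto
    then have "z = q + real k *\<^sub>R ?g (n - b, m - a)" using fg[of "n - b" "m - a"] by simp
    then show "z \<in> translated_sublattice q k (grid u v)"
      unfolding translated_sublattice_def using gridI[of "m - a" u "n - b" v] by auto
  next
    fix z assume "z \<in> translated_sublattice q k (grid u v)"
    then obtain m n :: int where "z = q + real k *\<^sub>R ?g (n, m)"
      unfolding translated_sublattice_def grid_def by auto
    then have "z = ?f (n + b, m + a)" using fg[of n m] by simp
    then show "z \<in> range ?f" by blast
  qed
  have inj: "inj ?f"
  proof (rule injI)
    fix z w assume eq: "?f z = ?f w"
    obtain n m where z: "z = (n, m)" by (cases z)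
    obtain n' m' where w: "w = (n', m')" by (cases w)
    have "?f z = q + real k *\<^sub>R ?g (n - b, m - a)" "?f w = q + real k *\<^sub>R ?g (n' - b, m' - a)"
      using fg[of "n - b" "m - a"] fg[of "n' - b" "m' - a"] unfolding z w by (simp_all only: diff_add_cancel)
    then have "real k *\<^sub>R ?g (n - b, m - a) = real k *\<^sub>R ?g (n' - b, m' - a)"
      using eq by (metis add_left_cancel)
    then have "?g (n - b, m - a) = ?g (n' - b, m' - a)" using k by (simp only: scaleR_cancel_left) simp
    then have "(n - b, m - a) = (n' - b, m' - a)"
      using grid_bij(1)[OF d] unfolding bij_betw_def by (metis (no_types, lifting) UNIV_I inj_onD)
    then show "z = w" by (simp add: z w)
  qed
  show "bij_betw ?f UNIV (translated_sublattice q k (grid u v))" using inj ran by (simp add: bij_betw_def)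
  show "0 \<notin> translated_sublattice q k (grid u v)"
  proof
    assume "0 \<in> translated_sublattice q k (grid u v)"
    then obtain z where "?f z = 0" using ran by (metis (no_types, lifting) imageE)
    then obtain n m :: int where "real k *\<^sub>R ((of_int m + 1/2) *\<^sub>R u + (of_int n + 1/2) *\<^sub>R v) = 0" by (cases z) auto
    then have "(of_int m + 1/2) *\<^sub>R u + (of_int n + 1/2) *\<^sub>R v = 0" using k by simp
    then have "2 *\<^sub>R ((of_int m + 1/2) *\<^sub>R u + (of_int n + 1/2) *\<^sub>R v) = 0" by (simp only: scaleR_zero_right)
    then have "of_int (2 * m + 1) *\<^sub>R u + of_int (2 * n + 1) *\<^sub>R v = 0"
      by (simp add: scaleR_add_left scaleR_add_right)
    then have "2 * m + 1 = 0" using grid_bij(2)[OF d] by blast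
    then show False by presburger
  qed
qed

section \<open>The triangular lattice and its rotations\<close>

definition tri1 :: "real^2" where "tri1 = sqrt (2 / sqrt 3) *\<^sub>R vector [1, 0]"
definition tri2 :: "real^2" where "tri2 = sqrt (2 / sqrt 3) *\<^sub>R vector [1/2, sqrt 3 / 2]"

lemma triangular_grid: "triangular_lattice = grid tri1 tri2"
proof -
  have "sqrt (2 / sqrt 3) *\<^sub>R (of_int m *\<^sub>R vector [1, 0] + of_int n *\<^sub>R vector [1/2, sqrt 3 / 2])
      = of_int m *\<^sub>R tri1 + of_int n *\<^sub>R tri2" for m n :: int
    by (simp add: tri1_def tri2_def scaleR_add_right mult.commute)
  then show ?thesis
    unfolding triangular_lattice_def grid_def image_Collect by (intro Collect_cong) metis
qed

lemma image_grid: "(\<lambda>x. Q *v x) ` grid u v = grid (Q *v u) (Q *v v)"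
proof -
  have "Q *v (of_int m *\<^sub>R u + of_int n *\<^sub>R v) = of_int m *\<^sub>R (Q *v u) + of_int n *\<^sub>R (Q *v v)" for m n :: int
    by (simp add: matrix_vector_right_distrib matrix_vector_mult_scaleR)
  then show ?thesis unfolding grid_def image_Collect by (intro Collect_cong) metis
qed

lemma matrix_vector_2: "((Q::real^2^2) *v x) $ i = Q $ i $ 1 * x $ 1 + Q $ i $ 2 * x $ 2"
  by (simp add: matrix_vector_mult_def sum_2)

lemma det2_image: "det2 (Q *v u) (Q *v v) = det Q * det2 u v"
  by (simp add: det2_def det_2 matrix_vector_2 algebra_simps)

lemma tri_det: "det2 tri1 tri2 = 1"
proof -
  define s where "s = sqrt (2 / sqrt 3)"
  have "det2 tri1 tri2 = (s * s) * (sqrt 3 / 2)" by (simp add: det2_def tri1_def tri2_def s_def[symmetric])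
  also have "s * s = 2 / sqrt 3" by (simp add: s_def)
  finally show ?thesis by simp
qed

lemma tri_norm: "(norm (of_int m *\<^sub>R tri1 + of_int n *\<^sub>R tri2))\<^sup>2 = 2 / sqrt 3 * of_int (hex_norm (n, m))"
proof -
  define s where "s = sqrt (2 / sqrt 3)"
  have s: "s\<^sup>2 = 2 / sqrt 3" by (simp add: s_def)
  have "(norm (of_int m *\<^sub>R tri1 + of_int n *\<^sub>R tri2))\<^sup>2
      = s\<^sup>2 * ((of_int m + of_int n / 2)\<^sup>2 + (of_int n * (sqrt 3 / 2))\<^sup>2)"
    unfolding norm2_sq tri1_def tri2_def s_def[symmetric]
    by (simp add: power2_eq_square algebra_simps)
  also have "(of_int m + of_int n / 2)\<^sup>2 + (of_int n * (sqrt 3 / 2))\<^sup>2 = real_of_int (hex_norm (n, m))"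
    by (simp add: hex_norm_def power_mult_distrib power_divide) (simp add: power2_eq_square field_simps)
  finally show ?thesis by (simp add: s)
qed

lemma rotation_norm:
  fixes Q :: "real^2^2"
  assumes "rotation_matrix Q"
  shows "norm (Q *v x) = norm x"
proof -
  have "orthogonal_transformation ((*v) Q)"
    using assms by (simp add: orthogonal_transformation_matrix rotation_matrix_def matrix_vector_mul_linear)
  then show ?thesis by (rule orthogonal_transformation_norm)
qed

lemma unit_det_lattice: "\<bar>det2 u v\<bar> = 1 \<Longrightarrow> grid u v \<in> lattices 1"
  unfolding lattices_def lattice_basis_iff det_vector_2
  using det2_nonzero_basis[of u v] by (intro CollectI exI[of _ u] exI[of _ v]) auto

lemma rotated_triangular_lattice:
  assumes "rotation_matrix Q"
  shows "(\<lambda>x. Q *v x) ` triangular_lattice \<in> lattices 1"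
  unfolding triangular_grid image_grid
  using assms by (intro unit_det_lattice) (simp add: det2_image tri_det rotation_matrix_def)

text \<open>For any Minkowski basis the first vector is minimal, since the form takes no value
  strictly between 0 and 1; this fixes y. Then x^2 + y^2 >= 1 and |x| <= 1/2 leave only |x| =
  1/2.\<close>

lemma rotated_triangular_params:
  assumes Q: "rotation_matrix Q" and mb: "minkowski_basis ((\<lambda>x. Q *v x) ` triangular_lattice) u v"
  shows "\<bar>par_x u v\<bar> = 1/2" "par_y u = sqrt 3 / 2"
proof -
  let ?L = "(\<lambda>x. Q *v x) ` triangular_lattice"
  note L = rotated_triangular_lattice[OF Q]
  note red = minkowski_reduced[OF L mb]
  have gL: "?L = grid (Q *v tri1) (Q *v tri2)" by (simp add: triangular_grid image_grid)
  have "det2 (Q *v tri1) (Q *v tri2) \<noteq> 0"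
    using Q by (simp add: det2_image tri_det rotation_matrix_def)
  then have "lattice_basis ?L (Q *v tri1) (Q *v tri2)"
    using det2_nonzero_basis gL by (simp add: lattice_basis_iff)
  then have "norm u \<le> norm (Q *v tri1)" using mb unfolding minkowski_basis_def by blast
  then have "(norm u)\<^sup>2 \<le> (norm tri1)\<^sup>2" unfolding rotation_norm[OF Q] by (intro power_mono) auto
  also have "(norm tri1)\<^sup>2 = 2 / sqrt 3" using tri_norm[of 1 0] by (simp add: hex_norm_def)
  finally have up: "(norm u)\<^sup>2 \<le> 2 / sqrt 3" .
  have "u \<in> ?L" using red(2) grid_base1[of u v] by simp
  then obtain x where x: "u = Q *v x" "x \<in> grid tri1 tri2" unfolding triangular_grid by blast
  then obtain m n :: int where mn: "x = of_int m *\<^sub>R tri1 + of_int n *\<^sub>R tri2" by (auto simp: grid_def)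
  have u: "(norm u)\<^sup>2 = 2 / sqrt 3 * of_int (hex_norm (n, m))"
    unfolding x(1) rotation_norm[OF Q] mn by (rule tri_norm)
  have "(norm u)\<^sup>2 > 0" using red(5) by (simp add: par_y_def)
  then have "real_of_int (hex_norm (n, m)) > 0" unfolding u by (rule zero_less_mult_pos) simp
  then have "1 \<le> real_of_int (hex_norm (n, m))" by simp
  then have "2 / sqrt 3 * 1 \<le> (norm u)\<^sup>2" unfolding u by (intro mult_left_mono) auto
  with up have nu: "(norm u)\<^sup>2 = 2 / sqrt 3" by simp
  then show y: "par_y u = sqrt 3 / 2" by (simp add: par_y_def)
  have "(par_y u)\<^sup>2 = 3/4" unfolding y by (simp add: power_divide)
  then have "(1/2)\<^sup>2 \<le> (par_x u v)\<^sup>2" using red(4) by (simp add: power2_eq_square)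
  then have "1/2 \<le> \<bar>par_x u v\<bar>" by (metis abs_le_square_iff abs_of_nonneg zero_le_divide_1_iff zero_le_numeral)
  with red(3) show "\<bar>par_x u v\<bar> = 1/2" by simp
qed

text \<open>A sign change and a shear of v alter neither the grid nor u, and bring the determinant
  to 1 and the angle to 60 degrees. Length and inner product then determine the basis up to a
  rotation.\<close>

lemma params_rotated_triangular:
  assumes d: "\<bar>det2 u v\<bar> = 1" and x: "\<bar>par_x u v\<bar> = 1/2" and y: "par_y u = sqrt 3 / 2"
  shows "\<exists>Q. rotation_matrix Q \<and> grid u v = (\<lambda>x. Q *v x) ` triangular_lattice"
proof -
  define s where "s = sqrt (2 / sqrt 3)"
  have s: "s\<^sup>2 = 2 / sqrt 3" "s > 0" by (simp_all add: s_def)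
  have U: "(norm u)\<^sup>2 = s\<^sup>2"
  proof -
    have "(norm u)\<^sup>2 = 1 / par_y u" by (simp add: par_y_def)
    then show ?thesis by (simp add: y s)
  qed
  have uv: "\<bar>u \<bullet> v\<bar> = s\<^sup>2 / 2"
  proof -
    have h: "\<bar>u \<bullet> v\<bar> / s\<^sup>2 = 1/2" using x unfolding par_x_def U by (simp only: abs_divide abs_power2)
    have "\<bar>u \<bullet> v\<bar> = \<bar>u \<bullet> v\<bar> / s\<^sup>2 * s\<^sup>2" using s(2) by simp
    then show ?thesis unfolding h by simp
  qed
  obtain v1 where v1: "grid u v1 = grid u v" "det2 u v1 = 1" "\<bar>u \<bullet> v1\<bar> = s\<^sup>2 / 2"
  proof (cases "det2 u v = 1")
    case True then show ?thesis using that[of v] uv by simp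
  next
    case False
    then have "det2 u (- v) = 1" using d by (auto simp: det2_def abs_if split: if_splits)
    then show ?thesis using that[of "- v"] uv grid_uminus[of u v] by simp
  qed
  obtain w where w: "grid u w = grid u v" "det2 u w = 1" "u \<bullet> w = s\<^sup>2 / 2"
  proof (cases "u \<bullet> v1 = s\<^sup>2 / 2")
    case True then show ?thesis using that[of v1] v1 by simp
  next
    case False
    then have "u \<bullet> v1 = - (s\<^sup>2 / 2)" using v1(3) by (auto simp: abs_if split: if_splits)
    then have "u \<bullet> (v1 + u) = s\<^sup>2 / 2" using U by (simp add: inner_add_right dot_square_norm)
    moreover have "det2 u (v1 + u) = 1" using v1(2) by (simp add: det2_def algebra_simps)
    moreover have "grid u (v1 + u) = grid u v" using grid_shear[of u v1] v1(1) by simp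
    ultimately show ?thesis using that by blast
  qed
  \<comment> \<open>The columns are u / s and its quarter turn, so \<open>Q\<close> is the rotation
    taking the first triangular basis vector to u.\<close>
  define Q :: "real^2^2" where "Q = vector [vector [u $ 1 / s, - u $ 2 / s], vector [u $ 2 / s, u $ 1 / s]]"
  have Qc: "Q $ 1 $ 1 = u $ 1 / s" "Q $ 1 $ 2 = - u $ 2 / s" "Q $ 2 $ 1 = u $ 2 / s" "Q $ 2 $ 2 = u $ 1 / s"
    by (simp_all add: Q_def)
  have uu: "(u $ 1)\<^sup>2 + (u $ 2)\<^sup>2 = s\<^sup>2" using U by (simp add: norm2_sq)
  have one: "(u $ 1 * u $ 1 + u $ 2 * u $ 2) / (s * s) = 1" using uu s(2) by (simp add: power2_eq_square)
  have rot: "rotation_matrix Q"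
    unfolding rotation_matrix_def
  proof
    have "transpose Q ** Q = mat 1"
      using one by (simp add: vec_eq_iff forall_2 matrix_matrix_mult_def transpose_def sum_2 Qc mat_def add_divide_distrib algebra_simps)
    then show "orthogonal_matrix Q" by (simp add: orthogonal_matrix)
    show "det Q = 1" using one by (simp add: det_2 Qc add_divide_distrib)
  qed
  have Q1: "Q *v tri1 = u"
    using s(2) by (simp add: vec_eq_iff forall_2 matrix_vector_2 Qc tri1_def s_def[symmetric])
  have Q2: "Q *v tri2 = w"
  proof -
    have a: "u $ 1 * w $ 1 + u $ 2 * w $ 2 = s\<^sup>2 / 2" "u $ 1 * w $ 2 - u $ 2 * w $ 1 = 1"
      using w(2,3) by (simp_all add: det2_def inner2)
    have h: "s\<^sup>2 * (sqrt 3 / 2) = 1" by (simp add: s)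
    have "((u $ 1)\<^sup>2 + (u $ 2)\<^sup>2) * w $ 1 = u $ 1 * (u $ 1 * w $ 1 + u $ 2 * w $ 2) - u $ 2 * (u $ 1 * w $ 2 - u $ 2 * w $ 1)"
      by (simp add: power2_eq_square algebra_simps)
    then have "s\<^sup>2 * w $ 1 = u $ 1 * (s\<^sup>2 / 2) - u $ 2 * 1" unfolding a uu .
    also have "\<dots> = s\<^sup>2 * (u $ 1 / 2 - u $ 2 * (sqrt 3 / 2))"
      unfolding h[symmetric] by (simp add: algebra_simps)
    finally have w1: "w $ 1 = u $ 1 / 2 - u $ 2 * (sqrt 3 / 2)" using s(2) by simp
    have "((u $ 1)\<^sup>2 + (u $ 2)\<^sup>2) * w $ 2 = u $ 2 * (u $ 1 * w $ 1 + u $ 2 * w $ 2) + u $ 1 * (u $ 1 * w $ 2 - u $ 2 * w $ 1)"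
      by (simp add: power2_eq_square algebra_simps)
    then have "s\<^sup>2 * w $ 2 = u $ 2 * (s\<^sup>2 / 2) + u $ 1 * 1" unfolding a uu .
    also have "\<dots> = s\<^sup>2 * (u $ 2 / 2 + u $ 1 * (sqrt 3 / 2))"
      unfolding h[symmetric] by (simp add: algebra_simps)
    finally have w2: "w $ 2 = u $ 2 / 2 + u $ 1 * (sqrt 3 / 2)" using s(2) by simp
    show ?thesis
      using s(2) by (simp add: vec_eq_iff forall_2 matrix_vector_2 Qc tri2_def s_def[symmetric] w1 w2)
  qed
  have "grid u v = (\<lambda>x. Q *v x) ` triangular_lattice"
    unfolding triangular_grid image_grid Q1 Q2 w(1) ..
  with rot show ?thesis by blast
qed

text \<open>The sum itself need not be measurable where it diverges, whence the representative \<open>G\<close>.\<close>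

lemma has_bochner_integral_infsum:
  fixes g :: "'i \<Rightarrow> 'a \<Rightarrow> real"
  assumes A: "countable A" "infinite A"
    and g: "\<And>i. i \<in> A \<Longrightarrow> has_bochner_integral M (g i) (J i)" "\<And>i x. i \<in> A \<Longrightarrow> 0 \<le> g i x"
    and ae: "AE x in M. (\<lambda>i. g i x) summable_on A" and J: "J summable_on A"
  shows "\<exists>G. has_bochner_integral M G (infsum J A) \<and> (AE x in M. G x = (\<Sum>\<^sub>\<infinity>i\<in>A. g i x))"
proof -
  define e where "e = from_nat_into A"
  have e: "bij_betw e UNIV A" unfolding e_def by (rule bij_betw_from_nat_into[OF A])
  have eA: "e n \<in> A" for n using e by (auto simp: bij_betw_def)
  have sJ: "summable (\<lambda>n. J (e n))" "infsum J A = (\<Sum>n. J (e n))"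
  proof -
    have "(\<lambda>n. J (e n)) summable_on UNIV" using summable_on_reindex_bij_betw[OF e, of J] J by simp
    then have "((\<lambda>n. J (e n)) has_sum infsum J A) UNIV"
      using has_sum_infsum infsum_reindex_bij_betw[OF e, of J] by metis
    then have "(\<lambda>n. J (e n)) sums infsum J A" by (rule has_sum_imp_sums)
    then show "summable (\<lambda>n. J (e n))" "infsum J A = (\<Sum>n. J (e n))" by (auto simp: sums_iff)
  qed
  have aes: "AE x in M. summable (\<lambda>n. norm (g (e n) x)) \<and> (\<Sum>\<^sub>\<infinity>i\<in>A. g i x) = (\<Sum>n. g (e n) x)"
    using ae
  proof eventually_elim
    fix x assume s: "(\<lambda>i. g i x) summable_on A"
    then have "(\<lambda>n. g (e n) x) summable_on UNIV" using summable_on_reindex_bij_betw[OF e, of "\<lambda>i. g i x"] by simp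
    then have "((\<lambda>n. g (e n) x) has_sum (\<Sum>\<^sub>\<infinity>i\<in>A. g i x)) UNIV"
      using has_sum_infsum infsum_reindex_bij_betw[OF e, of "\<lambda>i. g i x"] by metis
    then have "(\<lambda>n. g (e n) x) sums (\<Sum>\<^sub>\<infinity>i\<in>A. g i x)" by (rule has_sum_imp_sums)
    moreover have "norm (g (e n) x) = g (e n) x" for n using g(2)[OF eA] by simp
    ultimately show "summable (\<lambda>n. norm (g (e n) x)) \<and> (\<Sum>\<^sub>\<infinity>i\<in>A. g i x) = (\<Sum>n. g (e n) x)" by (auto simp: sums_iff)
  qed
  have gi: "integrable M (g (e n))" "integral\<^sup>L M (g (e n)) = J (e n)" for n
    using g(1)[OF eA] by (auto simp: has_bochner_integral_iff)
  have gn: "(\<integral>x. norm (g (e n) x) \<partial>M) = J (e n)" for n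
    using gi(2)[of n] g(2)[OF eA] by simp
  have ae1: "AE x in M. summable (\<lambda>n. norm (g (e n) x))" using aes by eventually_elim auto
  have I: "integrable M (\<lambda>x. \<Sum>n. g (e n) x)" "integral\<^sup>L M (\<lambda>x. \<Sum>n. g (e n) x) = (\<Sum>n. integral\<^sup>L M (g (e n)))"
    using sJ(1) unfolding gn[symmetric] by (rule integrable_suminf[OF gi(1) ae1], rule integral_suminf[OF gi(1) ae1])
  have "has_bochner_integral M (\<lambda>x. \<Sum>n. g (e n) x) (infsum J A)"
    using I by (simp add: has_bochner_integral_iff gi(2) sJ(2))
  moreover have "AE x in M. (\<Sum>n. g (e n) x) = (\<Sum>\<^sub>\<infinity>i\<in>A. g i x)" using aes by eventually_elim auto
  ultimately show ?thesis by blast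
qed

section \<open>Completely monotone potentials\<close>

lemma one_plus_square_powr_summable:
  fixes q :: real
  assumes q: "q > 1"
  shows "(\<lambda>n::int. (1 + (of_int n)\<^sup>2) powr (- q / 2)) summable_on UNIV"
proof -
  have "summable (\<lambda>n::nat. (1 + (real n)\<^sup>2) powr (- q / 2))"
  proof (rule summable_comparison_test_ev)
    show "summable (\<lambda>n. real n powr (- q))" using q by (subst summable_real_powr_iff) auto
    show "\<forall>\<^sub>F n in sequentially. norm ((1 + (real n)\<^sup>2) powr (- q / 2)) \<le> real n powr (- q)"
      using eventually_gt_at_top[of 0]
    proof eventually_elim
      fix n :: nat assume n: "0 < n"
      have "(1 + (real n)\<^sup>2) powr (- q / 2) \<le> ((real n)\<^sup>2) powr (- q / 2)"
        using n q by (intro powr_mono2') auto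
      also have "((real n)\<^sup>2) powr (- q / 2) = (real n powr 2) powr (- q / 2)" using n by (simp add: powr_numeral)
      also have "\<dots> = real n powr (- q)" by (simp only: powr_powr) simp
      finally show "norm ((1 + (real n)\<^sup>2) powr (- q / 2)) \<le> real n powr (- q)" by simp
    qed
  qed
  then have "(\<lambda>n::nat. (1 + (real n)\<^sup>2) powr (- q / 2)) summable_on UNIV"
    by (intro summable_nonneg_imp_summable_on) auto
  from summable_on_nat_abs[OF this] show ?thesis by simp
qed

text \<open>The growth condition speaks only about large r; on the bounded range from c up to R
  monotonicity supplies f r <= f c. The form 1 + r / c is chosen because it splits over the two
  lattice coordinates.\<close>

lemma cm_potential_decay:
  fixes f :: "real \<Rightarrow> real"
  assumes anti: "\<And>r r'. 0 < r \<Longrightarrow> r \<le> r' \<Longrightarrow> f r' \<le> f r" and nonneg: "\<And>r. 0 < r \<Longrightarrow> 0 \<le> f r"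
    and q: "q > 0" "f \<in> O[at_top](\<lambda>r. r powr (- q))" and c: "c > 0"
  obtains C where "C \<ge> 0" "\<And>r. c \<le> r \<Longrightarrow> f r \<le> C * (1 + r / c) powr (- q)"
proof -
  obtain B where B: "B > 0" "\<forall>\<^sub>F r in at_top. norm (f r) \<le> B * norm (r powr (- q))"
    using landau_o.bigE[OF q(2)] by blast
  then obtain R0 where R0: "\<And>r. R0 \<le> r \<Longrightarrow> norm (f r) \<le> B * norm (r powr (- q))"
    by (auto simp: eventually_at_top_linorder)
  define R where "R = max R0 c"
  define C where "C = B * (2 / c) powr q + f c * (1 + R / c) powr q"
  have R: "R \<ge> c" "R > 0" using c by (auto simp: R_def)
  have parts: "0 \<le> B * (2 / c) powr q" "0 \<le> f c * (1 + R / c) powr q" using B nonneg[OF c] by auto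
  show thesis
  proof (rule that[of C])
    show "C \<ge> 0" using parts by (simp add: C_def)
    fix r assume r: "c \<le> r"
    have r0: "r > 0" using r c by simp
    have pos: "0 \<le> (1 + r / c) powr (- q)" by simp
    have "f r \<le> B * (2 / c) powr q * (1 + r / c) powr (- q) \<or> f r \<le> f c * (1 + R / c) powr q * (1 + r / c) powr (- q)"
    proof (cases "R \<le> r")
      case True
      have "f r \<le> B * r powr (- q)" using R0[of r] True by (auto simp: R_def)
      also have "r powr (- q) = (2 / c) powr q * (2 * r / c) powr (- q)"
      proof -
        have "2 * r / c = (2 / c) * r" by simp
        then have "(2 * r / c) powr (- q) = (2 / c) powr (- q) * r powr (- q)" using c r0 by (simp only: powr_mult)
        moreover have "(2 / c) powr q * (2 / c) powr (- q) = 1" using c by (simp add: powr_minus)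
        ultimately show ?thesis by (simp add: mult.assoc[symmetric])
      qed
      also have "B * ((2 / c) powr q * (2 * r / c) powr (- q)) \<le> B * ((2 / c) powr q * (1 + r / c) powr (- q))"
      proof (intro mult_left_mono powr_mono2')
        show "1 + r / c \<le> 2 * r / c" "0 < 1 + r / c" using r c r0 by (auto simp: field_simps add_pos_pos)
      qed (use q B in auto)
      finally show ?thesis by (simp add: mult.assoc)
    next
      case False
      have "f r \<le> f c" by (rule anti[OF c r])
      also have "\<dots> = f c * 1" by simp
      also have "\<dots> \<le> f c * ((1 + R / c) powr q * (1 + r / c) powr (- q))"
      proof (intro mult_left_mono nonneg c)
        have p: "0 < 1 + r / c" using r0 c by (simp add: add_pos_pos)
        have "1 = (1 + r / c) powr q * (1 + r / c) powr (- q)" using p by (simp add: powr_minus)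
        also have "\<dots> \<le> (1 + R / c) powr q * (1 + r / c) powr (- q)"
          using False c p q by (intro mult_right_mono powr_mono2) (auto intro: divide_right_mono)
        finally show "1 \<le> (1 + R / c) powr q * (1 + r / c) powr (- q)" .
      qed
      finally show ?thesis by (simp add: mult.assoc)
    qed
    moreover have "0 \<le> B * (2 / c) powr q * (1 + r / c) powr (- q)" "0 \<le> f c * (1 + R / c) powr q * (1 + r / c) powr (- q)"
      using parts pos by (auto intro: mult_nonneg_nonneg)
    ultimately show "f r \<le> C * (1 + r / c) powr (- q)"
      unfolding C_def distrib_right by linarith
  qed
qed

text \<open>From (1 + a) * (1 + b) <= (1 + a + b)^2 with a = n^2 and b = m^2, the decay rate q
  splits into two one-dimensional series with terms of order |n|^(-q) and |m|^(-q), each convergent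
  for q > 1.\<close>

lemma cm_potential_lattice_summable:
  fixes f :: "real \<Rightarrow> real"
  assumes anti: "\<And>r r'. 0 < r \<Longrightarrow> r \<le> r' \<Longrightarrow> f r' \<le> f r" and nonneg: "\<And>r. 0 < r \<Longrightarrow> 0 \<le> f r"
    and q: "q > 1" "f \<in> O[at_top](\<lambda>r. r powr (- q))" and c: "c > 0"
    and Q: "\<And>n m. c * ((of_int n)\<^sup>2 + (of_int m)\<^sup>2) \<le> Q (n, m)"
  shows "(\<lambda>z::int \<times> int. f (Q z)) summable_on (UNIV - {(0, 0)})"
proof -
  obtain C where C: "C \<ge> 0" "\<And>r. c \<le> r \<Longrightarrow> f r \<le> C * (1 + r / c) powr (- q)"
    using cm_potential_decay[OF anti nonneg _ q(2) c] q(1) by (metis less_trans zero_less_one)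
  have "(\<lambda>(n::int, m::int). (1 + (of_int n)\<^sup>2) powr (- q / 2) * ((1 + (of_int m)\<^sup>2) powr (- q / 2) * 1)) summable_on UNIV"
    by (intro product_summable one_plus_square_powr_summable q) auto
  then have s: "(\<lambda>z. C * (case z of (n::int, m::int) \<Rightarrow> (1 + (of_int n)\<^sup>2) powr (- q / 2) * ((1 + (of_int m)\<^sup>2) powr (- q / 2) * 1))) summable_on (UNIV - {(0, 0)})"
    by (intro summable_on_cmult_right) (rule summable_on_subset_banach, auto)
  have pos: "c \<le> c * ((of_int n)\<^sup>2 + (of_int m)\<^sup>2)" if "(n, m) \<noteq> (0, 0)" for n m :: int
  proof -
    have "0 < n\<^sup>2 + m\<^sup>2" using that by (simp add: sum_power2_gt_zero_iff)
    then have "real_of_int 1 \<le> real_of_int (n\<^sup>2 + m\<^sup>2)" by (subst of_int_le_iff) linarith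
    then have "c * 1 \<le> c * ((of_int n)\<^sup>2 + (of_int m)\<^sup>2)" using c by (intro mult_left_mono) auto
    then show ?thesis by simp
  qed
  show ?thesis
  proof (rule summable_on_comparison_test[OF s])
    fix z :: "int \<times> int" assume "z \<in> UNIV - {(0, 0)}"
    then obtain n m where z: "z = (n, m)" "(n, m) \<noteq> (0, 0)" by (cases z) auto
    define a b where "a = (real_of_int n)\<^sup>2" and "b = (real_of_int m)\<^sup>2"
    have ab: "a \<ge> 0" "b \<ge> 0" by (auto simp: a_def b_def)
    have c1: "c \<le> c * (a + b)" using pos[OF z(2)] by (simp add: a_def b_def)
    have Qz: "c * (a + b) \<le> Q z" using Q[of n m] by (simp add: z a_def b_def)
    show "0 \<le> f (Q z)" using c c1 Qz by (intro nonneg) linarith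
    have "f (Q z) \<le> f (c * (a + b))" using c c1 Qz by (intro anti) linarith+
    also have "\<dots> \<le> C * (1 + c * (a + b) / c) powr (- q)" by (rule C(2)[OF c1])
    also have "1 + c * (a + b) / c = 1 + a + b" using c by simp
    also have "C * (1 + a + b) powr (- q) \<le> C * ((1 + a) powr (- q / 2) * ((1 + b) powr (- q / 2) * 1))"
    proof (intro mult_left_mono C(1))
      have "(1 + a + b) powr (- q) = ((1 + a + b) powr 2) powr (- q / 2)" by (simp only: powr_powr) simp
      also have "\<dots> = ((1 + a + b)\<^sup>2) powr (- q / 2)" using ab by (simp add: powr_numeral)
      also have "((1 + a + b)\<^sup>2) powr (- q / 2) \<le> ((1 + a) * (1 + b)) powr (- q / 2)"
      proof (rule powr_mono2')
        show "(1 + a) * (1 + b) \<le> (1 + a + b)\<^sup>2" using ab by (simp add: power2_eq_square algebra_simps)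
        show "0 < (1 + a) * (1 + b)" using ab by (intro mult_pos_pos) auto
      qed (use q in auto)
      also have "\<dots> = (1 + a) powr (- q / 2) * (1 + b) powr (- q / 2)" using ab by (simp add: powr_mult)
      finally show "(1 + a + b) powr (- q) \<le> (1 + a) powr (- q / 2) * ((1 + b) powr (- q / 2) * 1)" by simp
    qed
    finally show "f (Q z) \<le> C * (case z of (n::int, m::int) \<Rightarrow> (1 + (of_int n)\<^sup>2) powr (- q / 2) * ((1 + (of_int m)\<^sup>2) powr (- q / 2) * 1))"
      by (simp add: z a_def b_def)
  qed
qed

text \<open>The mixed term is at most |m * n| <= (m^2 + n^2) / 2 because |x| <= 1/2, and the
  coefficient of n^2 is at least 1.\<close>

lemma reduced_quadratic_ge:
  fixes m n x y :: real
  assumes "\<bar>x\<bar> \<le> 1/2" "1 \<le> x\<^sup>2 + y\<^sup>2"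
  shows "1/2 * (n\<^sup>2 + m\<^sup>2) \<le> (m + n * x)\<^sup>2 + (n * y)\<^sup>2"
proof -
  have "\<bar>2 * m * n * x\<bar> \<le> \<bar>m * n\<bar>"
    using mult_left_mono[OF assms(1), of "2 * \<bar>m * n\<bar>"] by (simp add: abs_mult mult_ac)
  moreover have "2 * \<bar>m * n\<bar> \<le> m\<^sup>2 + n\<^sup>2"
    using sum_squares_bound[of "\<bar>m\<bar>" "\<bar>n\<bar>"] by (simp add: abs_mult mult.assoc)
  moreover have "n\<^sup>2 * 1 \<le> n\<^sup>2 * (x\<^sup>2 + y\<^sup>2)" using assms(2) by (intro mult_left_mono) auto
  moreover have "(m + n * x)\<^sup>2 + (n * y)\<^sup>2 = m\<^sup>2 + 2 * m * n * x + n\<^sup>2 * (x\<^sup>2 + y\<^sup>2)"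
    by (simp add: power2_eq_square algebra_simps)
  ultimately show ?thesis by simp
qed

section \<open>Energies as integrals of theta functions over the inverse temperature\<close>

definition hexagonal :: "real^2 \<Rightarrow> real^2 \<Rightarrow> bool" where
  "hexagonal u v \<longleftrightarrow> \<bar>par_x u v\<bar> = 1/2 \<and> par_y u = sqrt 3 / 2"

lemma hexagonal_theta:
  assumes "hexagonal u v" "\<alpha> > 0"
  shows "theta \<alpha> (par_x u v) (par_y u) = theta \<alpha> (1/2) (sqrt 3 / 2)"
    and "theta_center \<alpha> (par_x u v) (par_y u) = theta_center \<alpha> (1/2) (sqrt 3 / 2)"
proof -
  have x: "par_x u v = 1/2 \<or> par_x u v = - (1/2)" using assms unfolding hexagonal_def by arith
  have y: "par_y u = sqrt 3 / 2" using assms by (simp add: hexagonal_def)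
  have "theta \<alpha> (- (1/2)) (sqrt 3 / 2) = theta \<alpha> (1/2) (sqrt 3 / 2)"
    "theta_center \<alpha> (- (1/2)) (sqrt 3 / 2) = theta_center \<alpha> (1/2) (sqrt 3 / 2)"
    by (intro theta_minus theta_center_minus assms(2), simp)+
  with x show "theta \<alpha> (par_x u v) (par_y u) = theta \<alpha> (1/2) (sqrt 3 / 2)"
    "theta_center \<alpha> (par_x u v) (par_y u) = theta_center \<alpha> (1/2) (sqrt 3 / 2)"
    unfolding y by metis+
qed

locale cm_measure =
  fixes \<mu> :: "real measure" and f :: "real \<Rightarrow> real" and q :: real
  assumes radon: "radon_measure_half_line \<mu>"
    and laplace: "\<And>r. r > 0 \<Longrightarrow> has_bochner_integral \<mu> (\<lambda>t. exp (- (r * t))) (f r)"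
    and q: "q > 1" "f \<in> O[at_top](\<lambda>r. r powr (- q))"
    and nz: "\<exists>r>0. f r \<noteq> 0"
begin

lemma sets_mu: "sets \<mu> = sets (restrict_space borel {0..})"
  using radon by (simp add: radon_measure_half_line_def)

lemma space_mu: "space \<mu> = {0..}"
  using sets_eq_imp_space_eq[OF sets_mu] by (simp add: space_restrict_space)

lemma f_eq: "r > 0 \<Longrightarrow> f r = (\<integral>t. exp (- (r * t)) \<partial>\<mu>)"
  using laplace[of r] by (simp add: has_bochner_integral_iff)

lemma f_nonneg: "r > 0 \<Longrightarrow> 0 \<le> f r"
  by (simp add: f_eq)

lemma f_antimono:
  assumes "0 < r" "r \<le> r'"
  shows "f r' \<le> f r"
proof -
  have "(\<integral>t. exp (- (r' * t)) \<partial>\<mu>) \<le> (\<integral>t. exp (- (r * t)) \<partial>\<mu>)"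
  proof (rule integral_mono_AE)
    show "integrable \<mu> (\<lambda>t. exp (- (r' * t)))" "integrable \<mu> (\<lambda>t. exp (- (r * t)))"
      using laplace[of r] laplace[of r'] assms by (auto simp: has_bochner_integral_iff)
    show "AE t in \<mu>. exp (- (r' * t)) \<le> exp (- (r * t))"
      by (rule AE_I2) (use assms in \<open>auto simp: space_mu mult_right_mono\<close>)
  qed
  then show ?thesis using assms by (simp add: f_eq)
qed

text \<open>The mass of the origin is bounded by f r for every r > 0, and f tends to 0. The point t
  = 0 has to be excluded because every Gaussian lattice sum diverges there.\<close>

lemma AE_pos: "AE t in \<mu>. t > 0"
proof -
  have S: "{0} \<in> sets \<mu>" by (simp add: sets_mu sets_restrict_space_iff)
  have "measure \<mu> {0} \<le> f r" if r: "r > 0" for r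
  proof -
    have fin: "emeasure \<mu> {0} < \<infinity>"
      using radon by (auto simp: radon_measure_half_line_def)
    have "measure \<mu> {0} = (\<integral>t. indicator {0} t \<partial>\<mu>)" by (simp add: space_mu)
    also have "\<dots> \<le> (\<integral>t. exp (- (r * t)) \<partial>\<mu>)"
    proof (rule integral_mono)
      show "integrable \<mu> (indicator {0} :: real \<Rightarrow> real)" using S fin by simp
      show "integrable \<mu> (\<lambda>t. exp (- (r * t)))" using laplace[OF r] by (simp add: has_bochner_integral_iff)
    qed (auto simp: indicator_def)
    finally show ?thesis using r by (simp add: f_eq)
  qed
  moreover have "(f \<longlongrightarrow> 0) at_top"
  proof -
    have "((\<lambda>r. r powr (- q)) \<longlongrightarrow> 0) (at_top :: real filter)"
      using q(1) by (intro tendsto_neg_powr filterlim_ident) auto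
    obtain B where B: "\<forall>\<^sub>F r in at_top. norm (f r) \<le> B * norm (r powr (- q))"
      using landau_o.bigE[OF q(2)] by blast
    have "((\<lambda>r. B * norm (r powr (- q))) \<longlongrightarrow> B * norm (0::real)) at_top"
      by (intro tendsto_intros) fact
    then show ?thesis using Lim_null_comparison[OF B] by simp
  qed
  ultimately have "measure \<mu> {0} \<le> 0"
    by (intro tendsto_lowerbound[of f 0 at_top]) (auto intro: eventually_mono[OF eventually_gt_at_top[of 0]])
  then have "measure \<mu> {0} = 0" using measure_nonneg[of \<mu> "{0}"] by linarith
  moreover have "emeasure \<mu> {0} < \<infinity>"
    using radon by (auto simp: radon_measure_half_line_def)
  ultimately have "emeasure \<mu> {0} = 0" by (simp add: emeasure_eq_ennreal_measure less_top)
  then have "AE t in \<mu>. t \<notin> {0}" using S by (intro AE_not_in) (auto simp: null_sets_def)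
  moreover have "AE t in \<mu>. t \<ge> 0" by (rule AE_I2) (simp add: space_mu)
  ultimately show ?thesis by eventually_elim auto
qed

text \<open>A null measure would make f vanish. This is the source of strict inequalities after
  integration.\<close>

lemma space_not_null: "emeasure \<mu> (space \<mu>) \<noteq> 0"
proof
  assume "emeasure \<mu> (space \<mu>) = 0"
  then have "AE t in \<mu>. False" by (simp add: AE_iff_null null_sets_def)
  then have "(\<integral>t. exp (- (r * t)) \<partial>\<mu>) = (\<integral>t. 0 \<partial>\<mu>)" for r
    by (intro Bochner_Integration.integral_cong_AE) (auto simp: sets_mu measurable_restrict_space1 cong: measurable_cong_sets)
  then show False using nz f_eq by auto
qed

text \<open>Each term of the energy is a Laplace integral; nonnegativity and the two summability
  conditions permit exchanging the sum with the integral.\<close>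

lemma energy_representation:
  assumes A: "countable A" "infinite A" and bij: "bij_betw \<phi> A (X - {0})"
    and s: "(\<lambda>i. f ((norm (\<phi> i))\<^sup>2)) summable_on A"
    and st: "\<And>t. t > 0 \<Longrightarrow> (\<lambda>i. exp (- (t * (norm (\<phi> i))\<^sup>2))) summable_on A"
  shows "\<exists>G. has_bochner_integral \<mu> G (energy f X) \<and> (AE t in \<mu>. t > 0 \<and> G t = (\<Sum>\<^sub>\<infinity>i\<in>A. exp (- (t * (norm (\<phi> i))\<^sup>2))))"
proof -
  have e: "energy f X = (\<Sum>\<^sub>\<infinity>i\<in>A. f ((norm (\<phi> i))\<^sup>2))"
    unfolding energy_def by (rule infsum_reindex_bij_betw[OF bij, symmetric])
  have nz: "(norm (\<phi> i))\<^sup>2 > 0" if "i \<in> A" for i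
    using bij that by (auto simp: bij_betw_def)
  have "\<exists>G. has_bochner_integral \<mu> G (\<Sum>\<^sub>\<infinity>i\<in>A. f ((norm (\<phi> i))\<^sup>2)) \<and> (AE t in \<mu>. G t = (\<Sum>\<^sub>\<infinity>i\<in>A. exp (- ((norm (\<phi> i))\<^sup>2 * t))))"
  proof (rule has_bochner_integral_infsum[OF A _ _ _ s])
    show "AE t in \<mu>. (\<lambda>i. exp (- ((norm (\<phi> i))\<^sup>2 * t))) summable_on A"
      using AE_pos by eventually_elim (use st in \<open>simp add: mult.commute\<close>)
  qed (auto intro!: laplace nz)
  then obtain G where G: "has_bochner_integral \<mu> G (energy f X)" "AE t in \<mu>. G t = (\<Sum>\<^sub>\<infinity>i\<in>A. exp (- ((norm (\<phi> i))\<^sup>2 * t)))"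
    unfolding e by blast
  from G(2) AE_pos have "AE t in \<mu>. t > 0 \<and> G t = (\<Sum>\<^sub>\<infinity>i\<in>A. exp (- (t * (norm (\<phi> i))\<^sup>2)))"
    by eventually_elim (simp add: mult.commute)
  with G(1) show ?thesis by blast
qed

lemma has_bochner_integral_le:
  assumes "has_bochner_integral \<mu> G a" "has_bochner_integral \<mu> H b" "AE t in \<mu>. G t \<le> H t"
  shows "a \<le> (b::real)"
  using assms integral_mono_AE[of \<mu> G H] by (auto simp: has_bochner_integral_iff)

text \<open>If the nonnegative difference H - G had integral 0, it would vanish almost everywhere,
  contradicting strict inequality on a space of positive measure.\<close>

lemma has_bochner_integral_less:
  assumes "has_bochner_integral \<mu> G a" "has_bochner_integral \<mu> H b" "AE t in \<mu>. G t < H t"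
  shows "a < (b::real)"
proof (rule ccontr)
  assume "\<not> a < b"
  have i: "integrable \<mu> G" "integrable \<mu> H" "integral\<^sup>L \<mu> G = a" "integral\<^sup>L \<mu> H = b"
    using assms by (auto simp: has_bochner_integral_iff)
  have "AE t in \<mu>. 0 \<le> H t - G t" using assms(3) by eventually_elim simp
  moreover from this have "integral\<^sup>L \<mu> (\<lambda>t. H t - G t) \<ge> 0" by (rule integral_nonneg_AE)
  then have "integral\<^sup>L \<mu> (\<lambda>t. H t - G t) = 0" using i \<open>\<not> a < b\<close> by simp
  ultimately have "AE t in \<mu>. H t - G t = 0"
    using i by (subst (asm) integral_nonneg_eq_0_iff_AE) auto
  with assms(3) have "AE t in \<mu>. False" by eventually_elim simp
  then show False using space_not_null by (simp add: AE_iff_null null_sets_def)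
qed

lemma lattice_summable:
  assumes L: "L \<in> lattices 1" and mb: "minkowski_basis L u v"
  shows "(\<lambda>p. f ((norm p)\<^sup>2)) summable_on (L - {0})"
proof -
  note red = minkowski_reduced[OF L mb]
  define \<phi> where "\<phi> = (\<lambda>(n::int, m::int). of_int m *\<^sub>R u + of_int n *\<^sub>R v)"
  have d0: "det2 u v \<noteq> 0" using red(1) by auto
  have b: "bij_betw \<phi> (UNIV - {(0, 0)}) (L - {0})"
    using grid_bij_nonzero[OF d0] red(2) by (simp add: \<phi>_def)
  have "(\<lambda>z. f ((norm (\<phi> z))\<^sup>2)) summable_on (UNIV - {(0, 0)})"
  proof (rule cm_potential_lattice_summable[OF f_antimono f_nonneg q])
    show "1/2 / par_y u > 0" using red(5) by simp
    fix n m :: int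
    have "1/2 * ((real_of_int n)\<^sup>2 + (real_of_int m)\<^sup>2) / par_y u \<le> ((of_int m + of_int n * par_x u v)\<^sup>2 + (of_int n * par_y u)\<^sup>2) / par_y u"
      using reduced_quadratic_ge[OF red(3,4), of "of_int n" "of_int m"] red(5) by (intro divide_right_mono) auto
    then show "1/2 / par_y u * ((real_of_int n)\<^sup>2 + (real_of_int m)\<^sup>2) \<le> (norm (\<phi> (n, m)))\<^sup>2"
      by (simp add: \<phi>_def norm_combination(2)[OF red(1)])
  qed auto
  then show ?thesis using summable_on_reindex_bij_betw[OF b, of "\<lambda>p. f ((norm p)\<^sup>2)"] by simp
qed

text \<open>Temperature t corresponds to alpha = t / pi; the 1 removed from \<open>theta\<close> is
  the term of the origin.\<close>

lemma lattice_energy: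
  assumes L: "L \<in> lattices 1" and mb: "minkowski_basis L u v"
  shows "\<exists>G. has_bochner_integral \<mu> G (energy f L) \<and> (AE t in \<mu>. t > 0 \<and> G t = theta (t / pi) (par_x u v) (par_y u) - 1)"
proof -
  note red = minkowski_reduced[OF L mb]
  define \<phi> where "\<phi> = (\<lambda>(n::int, m::int). of_int m *\<^sub>R u + of_int n *\<^sub>R v)"
  have d0: "det2 u v \<noteq> 0" using red(1) by auto
  have b: "bij_betw \<phi> (UNIV - {(0, 0)}) (L - {0})"
    using grid_bij_nonzero[OF d0] red(2) by (simp add: \<phi>_def)
  have th: "((\<lambda>z. exp (- (t * (norm (\<phi> z))\<^sup>2))) has_sum theta (t / pi) (par_x u v) (par_y u)) UNIV" if "t > 0" for t
  proof -
    have "(\<lambda>z. exp (- (t * (norm (\<phi> z))\<^sup>2))) = (\<lambda>(n::int, m::int). exp (- (pi * (t / pi) * (((of_int m + of_int n * par_x u v)\<^sup>2 + (of_int n * par_y u)\<^sup>2) / par_y u))))"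
      by (rule ext) (auto simp: \<phi>_def norm_combination(2)[OF red(1)])
    then show ?thesis using theta_has_sum(1)[of "t / pi" "par_y u" "par_x u v"] that red(5) by simp
  qed
  have th0: "((\<lambda>z. exp (- (t * (norm (\<phi> z))\<^sup>2))) has_sum (theta (t / pi) (par_x u v) (par_y u) - 1)) (UNIV - {(0, 0)})" if "t > 0" for t
    using has_sum_Diff[OF th[OF that] has_sum_finite[of "{(0, 0)}" "\<lambda>z. exp (- (t * (norm (\<phi> z))\<^sup>2))"]] by (simp add: \<phi>_def)
  have "\<exists>G. has_bochner_integral \<mu> G (energy f L) \<and> (AE t in \<mu>. t > 0 \<and> G t = (\<Sum>\<^sub>\<infinity>z\<in>UNIV - {(0, 0)}. exp (- (t * (norm (\<phi> z))\<^sup>2))))"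
  proof (rule energy_representation[OF _ _ b])
    show "(\<lambda>z. f ((norm (\<phi> z))\<^sup>2)) summable_on (UNIV - {(0, 0)})"
      using lattice_summable[OF L mb] summable_on_reindex_bij_betw[OF b, of "\<lambda>p. f ((norm p)\<^sup>2)"] by simp
    show "(\<lambda>z. exp (- (t * (norm (\<phi> z))\<^sup>2))) summable_on (UNIV - {(0, 0)})" if "t > 0" for t
      using th0[OF that] by (rule has_sum_imp_summable)
    show "infinite (UNIV - {(0::int, 0::int)})"
      by (intro infinite_remove) (simp add: finite_prod)
  qed auto
  then obtain G where G: "has_bochner_integral \<mu> G (energy f L)" "AE t in \<mu>. t > 0 \<and> G t = (\<Sum>\<^sub>\<infinity>z\<in>UNIV - {(0, 0)}. exp (- (t * (norm (\<phi> z))\<^sup>2)))" by blast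
  from G(2) have "AE t in \<mu>. t > 0 \<and> G t = theta (t / pi) (par_x u v) (par_y u) - 1"
    by eventually_elim (use th0 in \<open>auto dest: infsumI\<close>)
  with G(1) show ?thesis by blast
qed

text \<open>Dilation by k multiplies squared norms by k^2, which is absorbed into the temperature.
  Summability of f is inherited because the translated sublattice lies in L.\<close>

lemma center_energy:
  assumes L: "L \<in> lattices 1" and mb: "minkowski_basis L u v" and k: "k > 0"
    and p: "p \<in> L" and c: "(1 / real k) *\<^sub>R p - cell_center u v \<in> L"
  shows "\<exists>G. has_bochner_integral \<mu> G (energy f (translated_sublattice p k L)) \<and>
    (AE t in \<mu>. t > 0 \<and> G t = theta_center ((real k)\<^sup>2 * t / pi) (par_x u v) (par_y u))"
proof -
  note red = minkowski_reduced[OF L mb]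
  define \<phi> where "\<phi> = (\<lambda>(n::int, m::int). real k *\<^sub>R ((of_int m + 1/2) *\<^sub>R u + (of_int n + 1/2) *\<^sub>R v))"
  have d0: "det2 u v \<noteq> 0" using red(1) by auto
  have c': "(1 / real k) *\<^sub>R p - cell_center u v \<in> grid u v" using c red(2) by simp
  have b: "bij_betw \<phi> UNIV (translated_sublattice p k L - {0})"
    using translated_sublattice_bij[OF d0 k c'] red(2) by (simp add: \<phi>_def)
  have th: "((\<lambda>z. exp (- (t * (norm (\<phi> z))\<^sup>2))) has_sum theta_center ((real k)\<^sup>2 * t / pi) (par_x u v) (par_y u)) UNIV" if "t > 0" for t
  proof -
    have "(\<lambda>z. exp (- (t * (norm (\<phi> z))\<^sup>2))) = (\<lambda>(n::int, m::int). exp (- (pi * ((real k)\<^sup>2 * t / pi) *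
        (((of_int m + 1/2 + (of_int n + 1/2) * par_x u v)\<^sup>2 + ((of_int n + 1/2) * par_y u)\<^sup>2) / par_y u))))"
      by (rule ext) (auto simp: \<phi>_def norm_combination(2)[OF red(1)] power_mult_distrib simp del: scaleR_add_right)
    then show ?thesis using theta_center_has_sum(1)[of "(real k)\<^sup>2 * t / pi" "par_y u" "par_x u v"] that red(5) k by simp
  qed
  have sub: "translated_sublattice p k L - {0} \<subseteq> L - {0}"
  proof -
    have "p + real k *\<^sub>R x \<in> L" if "x \<in> L" for x
      using grid_add[OF p[unfolded red(2)] grid_scale[OF that[unfolded red(2)], of "int k"]] red(2) by simp
    then show ?thesis by (auto simp: translated_sublattice_def)
  qed
  have "\<exists>G. has_bochner_integral \<mu> G (energy f (translated_sublattice p k L)) \<and> (AE t in \<mu>. t > 0 \<and> G t = (\<Sum>\<^sub>\<infinity>z. exp (- (t * (norm (\<phi> z))\<^sup>2))))"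
  proof (rule energy_representation[OF _ _ b])
    show "(\<lambda>z. f ((norm (\<phi> z))\<^sup>2)) summable_on UNIV"
      using summable_on_subset_banach[OF lattice_summable[OF L mb] sub] summable_on_reindex_bij_betw[OF b, of "\<lambda>p. f ((norm p)\<^sup>2)"] by simp
    show "(\<lambda>z. exp (- (t * (norm (\<phi> z))\<^sup>2))) summable_on UNIV" if "t > 0" for t
      using th[OF that] by (rule has_sum_imp_summable)
  qed (auto simp: finite_prod)
  then obtain G where G: "has_bochner_integral \<mu> G (energy f (translated_sublattice p k L))"
    "AE t in \<mu>. t > 0 \<and> G t = (\<Sum>\<^sub>\<infinity>z. exp (- (t * (norm (\<phi> z))\<^sup>2)))" by blast
  from G(2) have "AE t in \<mu>. t > 0 \<and> G t = theta_center ((real k)\<^sup>2 * t / pi) (par_x u v) (par_y u)"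
    by eventually_elim (use th in \<open>auto dest: infsumI\<close>)
  with G(1) show ?thesis by blast
qed

lemma lattice_energy_min:
  assumes L: "L \<in> lattices 1" "minkowski_basis L u v" and L0: "L0 \<in> lattices 1" "minkowski_basis L0 u0 v0" "hexagonal u0 v0"
  shows "energy f L0 \<le> energy f L" "\<not> hexagonal u v \<Longrightarrow> energy f L0 < energy f L"
proof -
  note red = minkowski_reduced[OF L]
  obtain G where G: "has_bochner_integral \<mu> G (energy f L)" "AE t in \<mu>. t > 0 \<and> G t = theta (t / pi) (par_x u v) (par_y u) - 1"
    using lattice_energy[OF L] by blast
  obtain G0 where G0: "has_bochner_integral \<mu> G0 (energy f L0)" "AE t in \<mu>. t > 0 \<and> G0 t = theta (t / pi) (par_x u0 v0) (par_y u0) - 1"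
    using lattice_energy[OF L0(1,2)] by blast
  have less: "theta (t / pi) (par_x u0 v0) (par_y u0) < theta (t / pi) (par_x u v) (par_y u)" if "t > 0" "\<not> hexagonal u v" for t
    using theta_min[of "t / pi", OF _ red(3,4,5)] that hexagonal_theta(1)[OF L0(3), of "t / pi"] by (simp add: hexagonal_def)
  have le: "theta (t / pi) (par_x u0 v0) (par_y u0) \<le> theta (t / pi) (par_x u v) (par_y u)" if "t > 0" for t
    using less[OF that] hexagonal_theta(1)[of u v "t / pi"] hexagonal_theta(1)[OF L0(3), of "t / pi"] that
    by (cases "hexagonal u v") auto
  show "energy f L0 \<le> energy f L"
    by (rule has_bochner_integral_le[OF G0(1) G(1)]) (use G0(2) G(2) in \<open>eventually_elim, use le in auto\<close>)
  show "energy f L0 < energy f L" if "\<not> hexagonal u v"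
    by (rule has_bochner_integral_less[OF G0(1) G(1)]) (use G0(2) G(2) in \<open>eventually_elim, use less[OF _ that] in auto\<close>)
qed

lemma center_energy_max:
  assumes L: "L \<in> lattices 1" "minkowski_basis L u v" and L0: "L0 \<in> lattices 1" "minkowski_basis L0 u0 v0" "hexagonal u0 v0"
    and k: "k > 0" and p: "p \<in> L" "(1 / real k) *\<^sub>R p - cell_center u v \<in> L"
    and p0: "p0 \<in> L0" "(1 / real k) *\<^sub>R p0 - cell_center u0 v0 \<in> L0"
  shows "energy f (translated_sublattice p k L) \<le> energy f (translated_sublattice p0 k L0)"
proof -
  note red = minkowski_reduced[OF L]
  obtain G where G: "has_bochner_integral \<mu> G (energy f (translated_sublattice p k L))"
    "AE t in \<mu>. t > 0 \<and> G t = theta_center ((real k)\<^sup>2 * t / pi) (par_x u v) (par_y u)"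
    using center_energy[OF L k p] by blast
  obtain G0 where G0: "has_bochner_integral \<mu> G0 (energy f (translated_sublattice p0 k L0))"
    "AE t in \<mu>. t > 0 \<and> G0 t = theta_center ((real k)\<^sup>2 * t / pi) (par_x u0 v0) (par_y u0)"
    using center_energy[OF L0(1,2) k p0] by blast
  have le: "theta_center ((real k)\<^sup>2 * t / pi) (par_x u v) (par_y u) \<le> theta_center ((real k)\<^sup>2 * t / pi) (par_x u0 v0) (par_y u0)"
    if "t > 0" for t
  proof -
    have "(real k)\<^sup>2 * t / pi > 0" using that k by simp
    then show ?thesis using theta_center_max[OF _ red(3,4,5)] hexagonal_theta(2)[OF L0(3)] by simp
  qed
  show ?thesis
    by (rule has_bochner_integral_le[OF G(1) G0(1)]) (use G0(2) G(2) in \<open>eventually_elim, use le in auto\<close>)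
qed

end

text \<open>At a rotated triangular lattice the lattice energy is minimal and each defect energy,
  for every single k and i, is maximal, so all comparisons can be made termwise with weights a k >
  0.\<close>

theorem theorem2p4:
  fixes K :: "nat set"
    and a :: "nat \<Rightarrow> real"
    and I :: "nat \<Rightarrow> 'i set"
    and u1 u2 :: "(real^2) set \<Rightarrow> real^2"
    and p :: "(real^2) set \<Rightarrow> 'i \<Rightarrow> nat \<Rightarrow> real^2"
    and f :: "real \<Rightarrow> real"
  assumes "K \<subseteq> {2..}"
    and "\<And>k. k \<in> K \<Longrightarrow> a k > 0"
    and "\<And>k. k \<in> K \<Longrightarrow> finite (I k)"
    and "\<And>L. is_lattice L \<Longrightarrow> minkowski_basis L (u1 L) (u2 L)"
    and "\<And>L k i. is_lattice L \<Longrightarrow> k \<in> K \<Longrightarrow> i \<in> I k \<Longrightarrow> p L i k \<in> L"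
    and "\<And>L k i. is_lattice L \<Longrightarrow> k \<in> K \<Longrightarrow> i \<in> I k \<Longrightarrow>
           (1 / real k) *\<^sub>R p L i k - cell_center (u1 L) (u2 L) \<in> L"
    and "f \<in> cm_potentials"
    and "\<exists>r>0. f r \<noteq> 0"
    and "\<And>L. L \<in> lattices 1 \<Longrightarrow> (\<lambda>k. \<bar>defect_term f a I p L k\<bar>) summable_on K"
  shows "{L. is_arg_min (defect_energy f K a I p) (\<lambda>L. L \<in> lattices 1) L} =
         {(\<lambda>x. Q *v x) ` triangular_lattice | Q :: real^2^2. rotation_matrix Q}"
proof -
  obtain \<mu> q where rep: "radon_measure_half_line \<mu>" "\<forall>r>0. has_bochner_integral \<mu> (\<lambda>t. exp (- (r * t))) (f r)"
    and q: "q > 1" "f \<in> O[at_top](\<lambda>r. r powr (- q))"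
    using assms(7) unfolding cm_potentials_def by blast
  interpret cm_measure \<mu> f q
    using rep q assms(8) by unfold_locales auto
  let ?E = "defect_energy f K a I p"
  let ?T = "{(\<lambda>x. Q *v x) ` triangular_lattice | Q :: real^2^2. rotation_matrix Q}"
  have isl: "is_lattice L" if "L \<in> lattices 1" for L
    using that by (auto simp: lattices_def is_lattice_def)
  have mb: "minkowski_basis L (u1 L) (u2 L)" if "L \<in> lattices 1" for L
    using assms(4)[OF isl[OF that]] .
  define hex where "hex = (\<lambda>L. hexagonal (u1 L) (u2 L))"
  \<comment> \<open>\<open>hex\<close> speaks of the given basis of L, but by this equivalence it
    depends on L alone.\<close>
  have T: "L \<in> ?T \<longleftrightarrow> L \<in> lattices 1 \<and> hex L" for L
  proof
    assume "L \<in> ?T"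
    then obtain Q :: "real^2^2" where Q: "rotation_matrix Q" "L = (\<lambda>x. Q *v x) ` triangular_lattice" by blast
    then have L: "L \<in> lattices 1" using rotated_triangular_lattice by simp
    then show "L \<in> lattices 1 \<and> hex L"
      using rotated_triangular_params[OF Q(1), of "u1 L" "u2 L"] mb[OF L] Q(2) by (simp add: hex_def hexagonal_def)
  next
    assume L: "L \<in> lattices 1 \<and> hex L"
    note red = minkowski_reduced[OF conjunct1[OF L] mb[OF conjunct1[OF L]]]
    have "\<bar>par_x (u1 L) (u2 L)\<bar> = 1/2" "par_y (u1 L) = sqrt 3 / 2"
      using conjunct2[OF L] by (simp_all add: hex_def hexagonal_def)
    from params_rotated_triangular[OF red(1) this]
    show "L \<in> ?T" unfolding red(2)[symmetric] by blast
  qed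
  have defect: "defect_term f a I p L k \<le> defect_term f a I p L0 k"
    if "L \<in> lattices 1" "L0 \<in> lattices 1" "hex L0" "k \<in> K" for L L0 k
    unfolding defect_term_def
  proof (rule sum_mono)
    fix i assume i: "i \<in> I k"
    have "k > 0" using assms(1) that(4) by force
    then have "energy f (translated_sublattice (p L i k) k L) \<le> energy f (translated_sublattice (p L0 i k) k L0)"
      using that i assms(5,6) isl by (intro center_energy_max[where u = "u1 L" and v = "u2 L" and ?u0.0 = "u1 L0" and ?v0.0 = "u2 L0"] mb)
        (auto simp: hex_def)
    then show "a k * energy f (translated_sublattice (p L i k) k L) \<le> a k * energy f (translated_sublattice (p L0 i k) k L0)"
      using assms(2)[OF that(4)] by (intro mult_left_mono) auto
  qed
  have sums: "defect_term f a I p L summable_on K" if "L \<in> lattices 1" for L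
  proof (rule iffD2[OF summable_on_iff_abs_summable_on_real])
    show "(\<lambda>k. norm (defect_term f a I p L k)) summable_on K"
      using assms(9)[OF that] unfolding real_norm_def .
  qed
  \<comment> \<open>The subtracted sums only need the weak inequality; the strict one is carried by
    the lattice energy when L is not hexagonal.\<close>
  have le: "?E L0 \<le> ?E L" "\<not> hex L \<Longrightarrow> ?E L0 < ?E L" if L: "L \<in> lattices 1" and L0: "L0 \<in> lattices 1" "hex L0" for L L0
  proof -
    have d: "(\<Sum>\<^sub>\<infinity>k\<in>K. defect_term f a I p L k) \<le> (\<Sum>\<^sub>\<infinity>k\<in>K. defect_term f a I p L0 k)"
      by (intro infsum_mono sums defect L L0)
    note e = lattice_energy_min[OF L mb[OF L] L0(1) mb[OF L0(1)] L0(2)[unfolded hex_def]]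
    show "?E L0 \<le> ?E L" using d e(1) by (simp add: defect_energy_def)
    show "?E L0 < ?E L" if "\<not> hex L" using d e(2) that by (simp add: defect_energy_def hex_def)
  qed
  have id: "(\<lambda>x. mat 1 *v x) ` triangular_lattice = triangular_lattice" by simp
  have "rotation_matrix (mat 1 :: real^2^2)" by (simp add: rotation_matrix_def orthogonal_matrix_id)
  then have "triangular_lattice \<in> ?T" using id by blast
  then have A: "triangular_lattice \<in> lattices 1" "hex triangular_lattice" using T by blast+
  show ?thesis
  proof (rule set_eqI)
    fix L
    have "is_arg_min ?E (\<lambda>L. L \<in> lattices 1) L \<longleftrightarrow> L \<in> lattices 1 \<and> hex L"
    proof
      assume m: "is_arg_min ?E (\<lambda>L. L \<in> lattices 1) L"
      then have L: "L \<in> lattices 1" by (simp add: is_arg_min_def)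
      moreover have "hex L"
        using le(2)[OF L A] m A(1) by (auto simp: is_arg_min_def)
      ultimately show "L \<in> lattices 1 \<and> hex L" ..
    next
      assume L: "L \<in> lattices 1 \<and> hex L"
      then show "is_arg_min ?E (\<lambda>L. L \<in> lattices 1) L"
        using le(1)[of _ L] by (auto simp: is_arg_min_def not_less)
    qed
    then show "L \<in> {L. is_arg_min ?E (\<lambda>L. L \<in> lattices 1) L} \<longleftrightarrow> L \<in> ?T"
      unfolding T by simp
  qed
qed

end
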